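(* Let $M$ be a positive integer and let $m$ be a non-negative integer such that $\gcd(M,2m+2)=1$ if $m>0$. Let $s\in\mathbb{Z}$, $0\le s\le m$, let $\epsilon,\epsilon'\in\{0,\tfrac12\}$, and let $j,k\in\epsilon'+\mathbb{Z}$ with $0\le j,k<M$. Then the modified normalized (twisted) (super)characters satisfy $$\widetilde{ch}^{[M,m,s;\epsilon]}_{j,k;\epsilon'}\Big(-\frac1\tau,\frac{z_1}{\tau},\frac{z_2}{\tau},t-\frac{z_1z_2}{\tau}\Big)=(-1)^{4\epsilon\epsilon'}\frac1M\sum_{\substack{a,b\in\epsilon+\mathbb{Z}\\0\le a,b<M}}e^{-\frac{2\pi i(m+1)}{M}(ak+bj)}\,\widetilde{ch}^{[M,m,s;\epsilon']}_{a,b;\epsilon}(\tau,z_1,z_2,t),$$ $$\widetilde{ch}^{[M,m,s;\epsilon]}_{j,k;\epsilon'}(\tau+1,z_1,z_2,t)=e^{2\pi i\frac{(m+1)jk}{M}-\pi i\epsilon'}\;\widetilde{ch}^{[M,m,s;|\epsilon-\epsilon'|]}_{j,k;\epsilon'}(\tau,z_1,z_2,t).$$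
   Context: Variables: $\tau,z_1,z_2,t\in\mathbb{C}$, $\mathrm{Im}\,\tau>0$, $q^r=e^{2\pi i r\tau}$. All identities are identities of functions away from poles. For integers $m\ge0$, $0\le s\le m$ and $j\in\mathbb{Z}$ put $\Theta_{j,m+1}(\tau,z)=\sum_{n\in\mathbb{Z}}e^{2\pi i(m+1)z(n+\frac{j}{2(m+1)})}q^{(m+1)(n+\frac{j}{2(m+1)})^2}$, $$\Phi_1^{[m;s]}(\tau,z_1,z_2)=\sum_{j\in\mathbb{Z}}\frac{e^{2\pi i(m+1)j(z_1+z_2)}e^{-2\pi i s z_1}q^{j^2(m+1)-js}}{1-e^{2\pi i z_1}q^j},$$ $$\Phi^{[m;s]}(\tau,z_1,z_2,t)=e^{2\pi i(m+1)t}\big(\Phi_1^{[m;s]}(\tau,z_1,z_2)-\Phi_1^{[m;s]}(\tau,-z_2,-z_1)\big).$$ With $E(x)=2\int_0^xe^{-\pi u^2}du$, put $$R_{j;m+1}(\tau,v)=\sum_{\substack{n\in\mathbb{Z}\\ n\equiv-j\ \mathrm{mod}\ 2(m+1)}}\Big(\mathrm{sgn}\big(n+\tfrac12+j-2(m+1)\big)-E\Big(\big(n+2(m+1)\tfrac{\mathrm{Im}\,v}{\mathrm{Im}\,\tau}\big)\sqrt{\tfrac{\mathrm{Im}\,\tau}{m+1}}\Big)\Big)e^{-\frac{\pi i n^2}{2(m+1)}\tau-2\pi i nv},$$ $$\Phi^{[m;s]}_{\rm add}(\tau,z_1,z_2,t)=\tfrac12e^{2\pi i(m+1)t}\sum_{j=-s}^{-s+2m+1}R_{j;m+1}\big(\tau,\tfrac{z_1-z_2}{2}\big)\,(\Theta_{j,m+1}-\Theta_{-j,m+1})(\tau,z_1+z_2),$$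 and $\widetilde\Phi^{[m;s]}=\Phi^{[m;s]}+\Phi^{[m;s]}_{\rm add}$. For $\epsilon,\epsilon'\in\{0,\frac12\}$ and $a,b\in\epsilon'+\mathbb{Z}$ put $$\widetilde\Psi^{[M,m,s;\epsilon]}_{a,b;\epsilon'}(\tau,z_1,z_2,t)=q^{\frac{(m+1)ab}{M}}e^{\frac{2\pi i(m+1)}{M}(bz_1+az_2)}\,\widetilde\Phi^{[m;s]}\big(M\tau,z_1+a\tau+\epsilon,z_2+b\tau+\epsilon,\tfrac tM\big).$$ Jacobi theta functions ($a,b\in\{0,1\}$): $\vartheta_{ab}(\tau,z)=\sum_{n\in\mathbb{Z}}e^{\pi i\tau(n+\frac a2)^2+2\pi i(n+\frac a2)(z+\frac b2)}$; $\eta(\tau)=q^{1/24}\prod_{n\ge1}(1-q^n)$. The normalized (twisted) (super)denominators of $\widehat{s\ell}_{2|1}$ are $$\widehat R^{(\epsilon)}_{\epsilon'}(\tau,z_1,z_2,t)=(-1)^{2\epsilon(1-2\epsilon')}\,i\,e^{2\pi it}\,\frac{\eta(\tau)^3\,\vartheta_{11}(\tau,z_1+z_2)}{\vartheta_{1-2\epsilon',1-2\epsilon}(\tau,z_1)\,\vartheta_{1-2\epsilon',1-2\epsilon}(\tau,z_2)}.$$ The modified normalized characters ($\epsilon=\frac12,\epsilon'=0$), supercharacters ($\epsilon=\epsilon'=0$), twisted characters ($\epsilon=\epsilon'=\frac12$) and twisted supercharacters ($\epsilon=0,\epsilon'=\frac12$) of the principal admissible $\widehat{s\ell}_{2|1}$-modules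 are $$\widetilde{ch}^{[M,m,s;\epsilon]}_{j,k;\epsilon'}(\tau,z_1,z_2,t)=\frac{\widetilde\Psi^{[M,m,s;\epsilon]}_{j,k;\epsilon'}(\tau,z_1,z_2,t)}{\widehat R^{(\epsilon)}_{\epsilon'}(\tau,z_1,z_2,t)},\qquad j,k\in\epsilon'+\mathbb{Z},\ 0\le j,k<M.$$ *)

theory Defs
  imports "HOL-Analysis.Analysis" "HOL-Number_Theory.Cong"
begin

text \<open>
  Sums over the integers are unordered sums. All of them converge absolutely for
  \<open>Im \<tau> > 0\<close>, as long as no denominator of \<open>Phi1\<close> vanishes.
\<close>

definition e2pi :: "complex \<Rightarrow> complex" where
  "e2pi x = exp (2 * of_real pi * \<i> * x)"

text \<open>\<open>qpow \<tau> r\<close> is \<open>q\<^sup>r\<close>; the real exponent makes no choice of a branch necessary.\<close>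

definition qpow :: "complex \<Rightarrow> real \<Rightarrow> complex" where
  "qpow \<tau> r = e2pi (of_real r * \<tau>)"


text \<open>In \<open>Theta\<close> and \<open>R_corr\<close> the argument \<open>N\<close> is the full index \<open>m + 1\<close>.\<close>

definition Theta :: "int \<Rightarrow> nat \<Rightarrow> complex \<Rightarrow> complex \<Rightarrow> complex" where
  "Theta j N \<tau> z =
     (\<Sum>\<^sub>\<infinity>n::int. e2pi (of_nat N * z * of_real (of_int n + of_int j / (2 * of_nat N)))
                 * qpow \<tau> (of_nat N * (of_int n + of_int j / (2 * of_nat N))\<^sup>2))"

definition Phi1 :: "nat \<Rightarrow> nat \<Rightarrow> complex \<Rightarrow> complex \<Rightarrow> complex \<Rightarrow> complex" where
  "Phi1 m s \<tau> z1 z2 =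
     (\<Sum>\<^sub>\<infinity>j::int. e2pi (of_nat (m + 1) * of_int j * (z1 + z2)) * e2pi (- of_nat s * z1)
                   * qpow \<tau> ((of_int j)\<^sup>2 * of_nat (m + 1) - of_int j * of_nat s)
                 / (1 - e2pi z1 * qpow \<tau> (of_int j)))"

definition Phi :: "nat \<Rightarrow> nat \<Rightarrow> complex \<Rightarrow> complex \<Rightarrow> complex \<Rightarrow> complex \<Rightarrow> complex" where
  "Phi m s \<tau> z1 z2 t =
     e2pi (of_nat (m + 1) * t) * (Phi1 m s \<tau> z1 z2 - Phi1 m s \<tau> (- z2) (- z1))"

text \<open>The interval integral is oriented, so \<open>E_fun\<close> is odd.\<close>

definition E_fun :: "real \<Rightarrow> real" where
  "E_fun x = 2 * (LBINT u=0..ereal x. exp (- pi * u\<^sup>2))"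

definition R_corr :: "int \<Rightarrow> nat \<Rightarrow> complex \<Rightarrow> complex \<Rightarrow> complex" where
  "R_corr j N \<tau> v =
     (\<Sum>\<^sub>\<infinity>n\<in>{n::int. [n = - j] (mod (2 * int N))}.
        of_real (sgn (of_int n + 1 / 2 + of_int j - 2 * of_nat N)
                 - E_fun ((of_int n + 2 * of_nat N * Im v / Im \<tau>) * sqrt (Im \<tau> / of_nat N)))
        * exp (- (of_real pi * \<i> * (of_int n)\<^sup>2 / (2 * of_nat N)) * \<tau>
               - 2 * of_real pi * \<i> * of_int n * v))"

definition Phi_add :: "nat \<Rightarrow> nat \<Rightarrow> complex \<Rightarrow> complex \<Rightarrow> complex \<Rightarrow> complex \<Rightarrow> complex" where
  "Phi_add m s \<tau> z1 z2 t =
     1 / 2 * e2pi (of_nat (m + 1) * t)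
     * (\<Sum>j\<in>{- int s..- int s + 2 * int m + 1}.
          R_corr j (m + 1) \<tau> ((z1 - z2) / 2)
          * (Theta j (m + 1) \<tau> (z1 + z2) - Theta (- j) (m + 1) \<tau> (z1 + z2)))"

definition Phi_mod :: "nat \<Rightarrow> nat \<Rightarrow> complex \<Rightarrow> complex \<Rightarrow> complex \<Rightarrow> complex \<Rightarrow> complex" where
  "Phi_mod m s \<tau> z1 z2 t = Phi m s \<tau> z1 z2 t + Phi_add m s \<tau> z1 z2 t"

text \<open>
  In \<open>Psi_mod\<close>, \<open>R_hat\<close> and \<open>ch_mod\<close> the first of the two real parameters is the superscript
  \<open>\<epsilon>\<close>, the second the subscript \<open>\<epsilon>'\<close>. In \<open>Psi_mod\<close> and \<open>ch_mod\<close> the latter only restricts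
  the range \<open>\<epsilon>' + \<int>\<close> of \<open>a\<close> and \<open>b\<close>; it does not enter the formula for \<open>Psi_mod\<close>.
\<close>

definition Psi_mod ::
  "nat \<Rightarrow> nat \<Rightarrow> nat \<Rightarrow> real \<Rightarrow> real \<Rightarrow> real \<Rightarrow> real
     \<Rightarrow> complex \<Rightarrow> complex \<Rightarrow> complex \<Rightarrow> complex \<Rightarrow> complex" where
  "Psi_mod M m s \<epsilon> \<epsilon>' a b \<tau> z1 z2 t =
     qpow \<tau> (of_nat (m + 1) * a * b / of_nat M)
     * e2pi (of_nat (m + 1) / of_nat M * (of_real b * z1 + of_real a * z2))
     * Phi_mod m s (of_nat M * \<tau>)
         (z1 + of_real a * \<tau> + of_real \<epsilon>) (z2 + of_real b * \<tau> + of_real \<epsilon>) (t / of_nat M)"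


text \<open>The Jacobi theta function \<open>\<vartheta>\<^sub>a\<^sub>b\<close>, used for \<open>a, b \<in> {0, 1}\<close> only.\<close>

definition jtheta :: "real \<Rightarrow> real \<Rightarrow> complex \<Rightarrow> complex \<Rightarrow> complex" where
  "jtheta a b \<tau> z =
     (\<Sum>\<^sub>\<infinity>n::int. exp (of_real pi * \<i> * \<tau> * of_real ((of_int n + a / 2)\<^sup>2)
                     + 2 * of_real pi * \<i> * of_real (of_int n + a / 2) * (z + of_real (b / 2))))"

definition eta :: "complex \<Rightarrow> complex" where
  "eta \<tau> = qpow \<tau> (1 / 24) * (\<Prod>n. 1 - qpow \<tau> (of_nat (Suc n)))"

text \<open>
  The exponent of \<open>-1\<close> is \<open>0\<close> or \<open>1\<close> for \<open>\<epsilon>, \<epsilon>' \<in> {0, 1/2}\<close>, and complex \<open>powr\<close> then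
  is the ordinary power.
\<close>

definition R_hat ::
  "real \<Rightarrow> real \<Rightarrow> complex \<Rightarrow> complex \<Rightarrow> complex \<Rightarrow> complex \<Rightarrow> complex" where
  "R_hat \<epsilon> \<epsilon>' \<tau> z1 z2 t =
     (-1) powr of_real (2 * \<epsilon> * (1 - 2 * \<epsilon>')) * \<i> * e2pi t
     * ((eta \<tau>) ^ 3 * jtheta 1 1 \<tau> (z1 + z2)
        / (jtheta (1 - 2 * \<epsilon>') (1 - 2 * \<epsilon>) \<tau> z1 * jtheta (1 - 2 * \<epsilon>') (1 - 2 * \<epsilon>) \<tau> z2))"

definition ch_mod ::
  "nat \<Rightarrow> nat \<Rightarrow> nat \<Rightarrow> real \<Rightarrow> real \<Rightarrow> real \<Rightarrow> real
     \<Rightarrow> complex \<Rightarrow> complex \<Rightarrow> complex \<Rightarrow> complex \<Rightarrow> complex" where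
  "ch_mod M m s \<epsilon> \<epsilon>' j k \<tau> z1 z2 t =
     Psi_mod M m s \<epsilon> \<epsilon>' j k \<tau> z1 z2 t / R_hat \<epsilon> \<epsilon>' \<tau> z1 z2 t"

definition idx :: "nat \<Rightarrow> real \<Rightarrow> real set" where
  "idx M \<epsilon> = {a. a - \<epsilon> \<in> \<int> \<and> 0 \<le> a \<and> a < of_nat M}"

lemma finite_idx: "finite (idx M \<epsilon>)"
proof -
  have "idx M \<epsilon> \<subseteq> (\<lambda>n. of_int n + \<epsilon>) ` {\<lfloor>- \<epsilon>\<rfloor>..\<lceil>of_nat M - \<epsilon>\<rceil>}"
  proof
    fix a assume a: "a \<in> idx M \<epsilon>"
    then obtain n where n: "a - \<epsilon> = of_int n"
      by (auto simp: idx_def elim: Ints_cases)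
    have "n \<in> {\<lfloor>- \<epsilon>\<rfloor>..\<lceil>of_nat M - \<epsilon>\<rceil>}"
      using a n unfolding idx_def by auto linarith+
    with n show "a \<in> (\<lambda>n. of_int n + \<epsilon>) ` {\<lfloor>- \<epsilon>\<rfloor>..\<lceil>of_nat M - \<epsilon>\<rceil>}"
      by (intro image_eqI[of _ _ n]) auto
  qed
  then show ?thesis
    by (rule finite_subset) simp
qed

text \<open>
  The points at which every term of the defining formula of
  \<open>ch_mod M m s \<epsilon> \<epsilon>' a b \<tau> z1 z2 t\<close> (\<open>a, b \<in> \<epsilon>' + \<int>\<close>) makes sense. For \<open>z = z1\<close> and \<open>z = z2\<close>, the
  coset \<open>\<epsilon> + \<int> + (\<epsilon>' + \<int>) \<tau>\<close> is the set of zeros of the theta function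
  \<open>jtheta (1 - 2 * \<epsilon>') (1 - 2 * \<epsilon>) \<tau>\<close> in the denominator of \<open>R_hat\<close>; it contains all points
  at which a denominator \<open>1 - e2pi (z + a * \<tau> + \<epsilon>) * qpow (M * \<tau>) j\<close> in \<open>Psi_mod\<close>
  vanishes (and likewise for \<open>- z\<close>, the coset being symmetric). The lattice \<open>\<int> + \<int> \<tau>\<close> is the
  set of zeros of \<open>jtheta 1 1 \<tau>\<close>, that is, of \<open>R_hat\<close>. The condition is invariant under the
  two transformations: passing to \<open>(-1/\<tau>, z1/\<tau>, z2/\<tau>)\<close> interchanges \<open>\<epsilon>\<close> and \<open>\<epsilon>'\<close>, and passing
  to \<open>\<tau> + 1\<close> replaces \<open>\<epsilon>\<close> by \<open>\<bar>\<epsilon> - \<epsilon>'\<bar>\<close>.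
\<close>

definition coset :: "real \<Rightarrow> real \<Rightarrow> complex \<Rightarrow> complex set" where
  "coset \<epsilon> \<epsilon>' \<tau> = {of_real x + of_real y * \<tau> | x y. x - \<epsilon> \<in> \<int> \<and> y - \<epsilon>' \<in> \<int>}"

definition pole_free :: "real \<Rightarrow> real \<Rightarrow> complex \<Rightarrow> complex \<Rightarrow> complex \<Rightarrow> bool" where
  "pole_free \<epsilon> \<epsilon>' \<tau> z1 z2 \<longleftrightarrow>
     z1 \<notin> coset \<epsilon> \<epsilon>' \<tau> \<and> z2 \<notin> coset \<epsilon> \<epsilon>' \<tau> \<and> z1 + z2 \<notin> coset 0 0 \<tau>"

end

theory Submission
  imports Defs "HOL-Complex_Analysis.Complex_Analysis" "HOL-Probability.Probability"
begin

text \<open>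
  Write \<open>N = m + 1\<close> and \<open>e(x)\<close> for \<open>e2pi x\<close>. The functions \<open>Phi_mod\<close> are non-holomorphic completions of Appell
  sums, and the proof rests on another expression for them. Let
  \<open>S(\<tau>, z1, z2)\<close> be the sum of
  \<open>e(N (a\<^sup>2 \<tau> + a (z1 + z2))) exp(- \<pi> N \<zeta>\<^sup>2 / Im \<tau>) e(N \<zeta> Im (z1 - z2) / Im \<tau>) / \<zeta>\<close> over all lattice points
  \<open>a \<tau> + b\<close>, where \<open>\<zeta> = z1 + a \<tau> + b\<close>. It converges absolutely, and
  \<open>Phi_mod m s \<tau> z1 z2 t\<close> is \<open>\<i> / (2 \<pi>) e(N t)\<close> times \<open>S(\<tau>, z1, z2) - S(\<tau>, - z2, - z1)\<close>, for every \<open>s\<close> and away from the poles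
  (\<open>Phi_mod_eq_lattice_sums\<close>).

  In this form the transformations act on single terms. If imaginary parts are written with complex
  conjugates, the term of \<open>(a, b)\<close> at \<open>(-1/\<tau>, z1/\<tau>, z2/\<tau>)\<close> is seen to be the term of \<open>(b, -a)\<close> at
  \<open>(\<tau>, z1, z2)\<close>, up to the factor \<open>\<tau> e(N z1 z2 / \<tau>)\<close>. Replacing \<open>\<tau>\<close> by \<open>\<tau> + 1\<close>, or shifting \<open>z1\<close> and \<open>z2\<close> by
  integers, only relabels the lattice points. The sum over \<open>a\<close> and \<open>b\<close> in the first formula of the
  theorem is explained by \<open>lattice_sum_isogeny\<close>: in a combination of the sums
  \<open>S(M \<tau>, x1 + \<alpha> \<tau>, x2 + \<beta> \<tau>)\<close> the sum over the residues \<open>\<beta>\<close> modulo \<open>M\<close> is a sum of roots of unity, which, as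
  \<open>N\<close> is prime to \<open>M\<close>, leaves only the lattice points whose integer part is divisible by \<open>M\<close>; the sum over \<open>\<alpha>\<close> collects the
  residue classes of the coefficient of \<open>\<tau>\<close>. Up to an elementary factor, what remains is \<open>S(\<tau> / M, x1 / M, x2 / M)\<close>, or, if the
  indices \<open>\<alpha>\<close> and \<open>\<beta>\<close> run through \<open>1/2 + \<int>\<close>, the same with \<open>\<tau> / 2\<close> added to \<open>x1\<close> and \<open>x2\<close>. Inversion relates this to
  the modulus \<open>- M / \<tau>\<close> on the left-hand side.

  The lattice sum formula is proved row by row, that is, for fixed \<open>a\<close>. There it becomes
  \<open>kernel_identity\<close>, which compares two functions of \<open>z \<notin> \<int>\<close> and of a real parameter \<open>r\<close>: a geometric
  term plus a Fourier series with coefficients built from the error function, and a sum of Gaussians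
  divided by \<open>z + b\<close>. Their derivatives with respect to \<open>r\<close> are two Gaussian sums, proportional to each other by
  the inversion formula of the theta function, with a factor independent of \<open>r\<close> and \<open>z\<close>. Both functions are
  multiplied by \<open>e(z)\<close> if \<open>r\<close> increases by 1; a difference that is constant in \<open>r\<close> must therefore vanish. The
  factor is \<open>1\<close>, since both functions have the same residue at \<open>z = 0\<close>.

  For the denominators, \<open>\<vartheta>\<^sub>0\<^sub>0\<close> is inverted up to a factor \<open>C\<close> that depends on \<open>\<tau>\<close> only, because entire functions with
  the periodicity of \<open>\<vartheta>\<^sub>0\<^sub>0\<close> are proportional (\<open>quasi_periodic_unique\<close>). The other theta functions are translates
  of \<open>\<vartheta>\<^sub>0\<^sub>0\<close> and share \<open>C\<close>, and so does \<open>\<eta>\<^sup>3\<close>, because \<open>\<vartheta>\<^sub>1\<^sub>1\<close> has the derivative \<open>- 2 \<pi> \<eta>\<^sup>3\<close> at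
  \<open>0\<close>. In \<open>R_hat\<close> the two factors \<open>C\<close> of the numerator cancel the two of the denominator. The derivative is
  evaluated with Jacobi's identity \<open>jacobi_cube\<close>, a limit of a finite identity that comes from the
  q-binomial theorem.
\<close>

section \<open>The exponential function of period 1\<close>

lemma e2pi_0 [simp]: "e2pi 0 = 1"
  by (simp add: e2pi_def)

lemma e2pi_add: "e2pi (x + y) = e2pi x * e2pi y"
  by (simp add: e2pi_def exp_add[symmetric] algebra_simps)

lemma e2pi_nz [simp]: "e2pi x \<noteq> 0"
  by (simp add: e2pi_def)

lemma e2pi_minus: "e2pi (- x) = inverse (e2pi x)"
  by (simp add: e2pi_def exp_minus)

lemma norm_e2pi: "norm (e2pi x) = exp (- 2 * pi * Im x)"
  by (simp add: e2pi_def norm_exp_eq_Re)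

lemma e2pi_eq_1_iff: "e2pi z = 1 \<longleftrightarrow> z \<in> \<int>"
proof -
  have "e2pi z = 1 \<longleftrightarrow> Im z = 0 \<and> (\<exists>n::int. Re z = n)"
    by (simp add: e2pi_def exp_eq_1 mult.assoc mult_cancel_left)
  also have "\<dots> \<longleftrightarrow> z \<in> \<int>"
    by (auto simp: Ints_def complex_eq_iff image_iff)
  finally show ?thesis .
qed

lemma e2pi_of_int [simp]: "e2pi (of_int n) = 1"
  by (simp add: e2pi_eq_1_iff)

lemma e2pi_add_int [simp]: "e2pi (x + of_int n) = e2pi x"
  by (simp add: e2pi_add)

lemma e2pi_power: "e2pi x ^ n = e2pi (of_nat n * x)"
  by (simp add: e2pi_def exp_of_nat_mult[symmetric] algebra_simps)

lemma DERIV_e2pi [derivative_intros]: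
  "(f has_field_derivative f') (at x within A) \<Longrightarrow>
   ((\<lambda>x. e2pi (f x)) has_field_derivative (2 * of_real pi * \<i> * f' * e2pi (f x))) (at x within A)"
  unfolding e2pi_def by (auto intro!: derivative_eq_intros)

lemma DERIV_e2pi_primitive:
  assumes "c \<noteq> 0"
  shows "((\<lambda>z. e2pi (c * z) / (2 * of_real pi * \<i> * c)) has_field_derivative e2pi (c * z)) (at z)"
proof -
  have "((\<lambda>z. e2pi (c * z) / (2 * of_real pi * \<i> * c)) has_field_derivative
      (2 * of_real pi * \<i> * (c * 1) * e2pi (c * z)) / (2 * of_real pi * \<i> * c)) (at z)"
    by (intro DERIV_cdivide DERIV_e2pi DERIV_cmult DERIV_ident)
  then show ?thesis using assms by simp
qed

lemma holomorphic_e2pi [holomorphic_intros]: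
  "f holomorphic_on A \<Longrightarrow> (\<lambda>x. e2pi (f x)) holomorphic_on A"
  unfolding e2pi_def by (intro holomorphic_intros)

section \<open>Gaussian sums\<close>

lemma summable_on_exp_abs_int: "(\<lambda>n::int. exp (- \<bar>real_of_int n\<bar>)) summable_on UNIV"
proof -
  have 1: "(\<lambda>n::nat. exp (- real n)) summable_on UNIV"
  proof (rule norm_summable_imp_summable_on)
    have "summable (\<lambda>n. exp (-1::real) ^ n)" by (rule summable_geometric) simp
    then show "summable (\<lambda>n. norm (exp (- real n)))"
      by (simp add: exp_of_nat_mult[symmetric])
  qed
  have "(\<lambda>n::int. exp (- \<bar>real_of_int n\<bar>)) summable_on (range int)"
    by (subst summable_on_reindex) (use 1 in \<open>auto simp: o_def\<close>)
  moreover have "(\<lambda>n::int. exp (- \<bar>real_of_int n\<bar>)) summable_on (range (\<lambda>n. - int n))"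
    by (subst summable_on_reindex) (use 1 in \<open>auto simp: o_def inj_on_def\<close>)
  ultimately have "(\<lambda>n::int. exp (- \<bar>real_of_int n\<bar>)) summable_on (range int \<union> range (\<lambda>n. - int n))"
    by (rule summable_on_union)
  moreover have "range int \<union> range (\<lambda>n. - int n) = UNIV"
    by (auto simp: image_iff) (metis int_cases2)
  ultimately show ?thesis by simp
qed

text \<open>
  Completing the square bounds the exponent by a constant minus \<open>\<bar>n\<bar>\<close>. This series dominates all
  one-dimensional sums below.
\<close>

lemma summable_on_gauss_int:
  assumes "a > 0"
  shows "(\<lambda>n::int. exp (c * \<bar>real_of_int n\<bar> - a * (real_of_int n)\<^sup>2)) summable_on UNIV"
proof -
  \<comment> \<open>the maximum of \<open>(c + 1) * x - a * x\<^sup>2\<close>\<close>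
  define K where "K = (c + 1)\<^sup>2 / (4 * a)"
  have *: "c * \<bar>x\<bar> - a * x\<^sup>2 \<le> K - \<bar>x\<bar>" for x :: real
  proof -
    have "0 \<le> (2 * a * \<bar>x\<bar> - (c + 1))\<^sup>2" by simp
    also have "\<dots> = 4 * a * (a * x\<^sup>2 - (c + 1) * \<bar>x\<bar> + K)"
      using assms by (simp add: K_def power2_eq_square field_simps)
    finally have "0 \<le> a * x\<^sup>2 - (c + 1) * \<bar>x\<bar> + K"
      using assms by (simp add: zero_le_mult_iff)
    then show ?thesis by (simp add: algebra_simps)
  qed
  have "(\<lambda>n::int. exp K * exp (- \<bar>real_of_int n\<bar>)) summable_on UNIV"
    by (intro summable_on_cmult_right summable_on_exp_abs_int)
  then show ?thesis
    by (rule summable_on_comparison_test)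
       (use * in \<open>auto simp: exp_add[symmetric]\<close>)
qed

section \<open>Uniqueness of quasi-periodic entire functions\<close>

text \<open>
  In this section the integral of a function over a period appears as the increment of a primitive. That the
  increment does not depend on the base point, and how it changes with the function, is always
  obtained from this lemma.
\<close>

lemma zero_derivative_const_on_convex:
  fixes f :: "complex \<Rightarrow> complex"
  assumes "convex S" "\<And>z. z \<in> S \<Longrightarrow> (f has_field_derivative 0) (at z)" "x \<in> S" "y \<in> S"
  shows "f x = f y"
proof -
  have "\<exists>c. \<forall>z\<in>S. f z = c"
    using assms by (intro has_field_derivative_zero_constant)
       (auto intro: has_field_derivative_at_within)
  then show ?thesis using assms by auto
qed

text \<open>
  A periodic primitive of \<open>F z * e2pi (k * z)\<close> means that the corresponding Fourier coefficient of \<open>F\<close> vanishes.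
  The quotient \<open>k(z) = (F z - F 0) / (e2pi z - 1)\<close> is again holomorphic and has period 1. Let \<open>c\<^sub>n\<close> be the integral of
  \<open>k(z) * e2pi (n * z)\<close> over a period. Multiplication of the integrand by \<open>e2pi z - 1\<close> shows that
  \<open>c\<^bsub>n+1\<^esub> - c\<^sub>n\<close> is the \<open>n\<close>-th Fourier coefficient of \<open>F - F 0\<close>, that is, \<open>- F 0\<close> for \<open>n = 0\<close> and \<open>0\<close> otherwise. On the
  lines \<open>Im z = 1\<close> and \<open>Im z = - 1\<close> one sees that \<open>c\<^sub>n\<close> tends to \<open>0\<close> as \<open>n\<close> tends to \<open>\<infinity>\<close> and to \<open>-\<infinity>\<close>.
  Being constant for \<open>n \<ge> 1\<close> and for \<open>n \<le> 0\<close>, it is \<open>0\<close>, and \<open>F 0 = 0\<close>.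
\<close>

lemma periodic_fourier_zero_imp_zero_at_0:
  fixes F :: "complex \<Rightarrow> complex"
  assumes hol: "F holomorphic_on UNIV"
    and per: "\<And>z. F (z + 1) = F z"
    and prim: "\<And>z k. (G k has_field_derivative F z * e2pi (of_int k * z)) (at z)"
    and perG: "\<And>z k. G k (z + 1) = G k z"
  shows "F 0 = 0"
proof -
  \<comment> \<open>difference quotients at \<open>0\<close>: \<open>p / s\<close> is \<open>(F z - F 0) / (e2pi z - 1)\<close> without its removable singularity\<close>
  define p where "p = (\<lambda>z. if z = 0 then deriv F 0 else (F z - F 0) / (z - 0))"
  define s where "s = (\<lambda>z. if z = 0 then deriv e2pi 0 else (e2pi z - e2pi 0) / (z - 0))"
  define S S' where "S = {z::complex. \<bar>Re z\<bar> < 1}" and "S' = {z::complex. \<bar>Re z\<bar> < 1/2}"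
  have S_alt: "S = {z. Re z < 1} \<inter> {z. Re z > -1}" and S'_alt: "S' = {z. Re z < 1/2} \<inter> {z. Re z > -1/2}"
    by (auto simp: S_def S'_def)
  have convS: "convex S" and convS': "convex S'"
    unfolding S_alt S'_alt by (intro convex_Int convex_halfspace_Re_gt convex_halfspace_Re_lt)+
  have opS: "open S"
    unfolding S_alt by (intro open_Int open_halfspace_Re_gt open_halfspace_Re_lt)
  have p: "p holomorphic_on UNIV" unfolding p_def
    by (rule pole_lemma_open[OF hol]) auto
  have s: "s holomorphic_on UNIV" unfolding s_def
    by (rule pole_lemma_open) (auto intro!: holomorphic_intros)
  have e1: "e2pi z \<noteq> 1" if "z \<in> S" "z \<noteq> 0" for z
  proof
    assume "e2pi z = 1"
    then obtain n where n: "z = of_int n" by (auto simp: e2pi_eq_1_iff elim: Ints_cases)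
    with that have "n = 0" by (auto simp: S_def)
    with n that show False by simp
  qed
  have s0: "s z \<noteq> 0" if "z \<in> S" for z
  proof (cases "z = 0")
    case True
    have "deriv e2pi 0 = 2 * of_real pi * \<i> * 1 * e2pi 0"
      by (rule DERIV_imp_deriv) (rule DERIV_e2pi, rule DERIV_ident)
    with True show ?thesis by (simp add: s_def)
  next
    case False
    with e1[OF that] show ?thesis by (simp add: s_def)
  qed
  define k where "k = (\<lambda>z. p z / s z)"
  have k: "k holomorphic_on S" unfolding k_def
    using p s s0 by (intro holomorphic_intros) (auto intro: holomorphic_on_subset)
  have keq: "k z * (e2pi z - 1) = F z - F 0" if "z \<in> S" for z
    using e1[OF that] by (cases "z = 0") (auto simp: k_def p_def s_def)
  have kper: "k (w + 1/2) = k (w - 1/2)" if w: "w \<in> S'" for w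
  proof -
    have w': "w + 1/2 \<in> S" "w - 1/2 \<in> S" "w + 1/2 \<noteq> 0" "w - 1/2 \<noteq> 0"
      using w by (auto simp: S_def S'_def complex_eq_iff abs_if split: if_splits)
    have "k (w + 1/2) * (e2pi (w + 1/2) - 1) = k (w - 1/2) * (e2pi (w - 1/2) - 1)"
      unfolding keq[OF w'(1)] keq[OF w'(2)] using per[of "w - 1/2"] by (simp add: algebra_simps)
    moreover have "e2pi (w + 1/2) = e2pi (w - 1/2)"
      using e2pi_add_int[of "w - 1/2" 1] by (simp add: algebra_simps)
    ultimately show ?thesis using e1[OF w'(1,3)] by simp
  qed
  have "\<exists>K. \<forall>z\<in>S. (K has_field_derivative k z * e2pi (of_int n * z)) (at z)" for n :: int
  proof -
    have "(\<lambda>z. k z * e2pi (of_int n * z)) holomorphic_on S" by (intro holomorphic_on_mult k holomorphic_intros)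
    then obtain K where "\<And>z. z \<in> S \<Longrightarrow> (K has_field_derivative k z * e2pi (of_int n * z)) (at z within S)"
      using holomorphic_convex_primitive'[OF convS opS] by blast
    then show ?thesis using at_within_open[OF _ opS] by (intro exI[of _ K] ballI) simp
  qed
  then obtain K where K: "\<And>n z. z \<in> S \<Longrightarrow> (K n has_field_derivative k z * e2pi (of_int n * z)) (at z)"
    by metis
  \<comment> \<open>the integral of \<open>k z * e2pi (n * z)\<close> over a period\<close>
  define c where "c = (\<lambda>n. K n (1/2) - K n (-1/2))"
  have c: "K n (z + 1/2) - K n (z - 1/2) = c n" if "z \<in> S'" for n z
  proof -
    let ?D = "\<lambda>z. K n (z + 1/2) - K n (z + (-1/2))"
    have "?D z = ?D 0"
    proof (rule zero_derivative_const_on_convex[OF convS', where f = ?D])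
      fix w assume w: "w \<in> S'"
      then have w': "w + 1/2 \<in> S" "w + (-1/2) \<in> S" by (auto simp: S_def S'_def abs_if split: if_splits)
      have "of_int n * (w + 1/2) = of_int n * (w + (-1/2)) + of_int n" by (simp add: algebra_simps)
      then have "e2pi (of_int n * (w + 1/2)) = e2pi (of_int n * (w + (-1/2)))" by (simp only: e2pi_add_int)
      then show "(?D has_field_derivative 0) (at w)"
        using DERIV_diff[OF K[OF w'(1), of n, THEN DERIV_shift[THEN iffD1]] K[OF w'(2), of n, THEN DERIV_shift[THEN iffD1]]] kper[OF w]
        by simp
    qed (use that in \<open>auto simp: S'_def\<close>)
    then show ?thesis by (simp add: c_def)
  qed
  have c_Suc: "c (n + 1) = c n - (if n = 0 then F 0 else 0)" for n
  proof -
    define H where "H = (\<lambda>z. if n = 0 then z else e2pi (of_int n * z) / (2 * of_real pi * \<i> * of_int n))"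
    have H: "(H has_field_derivative e2pi (of_int n * z)) (at z)" for z
      using DERIV_e2pi_primitive[of "of_int n" z] by (cases "n = 0") (simp_all add: H_def)
    let ?D = "\<lambda>z. K (n + 1) z - K n z - (G n z - F 0 * H z)"
    have "?D (1/2) = ?D (-1/2)"
    proof (rule zero_derivative_const_on_convex[OF convS, where f = ?D])
      fix z assume z: "z \<in> S"
      have "k z * e2pi (of_int (n + 1) * z) - k z * e2pi (of_int n * z) = (F z - F 0) * e2pi (of_int n * z)"
        unfolding keq[OF z, symmetric] by (simp add: algebra_simps e2pi_add)
      then show "(?D has_field_derivative 0) (at z)"
        using DERIV_diff[OF DERIV_diff[OF K[OF z, of "n + 1"] K[OF z, of n]] DERIV_diff[OF prim[of n z] DERIV_cmult[OF H[of z], of "F 0"]]]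
        by (simp add: algebra_simps)
    qed (auto simp: S_def)
    moreover have "G n (1/2) = G n (-1/2)" using perG[of n "-1/2"] by simp
    moreover have "H (1/2) - H (-1/2) = (if n = 0 then 1 else 0)"
      using e2pi_add_int[of "of_int n * (-1/2)" n] by (simp add: H_def algebra_simps)
    ultimately show ?thesis by (simp add: c_def algebra_simps split: if_splits)
  qed
  \<comment> \<open>the integral over the horizontal line at height \<open>y\<close>\<close>
  have bound: "\<exists>B. \<forall>n. norm (c n) \<le> B * exp (- 2 * pi * (of_int n * y))" for y :: real
  proof -
    define L where "L = cbox (Complex (-1/2) y) (Complex (1/2) y)"
    have L: "L = {z. \<bar>Re z\<bar> \<le> 1/2 \<and> Im z = y}"
      by (auto simp: L_def in_cbox_complex_iff)
    have LS: "L \<subseteq> S" by (auto simp: L S_def)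
    have "compact (k ` L)"
      unfolding L_def by (intro compact_continuous_image compact_cbox)
        (use holomorphic_on_imp_continuous_on[OF k] LS in \<open>auto simp: L_def intro: continuous_on_subset\<close>)
    then obtain B where B: "\<And>z. z \<in> L \<Longrightarrow> norm (k z) \<le> B"
      using compact_imp_bounded by (fastforce simp: bounded_iff)
    have "norm (c n) \<le> B * exp (- 2 * pi * (of_int n * y))" for n
    proof -
      let ?y = "\<i> * of_real y"
      have "norm (K n (?y + 1/2) - K n (?y - 1/2)) \<le> (B * exp (- 2 * pi * (of_int n * y))) * norm ((?y + 1/2) - (?y - 1/2))"
      proof (rule field_differentiable_bound)
        show "convex L" unfolding L_def by (rule convex_box)
        fix z assume z: "z \<in> L"
        with LS show "(K n has_field_derivative k z * e2pi (of_int n * z)) (at z within L)"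
          by (blast intro: has_field_derivative_at_within K)
        have "norm (e2pi (of_int n * z)) = exp (- 2 * pi * (of_int n * y))"
          using z by (simp add: L norm_e2pi)
        then show "norm (k z * e2pi (of_int n * z)) \<le> B * exp (- 2 * pi * (of_int n * y))"
          unfolding norm_mult using B[OF z] by (simp add: mult_right_mono)
      qed (auto simp: L)
      then show ?thesis using c[of ?y n] by (simp add: S'_def)
    qed
    then show ?thesis by blast
  qed
  have decay: "x = 0" if "\<And>m::nat. norm x \<le> B * exp (- 2 * pi * of_nat m)" for x :: complex and B
  proof -
    have "(\<lambda>m. B * exp (- 2 * pi * real m)) \<longlonglongrightarrow> 0"
      by real_asymp
    then have "norm x \<le> 0" by (rule tendsto_lowerbound) (use that in auto)
    then show ?thesis by simp
  qed
  have up: "c (1 + int m) = c 1" for m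
  proof (induction m)
    case (Suc m)
    then show ?case using c_Suc[of "1 + int m"] by (simp add: algebra_simps)
  qed simp
  obtain B where B: "\<And>n. norm (c n) \<le> B * exp (- 2 * pi * (of_int n * 1))" using bound[of 1] by blast
  have "norm (c 1) \<le> (B * exp (- 2 * pi)) * exp (- 2 * pi * of_nat m)" for m
    using B[of "1 + int m"] unfolding up by (simp add: algebra_simps flip: exp_add)
  then have "c 1 = 0" by (rule decay)
  have down: "c (- int m) = c 0" for m
  proof (induction m)
    case (Suc m)
    then show ?case using c_Suc[of "- 1 - int m"] by (simp add: algebra_simps)
  qed simp
  obtain B' where B': "\<And>n. norm (c n) \<le> B' * exp (- 2 * pi * (of_int n * (-1)))" using bound[of "-1"] by blast
  have "norm (c 0) \<le> B' * exp (- 2 * pi * of_nat m)" for m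
    using B'[of "- int m"] unfolding down by simp
  then have "c 0 = 0" by (rule decay)
  with \<open>c 1 = 0\<close> show ?thesis using c_Suc[of 0] by simp
qed

lemma entire_has_primitive:
  assumes "F holomorphic_on UNIV"
  shows "\<exists>P. \<forall>z. (P has_field_derivative F z) (at z)"
proof -
  obtain P where "\<And>z. z \<in> UNIV \<Longrightarrow> (P has_field_derivative F z) (at z within UNIV)"
    using holomorphic_convex_primitive'[OF convex_UNIV open_UNIV assms] by blast
  then show ?thesis by auto
qed

text \<open>
  The function \<open>G\<close> says that the mean of \<open>F\<close> over a period is zero. Because of the factor under \<open>z \<mapsto> z + \<tau>\<close>, each Fourier
  coefficient of \<open>F\<close> is a multiple of its neighbour, with a non-zero factor; hence all of them vanish, and so do those of
  the translates of \<open>F\<close>, whose values at \<open>0\<close> are the values of \<open>F\<close>.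
\<close>

lemma quasi_periodic_zero:
  fixes F G :: "complex \<Rightarrow> complex"
  assumes hol: "F holomorphic_on UNIV"
    and per: "\<And>z. F (z + 1) = F z"
    and quasi: "\<And>z. F (z + \<tau>) = e2pi (- \<tau> / 2 - z) * F z"
    and prim: "\<And>z. (G has_field_derivative F z) (at z)"
    and perG: "\<And>z. G (z + 1) = G z"
  shows "F a = 0"
proof -
  have "\<exists>P. \<forall>z. (P has_field_derivative F z * e2pi (of_int k * z)) (at z)" for k :: int
  proof -
    have "(\<lambda>z. F z * e2pi (of_int k * z)) holomorphic_on UNIV"
      by (intro holomorphic_intros hol)
    then show ?thesis by (rule entire_has_primitive)
  qed
  then obtain P where P: "\<And>k z. (P k has_field_derivative F z * e2pi (of_int k * z)) (at z)"
    by metis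
  have shift: "((\<lambda>z. P k (z + c)) has_field_derivative F (z + c) * e2pi (of_int k * (z + c))) (at z)" for k c z
    using P[of k "z + c"] by (simp add: DERIV_shift)
  \<comment> \<open>the Fourier coefficients of \<open>F\<close>\<close>
  define I where "I = (\<lambda>k. P k 1 - P k 0)"
  have I: "P k (z + 1) - P k z = I k" for k z
  proof -
    have "(\<lambda>z. P k (z + 1) - P k z) z = (\<lambda>z. P k (z + 1) - P k z) 0"
    proof (rule zero_derivative_const_on_convex[OF convex_UNIV, where f = "\<lambda>z. P k (z + 1) - P k z"])
      fix w :: complex
      have "e2pi (of_int k * (w + 1)) = e2pi (of_int k * w)"
        using e2pi_add_int[of "of_int k * w" k] by (simp add: algebra_simps)
      then show "((\<lambda>z. P k (z + 1) - P k z) has_field_derivative 0) (at w)"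
        using DERIV_diff[OF shift[of k 1 w] P[of k w]] by (simp add: per)
    qed auto
    then show ?thesis by (simp add: I_def)
  qed
  have rec: "I k = e2pi (of_int k * \<tau> - \<tau> / 2) * I (k - 1)" for k
  proof -
    let ?c = "e2pi (of_int k * \<tau> - \<tau> / 2)"
    let ?D = "\<lambda>z. P k (z + \<tau>) - ?c * P (k - 1) z"
    have "?D 1 = ?D 0"
    proof (rule zero_derivative_const_on_convex[OF convex_UNIV, where f = ?D])
      fix w :: complex
      have "F (w + \<tau>) * e2pi (of_int k * (w + \<tau>)) = ?c * (F w * e2pi (of_int (k - 1) * w))"
        unfolding quasi by (simp add: algebra_simps flip: e2pi_add)
      then show "(?D has_field_derivative 0) (at w)"
        using DERIV_diff[OF shift[of k \<tau> w] DERIV_cmult[OF P[of "k - 1" w], of ?c]] by simp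
    qed auto
    then have "P k (\<tau> + 1) - P k \<tau> = ?c * (P (k - 1) (0 + 1) - P (k - 1) 0)"
      by (simp add: algebra_simps)
    then show ?thesis unfolding I .
  qed
  have I0: "I 0 = 0"
  proof -
    let ?D = "\<lambda>z. P 0 z - G z"
    have "?D 1 = ?D 0"
    proof (rule zero_derivative_const_on_convex[OF convex_UNIV, where f = ?D])
      fix w :: complex
      show "(?D has_field_derivative 0) (at w)"
        using DERIV_diff[OF P[of 0 w] prim[of w]] by simp
    qed auto
    then show ?thesis using perG[of 0] by (simp add: I_def algebra_simps)
  qed
  have I_zero: "I k = 0" for k
  proof (induction k rule: int_induct[where k = 0])
    case (step1 i)
    then show ?case using rec[of "i + 1"] by simp
  next
    case (step2 i)
    then show ?case using rec[of i] by simp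
  qed (rule I0)
  have "(\<lambda>z. F (z + a)) 0 = 0"
  proof (rule periodic_fourier_zero_imp_zero_at_0[where F = "\<lambda>z. F (z + a)"
        and G = "\<lambda>k z. e2pi (- of_int k * a) * P k (z + a)"])
    have "F \<circ> (\<lambda>z. z + a) holomorphic_on UNIV"
      by (rule holomorphic_on_compose_gen[OF _ hol]) (auto intro!: holomorphic_intros)
    then show "(\<lambda>z. F (z + a)) holomorphic_on UNIV" by (simp add: o_def)
  next
    fix z :: complex
    show "F (z + 1 + a) = F (z + a)" using per[of "z + a"] by (simp add: algebra_simps)
    fix k :: int
    have "e2pi (- of_int k * a) * e2pi (of_int k * (z + a)) = e2pi (of_int k * z)"
      by (simp add: algebra_simps flip: e2pi_add)
    then have "e2pi (- of_int k * a) * (F (z + a) * e2pi (of_int k * (z + a))) = F (z + a) * e2pi (of_int k * z)"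
      by (metis mult.left_commute)
    then show "((\<lambda>z. e2pi (- of_int k * a) * P k (z + a)) has_field_derivative F (z + a) * e2pi (of_int k * z)) (at z)"
      using DERIV_cmult[OF shift[of k a z], of "e2pi (- of_int k * a)"] by (simp only:)
    show "e2pi (- of_int k * a) * P k (z + 1 + a) = e2pi (- of_int k * a) * P k (z + a)"
      using I[of k "z + a"] by (simp add: I_zero algebra_simps)
  qed
  then show ?thesis by simp
qed

text \<open>
  The means of \<open>F\<close> and \<open>H\<close> over a period are two numbers, so some non-trivial linear combination of \<open>F\<close> and \<open>H\<close> has
  mean zero.
\<close>

lemma quasi_periodic_unique:
  fixes F H :: "complex \<Rightarrow> complex"
  assumes "F holomorphic_on UNIV" "H holomorphic_on UNIV"
    and per: "\<And>z. F (z + 1) = F z" "\<And>z. H (z + 1) = H z"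
    and quasi: "\<And>z. F (z + \<tau>) = e2pi (- \<tau> / 2 - z) * F z"
      "\<And>z. H (z + \<tau>) = e2pi (- \<tau> / 2 - z) * H z"
  obtains c d where "c \<noteq> 0 \<or> d \<noteq> 0" "\<And>z. c * F z = d * H z"
proof -
  obtain P where P: "\<And>z. (P has_field_derivative F z) (at z)"
    using entire_has_primitive[OF assms(1)] by blast
  obtain Q where Q: "\<And>z. (Q has_field_derivative H z) (at z)"
    using entire_has_primitive[OF assms(2)] by blast
  have incr: "R (z + 1) - R z = R 1 - R 0"
    if R: "\<And>z. (R has_field_derivative K z) (at z)" and K: "\<And>z. K (z + 1) = K z" for R K :: "complex \<Rightarrow> complex" and z
  proof -
    have "(\<lambda>z. R (z + 1) - R z) z = (\<lambda>z. R (z + 1) - R z) 0"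
    proof (rule zero_derivative_const_on_convex[OF convex_UNIV, where f = "\<lambda>z. R (z + 1) - R z"])
      fix w :: complex
      have "((\<lambda>z. R (z + 1)) has_field_derivative K (w + 1)) (at w)"
        using R[of "w + 1"] by (simp add: DERIV_shift)
      from DERIV_diff[OF this R[of w]] show "((\<lambda>z. R (z + 1) - R z) has_field_derivative 0) (at w)"
        by (simp add: K)
    qed auto
    then show ?thesis by simp
  qed
  \<comment> \<open>the means of \<open>H\<close> and \<open>F\<close>\<close>
  define c d where "c = Q 1 - Q 0" and "d = P 1 - P 0"
  show ?thesis
  proof (cases "c = 0 \<and> d = 0")
    case True
    have "F z = 0" for z
      by (rule quasi_periodic_zero[OF assms(1) per(1) quasi(1) P])
         (use incr[OF P per(1)] True in \<open>simp add: d_def\<close>)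
    then show ?thesis using that[of 1 0] by simp
  next
    case False
    have "c * F z - d * H z = 0" for z
    proof (rule quasi_periodic_zero[where F = "\<lambda>z. c * F z - d * H z" and G = "\<lambda>z. c * P z - d * Q z"])
      show "(\<lambda>z. c * F z - d * H z) holomorphic_on UNIV" by (intro holomorphic_intros assms)
      fix z
      show "c * F (z + 1) - d * H (z + 1) = c * F z - d * H z" by (simp add: per)
      show "c * F (z + \<tau>) - d * H (z + \<tau>) = e2pi (- \<tau> / 2 - z) * (c * F z - d * H z)"
        unfolding quasi by (simp only: algebra_simps)
      show "((\<lambda>z. c * P z - d * Q z) has_field_derivative c * F z - d * H z) (at z)"
        by (intro derivative_intros DERIV_cmult P Q)
      have "P (z + 1) = P z + d" "Q (z + 1) = Q z + c"
        using incr[OF P per(1), of z] incr[OF Q per(2), of z] by (simp_all add: c_def d_def algebra_simps)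
      then show "c * P (z + 1) - d * Q (z + 1) = c * P z - d * Q z" by (simp add: algebra_simps)
    qed
    then show ?thesis using that[of c d] False by auto
  qed
qed

section \<open>Differentiation of sums of entire functions\<close>

lemma has_field_derivative_infsum:
  fixes f :: "'a \<Rightarrow> complex \<Rightarrow> complex"
  assumes d: "\<And>n w. (f n has_field_derivative f' n w) (at w)"
    and bound: "\<And>r::real. \<exists>M. M summable_on A \<and> (\<forall>n\<in>A. \<forall>w. norm w \<le> r \<longrightarrow> norm (f n w) \<le> M n)"
  shows "((\<lambda>w. \<Sum>\<^sub>\<infinity>n\<in>A. f n w) has_field_derivative (\<Sum>\<^sub>\<infinity>n\<in>A. f' n z)) (at z)"
    and "(\<lambda>n. f' n z) summable_on A"
proof -
  define r where "r = norm z + 1"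
  have r: "0 < r" "z \<in> ball 0 r" by (auto simp: r_def add_nonneg_pos)
  obtain M where M: "M summable_on A" "\<And>n w. n \<in> A \<Longrightarrow> norm w \<le> r \<Longrightarrow> norm (f n w) \<le> M n"
    using bound[of r] by blast
  have ul: "uniform_limit (cball 0 r) (\<lambda>X w. \<Sum>n\<in>X. f n w) (\<lambda>w. \<Sum>\<^sub>\<infinity>n\<in>A. f n w) (finite_subsets_at_top A)"
    by (rule Weierstrass_m_test_general[OF _ M(1)]) (use M(2) in auto)
  obtain g' where g': "\<And>w. w \<in> ball 0 r \<Longrightarrow>
      ((\<lambda>w. \<Sum>\<^sub>\<infinity>n\<in>A. f n w) has_field_derivative (g' w)) (at w) \<and>
      ((\<lambda>X. \<Sum>n\<in>X. f' n w) \<longlongrightarrow> g' w) (finite_subsets_at_top A)"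
  proof (rule has_complex_derivative_uniform_limit[OF _ ul])
    have "continuous_on (cball 0 r) (\<lambda>w. \<Sum>n\<in>X. f n w)" for X
      by (intro continuous_on_sum) (meson DERIV_isCont continuous_at_imp_continuous_on d)
    moreover have "((\<lambda>w. \<Sum>n\<in>X. f n w) has_field_derivative (\<Sum>n\<in>X. f' n w)) (at w)" for X w
      by (intro DERIV_sum d)
    ultimately show "\<forall>\<^sub>F X in finite_subsets_at_top A. continuous_on (cball 0 r) (\<lambda>w. \<Sum>n\<in>X. f n w) \<and>
        (\<forall>w\<in>ball 0 r. ((\<lambda>w. \<Sum>n\<in>X. f n w) has_field_derivative (\<Sum>n\<in>X. f' n w)) (at w))"
      by simp
  qed (use r in auto)
  have "((\<lambda>n. f' n z) has_sum g' z) A"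
    using g'[OF r(2)] by (simp add: has_sum_def)
  then show "(\<lambda>n. f' n z) summable_on A" "((\<lambda>w. \<Sum>\<^sub>\<infinity>n\<in>A. f n w) has_field_derivative (\<Sum>\<^sub>\<infinity>n\<in>A. f' n z)) (at z)"
    using g'[OF r(2)] by (auto simp: has_sum_iff)
qed

section \<open>Jacobi's identity for the cube of the Euler product\<close>

text \<open>
  The q-Pochhammer symbol \<open>(q; q)\<^sub>n\<close>. It differs from the q-factorial by a power of \<open>1 - q\<close>, which cancels in \<open>qbinom\<close>.
\<close>

definition qfact :: "complex \<Rightarrow> nat \<Rightarrow> complex" where
  "qfact q n = (\<Prod>i<n. 1 - q ^ Suc i)"

definition qbinom :: "complex \<Rightarrow> nat \<Rightarrow> nat \<Rightarrow> complex" where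
  "qbinom q m j = (if j \<le> m then qfact q m / (qfact q j * qfact q (m - j)) else 0)"

lemma qfact_0 [simp]: "qfact q 0 = 1"
  by (simp add: qfact_def)

lemma qfact_Suc: "qfact q (Suc n) = qfact q n * (1 - q ^ Suc n)"
  by (simp add: qfact_def)

lemma one_minus_power_nonzero:
  fixes q :: complex
  assumes "norm q < 1"
  shows "1 - q ^ Suc i \<noteq> 0"
proof
  assume "1 - q ^ Suc i = 0"
  then have "norm (q ^ Suc i) = 1" by simp
  moreover have "norm q ^ Suc i < 1" using power_decreasing[of 1 "Suc i" "norm q"] assms by simp
  ultimately show False unfolding norm_power by linarith
qed

lemma qfact_nonzero: "norm q < 1 \<Longrightarrow> qfact q n \<noteq> 0"
  unfolding qfact_def using one_minus_power_nonzero by (simp del: power_Suc)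

lemma qbinom_pascal:
  assumes q: "norm q < 1" and "j \<le> m"
  shows "qbinom q (Suc m) (Suc j) = qbinom q m (Suc j) + q ^ (m - j) * qbinom q m j"
proof (cases "j = m")
  case True
  then show ?thesis using qfact_nonzero[OF q] by (simp add: qbinom_def)
next
  case False
  with assms obtain d where d: "m = Suc (j + d)"
    by (metis add_Suc_right le_neq_implies_less less_imp_Suc_add)
  have nz: "qfact q n \<noteq> 0" "1 - q ^ Suc n \<noteq> 0" for n
    using qfact_nonzero[OF q] one_minus_power_nonzero[OF q] by auto
  have B1: "qbinom q (Suc m) (Suc j) = qfact q m * (1 - q ^ Suc m) / (qfact q (Suc j) * qfact q (Suc d))"
    by (simp add: qbinom_def d qfact_Suc)
  have B2: "qbinom q m (Suc j) = qfact q m * (1 - q ^ Suc d) / (qfact q (Suc j) * qfact q (Suc d))"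
    using nz by (simp add: qbinom_def d qfact_Suc[of q d])
  have B3: "qbinom q m j = qfact q m * (1 - q ^ Suc j) / (qfact q (Suc j) * qfact q (Suc d))"
    using nz by (simp add: qbinom_def d qfact_Suc[of q j] Suc_diff_le)
  have md: "m - j = Suc d" by (simp add: d)
  have "qfact q m * (1 - q ^ Suc d) + q ^ Suc d * (qfact q m * (1 - q ^ Suc j)) = qfact q m * (1 - q ^ Suc m)"
    by (simp add: d algebra_simps power_add)
  then show ?thesis
    unfolding B1 B2 B3 md times_divide_eq_right add_divide_distrib[symmetric] by simp
qed

lemma qbinom_0 [simp]: "norm q < 1 \<Longrightarrow> qbinom q m 0 = 1"
  using qfact_nonzero by (simp add: qbinom_def)

lemma triangle_Suc: "Suc j * j div 2 = j + j * (j - 1) div 2"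
proof -
  have "Suc j * j = 2 * j + j * (j - 1)"
    by (cases j) (auto simp: algebra_simps)
  then show ?thesis by simp
qed

text \<open>
  By induction on \<open>m\<close>: multiplication by the factor \<open>1 + x * q ^ m\<close> acts on the coefficients as in \<open>qbinom_pascal\<close>.
\<close>

lemma q_binomial_theorem:
  assumes q: "norm q < 1"
  shows "(\<Prod>i<m. 1 + x * q ^ i) = (\<Sum>j\<le>m. q ^ (j * (j - 1) div 2) * qbinom q m j * x ^ j)"
proof (induction m)
  case 0
  then show ?case using q by simp
next
  case (Suc m)
  let ?f = "\<lambda>j. q ^ (j * (j - 1) div 2) * qbinom q m j * x ^ j"
  have top: "?f (Suc m) = 0" by (simp add: qbinom_def)
  have "(\<Sum>j\<le>Suc m. q ^ (j * (j - 1) div 2) * qbinom q (Suc m) j * x ^ j)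
      = 1 + (\<Sum>j\<le>m. q ^ (Suc j * j div 2) * qbinom q (Suc m) (Suc j) * x ^ Suc j)"
    using q by (subst sum.atMost_Suc_shift) simp
  also have "(\<Sum>j\<le>m. q ^ (Suc j * j div 2) * qbinom q (Suc m) (Suc j) * x ^ Suc j)
      = (\<Sum>j\<le>m. ?f (Suc j)) + (\<Sum>j\<le>m. x * q ^ m * ?f j)"
    unfolding sum.distrib[symmetric]
  proof (rule sum.cong)
    fix j assume "j \<in> {..m}"
    then have j: "j \<le> m" by simp
    have "q ^ (Suc j * j div 2) * q ^ (m - j) = q ^ m * q ^ (j * (j - 1) div 2)"
      unfolding triangle_Suc power_add[symmetric] using j by (simp add: algebra_simps)
    then have "q ^ (Suc j * j div 2) * (q ^ (m - j) * qbinom q m j) * x ^ Suc j = x * q ^ m * ?f j"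
      by (simp add: mult.assoc[symmetric])
    then show "q ^ (Suc j * j div 2) * qbinom q (Suc m) (Suc j) * x ^ Suc j = ?f (Suc j) + x * q ^ m * ?f j"
      unfolding qbinom_pascal[OF q j] by (simp add: algebra_simps)
  qed simp
  also have "1 + ((\<Sum>j\<le>m. ?f (Suc j)) + (\<Sum>j\<le>m. x * q ^ m * ?f j)) = (\<Sum>j\<le>Suc m. ?f j) + x * q ^ m * (\<Sum>j\<le>m. ?f j)"
    unfolding sum.atMost_Suc_shift[of ?f] sum_distrib_left using q by simp
  also have "\<dots> = (\<Sum>j\<le>m. ?f j) * (1 + x * q ^ m)"
    by (simp only: sum.atMost_Suc top) (simp add: algebra_simps)
  finally show ?case by (simp add: Suc.IH)
qed

text \<open>
  The factors on the left are \<open>1 - q\<^bsup>-j\<^esup> = - q\<^bsup>-j\<^esup> (1 - q\<^sup>j)\<close> for \<open>j = 1, ..., n\<close>.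
\<close>

lemma qfact_shifted_prod:
  assumes "q \<noteq> 0"
  shows "q ^ (n * (n + 1) div 2) * (\<Prod>i<n. 1 - q ^ i / q ^ n) = (-1) ^ n * qfact q n"
proof -
  have "(\<Prod>i<n. 1 - q ^ i / q ^ n) = (\<Prod>i<n. 1 - 1 / q ^ Suc i)"
  proof (rule prod.reindex_bij_witness[where i = "\<lambda>i. n - Suc i" and j = "\<lambda>i. n - Suc i"])
    fix a assume "a \<in> {..<n}"
    then have "n = a + Suc (n - Suc a)" by auto
    then have "q ^ n = q ^ a * q ^ Suc (n - Suc a)" by (metis power_add)
    then show "1 - 1 / q ^ Suc (n - Suc a) = 1 - q ^ a / q ^ n" using assms by (simp add: field_simps)
  qed auto
  note 1 = this
  have 2: "q ^ (n * (n + 1) div 2) = (\<Prod>i<n. q ^ Suc i)"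
  proof (induction n)
    case (Suc n)
    have "Suc n * (Suc n + 1) div 2 = n * (n + 1) div 2 + Suc n"
      by (simp add: algebra_simps)
    then show ?case using Suc by (simp only: power_add prod.lessThan_Suc)
  qed simp
  have "(\<Prod>i<n. q ^ Suc i) * (\<Prod>i<n. 1 - 1 / q ^ Suc i) = (\<Prod>i<n. (-1) * (1 - q ^ Suc i))"
    unfolding prod.distrib[symmetric]
    by (rule prod.cong) (use assms in \<open>auto simp: field_simps\<close>)
  also have "\<dots> = (-1) ^ n * qfact q n"
    unfolding prod.distrib qfact_def by simp
  finally show ?thesis by (simp only: 1 2)
qed

text \<open>
  The derivative of the q-binomial theorem with \<open>2 * n + 1\<close> factors at the zero \<open>x = - 1 / q ^ n\<close> of the middle factor.
  On the product side only the derivative of that factor contributes.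
\<close>

lemma q_binomial_derivative:
  assumes q: "norm q < 1" "q \<noteq> 0"
  shows "(\<Sum>j\<le>2*n+1. q ^ (j * (j - 1) div 2) * qbinom q (2*n+1) j * (of_nat j * (- 1 / q ^ n) ^ (j - 1)))
     = q ^ n * ((\<Prod>i<n. 1 - q ^ i / q ^ n) * qfact q n)"
proof -
  define x0 where "x0 = - 1 / q ^ n"
  define Q where "Q = (\<lambda>x::complex. (\<Prod>i<n. 1 + x * q ^ i) * (\<Prod>i<n. 1 + x * q ^ (n + Suc i)))"
  have P: "(\<Prod>i<2*n+1. 1 + x * q ^ i) = (1 + x * q ^ n) * Q x" for x
  proof -
    have "{..<2*n+1} = {..<n} \<union> ({n} \<union> {Suc n..<2*n+1})" by auto
    then have "(\<Prod>i<2*n+1. 1 + x * q ^ i) = (\<Prod>i\<in>{..<n} \<union> ({n} \<union> {Suc n..<2*n+1}). 1 + x * q ^ i)"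
      by (simp only:)
    also have "\<dots> = (\<Prod>i<n. 1 + x * q ^ i) * (\<Prod>i\<in>{n} \<union> {Suc n..<2*n+1}. 1 + x * q ^ i)"
      by (rule prod.union_disjoint) auto
    also have "(\<Prod>i\<in>{n} \<union> {Suc n..<2*n+1}. 1 + x * q ^ i) = (1 + x * q ^ n) * (\<Prod>i\<in>{Suc n..<2*n+1}. 1 + x * q ^ i)"
      by (subst prod.union_disjoint) auto
    also have "(\<Prod>i\<in>{Suc n..<2*n+1}. 1 + x * q ^ i) = (\<Prod>i<n. 1 + x * q ^ (n + Suc i))"
      by (rule prod.reindex_bij_witness[where i = "\<lambda>i. n + Suc i" and j = "\<lambda>i. i - Suc n"]) auto
    finally show ?thesis by (simp add: Q_def algebra_simps)
  qed
  have "Q field_differentiable (at x0)"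
    unfolding Q_def by (intro derivative_intros holomorphic_on_imp_differentiable_at[where s=UNIV] holomorphic_intros) auto
  then obtain Q' where Q': "(Q has_field_derivative Q') (at x0)"
    by (auto simp: field_differentiable_def)
  have d1: "((\<lambda>x. (1 + x * q ^ n) * Q x) has_field_derivative q ^ n * Q x0) (at x0)"
    by (rule derivative_eq_intros Q' refl)+ (use q in \<open>simp add: x0_def\<close>)
  have d2: "((\<lambda>x. \<Sum>j\<le>2*n+1. q ^ (j * (j - 1) div 2) * qbinom q (2*n+1) j * x ^ j) has_field_derivative
      (\<Sum>j\<le>2*n+1. q ^ (j * (j - 1) div 2) * qbinom q (2*n+1) j * (of_nat j * x0 ^ (j - 1)))) (at x0)"
  proof (rule DERIV_sum)
    fix j
    show "((\<lambda>x. q ^ (j * (j - 1) div 2) * qbinom q (2*n+1) j * x ^ j) has_field_derivative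
        q ^ (j * (j - 1) div 2) * qbinom q (2*n+1) j * (of_nat j * x0 ^ (j - 1))) (at x0)"
      using DERIV_cmult[OF DERIV_power[OF DERIV_ident, of j x0 UNIV], of "q ^ (j * (j - 1) div 2) * qbinom q (2*n+1) j"]
      by (simp only: mult_1 One_nat_def)
  qed
  have "(\<lambda>x. (1 + x * q ^ n) * Q x) = (\<lambda>x. \<Sum>j\<le>2*n+1. q ^ (j * (j - 1) div 2) * qbinom q (2*n+1) j * x ^ j)"
    by (rule ext) (simp only: P[symmetric] q_binomial_theorem[OF q(1)])
  then have "(\<Sum>j\<le>2*n+1. q ^ (j * (j - 1) div 2) * qbinom q (2*n+1) j * (of_nat j * x0 ^ (j - 1))) = q ^ n * Q x0"
    using DERIV_unique[OF d1] d2 by simp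
  moreover have "Q x0 = (\<Prod>i<n. 1 - q ^ i / q ^ n) * qfact q n"
    unfolding Q_def qfact_def x0_def using q(2) by (simp add: power_add)
  ultimately show ?thesis by (simp add: x0_def)
qed

text \<open>
  The terms \<open>j = n - k\<close> and \<open>j = n + 1 + k\<close> of the sum in \<open>q_binomial_derivative\<close> contain the same q-binomial
  coefficient by symmetry, the same power of \<open>q\<close>, and opposite signs; their factors \<open>j\<close> combine to
  \<open>(n + 1 + k) - (n - k) = 2 * k + 1\<close>.
\<close>

lemma finite_jacobi_cube:
  assumes q: "norm q < 1" "q \<noteq> 0"
  shows "(\<Sum>k\<le>n. (-1) ^ k * of_nat (2 * k + 1) * q ^ (k * (k + 1) div 2) * qbinom q (2*n+1) (n+1+k)) = qfact q n ^ 2"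
proof -
  \<comment> \<open>the power \<open>q ^ T\<close> clears the denominators coming from \<open>x0\<close>, as in \<open>qfact_shifted_prod\<close>\<close>
  define T where "T = n * (n + 1) div 2"
  define x0 where "x0 = - 1 / q ^ n"
  define b where "b = qbinom q (2*n+1)"
  define g where "g = (\<lambda>j. q ^ (j * (j - 1) div 2) * b j * (of_nat j * x0 ^ (j - 1)))"
  have sym: "b (n - k) = b (n + 1 + k)" if "k \<le> n" for k
    using that by (simp add: b_def qbinom_def Suc_diff_le mult.commute)
  have tri: "2 * (m * (m + 1) div 2) = m * (m + 1)" for m :: nat by simp
  have up: "q ^ T * g (n + 1 + k) = (-1) ^ (n + k) * q ^ n * (of_nat (n + 1 + k) * q ^ (k * (k + 1) div 2) * b (n + 1 + k))" for k
  proof -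
    have "2 * (T + (n + 1 + k) * (n + 1 + k - 1) div 2) = 2 * (n * (n + k) + n + k * (k + 1) div 2)"
      using tri[of n] tri[of k] tri[of "n + k"] by (simp add: T_def algebra_simps)
    then have e: "T + (n + 1 + k) * (n + 1 + k - 1) div 2 = n * (n + k) + n + k * (k + 1) div 2" by (rule mult_left_cancel[THEN iffD1, rotated]) simp
    have x: "x0 ^ (n + k) * q ^ (n * (n + k)) = (-1) ^ (n + k)"
      using q(2) by (simp add: x0_def power_mult power_divide flip: power_mult_distrib)
    have "q ^ T * g (n + 1 + k) = q ^ (T + (n + 1 + k) * (n + 1 + k - 1) div 2) * b (n + 1 + k) * (of_nat (n + 1 + k) * x0 ^ (n + k))"
      by (simp add: g_def power_add)
    also have "\<dots> = (x0 ^ (n + k) * q ^ (n * (n + k))) * q ^ n * (of_nat (n + 1 + k) * q ^ (k * (k + 1) div 2) * b (n + 1 + k))"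
      unfolding e power_add[of q] by (simp add: algebra_simps)
    finally show ?thesis by (simp add: x)
  qed
  have down: "q ^ T * g (n - k) = - ((-1) ^ (n + k) * q ^ n * (of_nat (n - k) * q ^ (k * (k + 1) div 2) * b (n + 1 + k)))" if k: "k \<le> n" for k
  proof (cases "k = n")
    case True
    then show ?thesis by (simp add: g_def)
  next
    case False
    with k obtain d where d: "n = Suc (d + k)"
      by (metis add.commute le_neq_implies_less less_imp_Suc_add add_Suc_right)
    have nk: "n - k = Suc d" by (simp add: d)
    have "2 * (T + Suc d * d div 2) = 2 * (n * d + n + k * (k + 1) div 2)"
      using tri[of n] tri[of k] tri[of d] by (simp add: T_def d algebra_simps)
    then have e: "T + Suc d * d div 2 = n * d + n + k * (k + 1) div 2" by (rule mult_left_cancel[THEN iffD1, rotated]) simp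
    have x: "x0 ^ d * q ^ (n * d) = (-1) ^ d"
      using q(2) by (simp add: x0_def power_mult power_divide flip: power_mult_distrib)
    have s: "(-1) ^ d = - ((-1) ^ (n + k) :: complex)"
      by (simp add: d power_add flip: mult_2 power_mult_distrib)
    have "q ^ T * g (n - k) = q ^ (T + Suc d * d div 2) * b (n - k) * (of_nat (n - k) * x0 ^ d)"
      by (simp add: g_def nk power_add)
    also have "\<dots> = (x0 ^ d * q ^ (n * d)) * q ^ n * (of_nat (n - k) * q ^ (k * (k + 1) div 2) * b (n - k))"
      unfolding e power_add[of q] by (simp add: algebra_simps)
    finally show ?thesis unfolding x s sym[OF k] by simp
  qed
  \<comment> \<open>the two halves are indexed by the distance from the centre\<close>
  have split: "(\<Sum>j\<le>2*n+1. g j) = (\<Sum>k\<le>n. g (n - k)) + (\<Sum>k\<le>n. g (n + 1 + k))"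
  proof -
    have "{..2*n+1} = {..n} \<union> {n+1..2*n+1}" by auto
    then have "(\<Sum>j\<le>2*n+1. g j) = (\<Sum>j\<le>n. g j) + (\<Sum>j\<in>{n+1..2*n+1}. g j)"
      by (simp add: sum.union_disjoint)
    also have "(\<Sum>j\<le>n. g j) = (\<Sum>k\<le>n. g (n - k))"
      by (rule sum.reindex_bij_witness[where i = "\<lambda>k. n - k" and j = "\<lambda>k. n - k"]) auto
    also have "(\<Sum>j\<in>{n+1..2*n+1}. g j) = (\<Sum>k\<le>n. g (n + 1 + k))"
      by (rule sum.reindex_bij_witness[where i = "\<lambda>k. n + 1 + k" and j = "\<lambda>k. k - (n + 1)"]) auto
    finally show ?thesis .
  qed
  have "q ^ T * (\<Sum>j\<le>2*n+1. g j) = (\<Sum>k\<le>n. q ^ T * g (n - k) + q ^ T * g (n + 1 + k))"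
    unfolding split by (simp add: sum.distrib sum_distrib_left distrib_left)
  also have "\<dots> = (\<Sum>k\<le>n. (-1) ^ n * q ^ n * ((-1) ^ k * of_nat (2 * k + 1) * q ^ (k * (k + 1) div 2) * b (n+1+k)))"
  proof (rule sum.cong)
    fix k assume "k \<in> {..n}"
    then have k: "k \<le> n" by simp
    have "of_nat (2 * k + 1) = of_nat (n + 1 + k) - (of_nat (n - k) :: complex)"
      using k by (simp add: of_nat_diff)
    then show "q ^ T * g (n - k) + q ^ T * g (n + 1 + k) = (-1) ^ n * q ^ n * ((-1) ^ k * of_nat (2 * k + 1) * q ^ (k * (k + 1) div 2) * b (n+1+k))"
      unfolding down[OF k] up power_add by (simp only: of_nat_mult) (simp add: algebra_simps)
  qed simp
  finally have 1: "q ^ T * (\<Sum>j\<le>2*n+1. g j) = (-1) ^ n * q ^ n * (\<Sum>k\<le>n. (-1) ^ k * of_nat (2 * k + 1) * q ^ (k * (k + 1) div 2) * b (n+1+k))"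
    by (simp add: sum_distrib_left)
  have "(\<Sum>j\<le>2*n+1. g j) = q ^ n * ((\<Prod>i<n. 1 - q ^ i / q ^ n) * qfact q n)"
    unfolding g_def b_def x0_def by (rule q_binomial_derivative[OF q])
  then have "q ^ T * (\<Sum>j\<le>2*n+1. g j) = q ^ n * ((q ^ T * (\<Prod>i<n. 1 - q ^ i / q ^ n)) * qfact q n)"
    by (simp add: algebra_simps)
  also have "\<dots> = (-1) ^ n * q ^ n * qfact q n ^ 2"
    unfolding T_def qfact_shifted_prod[OF q(2)] by (simp add: power2_eq_square)
  finally show ?thesis using 1 q(2) unfolding b_def by simp
qed

lemma qfact_tendsto:
  fixes q :: complex
  assumes q: "norm q < 1"
  shows "(\<lambda>n. qfact q n) \<longlonglongrightarrow> (\<Prod>i. 1 - q ^ Suc i)" "(\<Prod>i. 1 - q ^ Suc i) \<noteq> 0"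
proof -
  have "summable (\<lambda>i. norm q ^ i)" using q by (intro summable_geometric) auto
  then have "summable (\<lambda>i. norm q ^ Suc i)" by (subst summable_Suc_iff)
  then have "summable (\<lambda>i. norm (1 - q ^ Suc i - 1))"
    by (simp add: norm_power norm_mult)
  then have "convergent_prod (\<lambda>i. 1 - q ^ Suc i)"
    by (intro abs_convergent_prod_imp_convergent_prod summable_imp_abs_convergent_prod)
  then have nz: "(\<Prod>i. 1 - q ^ Suc i) \<noteq> 0"
    using one_minus_power_nonzero[OF q] by (rule prodinf_nonzero)
  have "(\<lambda>n. \<Prod>i\<le>n. 1 - q ^ Suc i) \<longlonglongrightarrow> (\<Prod>i. 1 - q ^ Suc i)"
    using \<open>convergent_prod _\<close> by (intro convergent_prod_LIMSEQ)
  then have "(\<lambda>n. qfact q (Suc n)) \<longlonglongrightarrow> (\<Prod>i. 1 - q ^ Suc i)"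
    by (simp add: qfact_def lessThan_Suc_atMost)
  then show "(\<lambda>n. qfact q n) \<longlonglongrightarrow> (\<Prod>i. 1 - q ^ Suc i)"
    by (rule LIMSEQ_imp_Suc)
  show "(\<Prod>i. 1 - q ^ Suc i) \<noteq> 0" by (rule nz)
qed

text \<open>
  For \<open>n\<close> tending to infinity the q-binomial coefficient in \<open>finite_jacobi_cube\<close> tends to the inverse of the Euler product.
  The limit may be taken termwise by Tannery's theorem, since \<open>qfact q n\<close> and its inverse are bounded.
\<close>

theorem jacobi_cube:
  fixes q :: complex
  assumes q: "norm q < 1" "q \<noteq> 0"
  shows "(\<lambda>k. (-1) ^ k * of_nat (2 * k + 1) * q ^ (k * (k + 1) div 2)) sums (\<Prod>i. 1 - q ^ Suc i) ^ 3"
proof -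
  define P where "P = (\<Prod>i. 1 - q ^ Suc i)"
  have lim: "(\<lambda>n. qfact q n) \<longlonglongrightarrow> P" and P0: "P \<noteq> 0"
    using qfact_tendsto[OF q(1)] by (simp_all add: P_def)
  define t where "t = (\<lambda>k. (-1) ^ k * of_nat (2 * k + 1) * q ^ (k * (k + 1) div 2))"
  define a where "a = (\<lambda>k n. if k \<le> n then t k * qbinom q (2*n+1) (n+1+k) else 0)"
  have "Bseq (qfact q)" using lim convergent_imp_Bseq convergentI by blast
  then obtain B1 where B1: "\<And>n. norm (qfact q n) \<le> B1" by (meson Bseq_def)
  have "(\<lambda>n. inverse (qfact q n)) \<longlonglongrightarrow> inverse P" using lim P0 by (rule tendsto_inverse)
  then have "Bseq (\<lambda>n. inverse (qfact q n))" using convergent_imp_Bseq convergentI by blast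
  then obtain B2 where B2: "\<And>n. norm (inverse (qfact q n)) \<le> B2" by (meson Bseq_def)
  have B0: "0 \<le> B1" "0 \<le> B2" using B1[of 0] B2[of 0] by simp_all
  define C where "C = B1 * (B2 * B2)"
  have qb: "norm (qbinom q m j) \<le> C" for m j
  proof (cases "j \<le> m")
    case True
    then have "qbinom q m j = qfact q m * (inverse (qfact q j) * inverse (qfact q (m - j)))"
      by (simp add: qbinom_def field_simps)
    then show ?thesis
      unfolding C_def by (simp only: norm_mult) (intro mult_mono B1 B2 mult_nonneg_nonneg B0 norm_ge_zero)
  next
    case False
    then show ?thesis using B0 by (simp add: qbinom_def C_def)
  qed
  define M where "M = (\<lambda>k. 2 * C * (of_nat (Suc k) * norm q ^ k))"
  have "summable (\<lambda>k. of_nat (Suc k) * norm q ^ k)"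
    using geometric_deriv_sums[of "norm q"] q by (auto intro: sums_summable)
  then have sM: "summable M" unfolding M_def by (rule summable_mult)
  have t: "norm (t k) \<le> 2 * (of_nat (Suc k) * norm q ^ k)" for k
  proof -
    have "k * 2 \<le> k * (k + 1)" by (cases k) auto
    then have "k * 2 div 2 \<le> k * (k + 1) div 2" by (rule div_le_mono)
    then have "k \<le> k * (k + 1) div 2" by simp
    then have "norm q ^ (k * (k + 1) div 2) \<le> norm q ^ k"
      using q by (intro power_decreasing) auto
    then have "real (2 * k + 1) * norm q ^ (k * (k + 1) div 2) \<le> (2 * real (Suc k)) * norm q ^ k"
      by (intro mult_mono) auto
    moreover have "norm (t k) = real (2 * k + 1) * norm q ^ (k * (k + 1) div 2)"
      unfolding t_def norm_mult norm_power norm_of_nat by simp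
    ultimately have "norm (t k) \<le> (2 * real (Suc k)) * norm q ^ k" by metis
    then show ?thesis by (simp only: mult.assoc)
  qed
  have tan: "eventually (\<lambda>n. summable (\<lambda>k. norm (a k n))) sequentially \<and> summable (\<lambda>k. norm (t k / P)) \<and>
        (\<lambda>n. suminf (\<lambda>k. a k n)) \<longlonglongrightarrow> suminf (\<lambda>k. t k / P)"
  proof (rule tannerys_theorem[OF _ _ sM])
    fix k
    have "(\<lambda>n. t k * (qfact q (2*n+1) * (inverse (qfact q (n+1+k)) * inverse (qfact q (n - k))))) \<longlonglongrightarrow> t k * (P * (inverse P * inverse P))"
      by (intro tendsto_intros P0 filterlim_compose[OF lim])
         (auto intro!: filterlim_subseq strict_monoI filterlim_minus_const_nat_at_top)
    then have "(\<lambda>n. t k * (qfact q (2*n+1) * (inverse (qfact q (n+1+k)) * inverse (qfact q (n - k))))) \<longlonglongrightarrow> t k / P"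
      using P0 by (simp add: field_simps)
    moreover have "eventually (\<lambda>n. t k * (qfact q (2*n+1) * (inverse (qfact q (n+1+k)) * inverse (qfact q (n - k)))) = a k n) sequentially"
      using eventually_ge_at_top[of k]
    proof eventually_elim
      case (elim n)
      then have "2 * n + 1 - (n + 1 + k) = n - k" by simp
      with elim show ?case unfolding a_def qbinom_def by (simp add: field_simps)
    qed
    ultimately show "(\<lambda>n. a k n) \<longlonglongrightarrow> t k / P" by (rule Lim_transform_eventually)
  next
    have "norm (a k n) \<le> M k" for k n
    proof (cases "k \<le> n")
      case True
      have "norm (t k) * norm (qbinom q (2*n+1) (n+1+k)) \<le> (2 * (of_nat (Suc k) * norm q ^ k)) * C"
        by (intro mult_mono t qb) auto
      with True show ?thesis by (simp add: a_def M_def norm_mult algebra_simps)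
    next
      case False
      then show ?thesis using B0 by (simp add: a_def M_def C_def)
    qed
    then show "eventually (\<lambda>(k,n). norm (a k n) \<le> M k) (at_top \<times>\<^sub>F sequentially)"
      by (intro always_eventually) auto
  qed simp
  have "suminf (\<lambda>k. a k n) = qfact q n ^ 2" for n
  proof -
    have "suminf (\<lambda>k. a k n) = (\<Sum>k\<le>n. a k n)"
      by (rule suminf_finite) (auto simp: a_def)
    also have "\<dots> = (\<Sum>k\<le>n. t k * qbinom q (2*n+1) (n+1+k))"
      by (rule sum.cong) (auto simp: a_def)
    finally show ?thesis using finite_jacobi_cube[OF q, of n] by (simp add: t_def)
  qed
  with tan have "(\<lambda>n. qfact q n ^ 2) \<longlonglongrightarrow> suminf (\<lambda>k. t k / P)" by simp
  moreover have "(\<lambda>n. qfact q n ^ 2) \<longlonglongrightarrow> P ^ 2" by (intro tendsto_intros lim)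
  ultimately have "suminf (\<lambda>k. t k / P) = P ^ 2" using LIMSEQ_unique by blast
  moreover have "summable (\<lambda>k. t k / P)" 
    by (rule summable_norm_cancel[OF tan[THEN conjunct2, THEN conjunct1]])
  ultimately have "(\<lambda>k. t k / P) sums P ^ 2" by (simp add: sums_iff)
  from sums_mult[OF this, of P] have "t sums P ^ 3"
    using P0 by (simp add: power2_eq_square power3_eq_cube mult.assoc)
  then show ?thesis unfolding t_def P_def .
qed

section \<open>Theta functions\<close>

abbreviation jtheta_term :: "real \<Rightarrow> real \<Rightarrow> complex \<Rightarrow> complex \<Rightarrow> int \<Rightarrow> complex" where
  "jtheta_term a b \<tau> z n \<equiv>
     e2pi (\<tau> * of_real ((of_int n + a / 2)\<^sup>2) / 2 + of_real (of_int n + a / 2) * (z + of_real (b / 2)))"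

lemma jtheta_e2pi:
  "jtheta a b \<tau> z = (\<Sum>\<^sub>\<infinity>n::int. jtheta_term a b \<tau> z n)"
  unfolding jtheta_def e2pi_def by (intro infsum_cong arg_cong[where f=exp]) (simp add: algebra_simps)

lemma jtheta_term_bound:
  assumes "Im \<tau> > 0" "norm z \<le> r"
  shows "norm (jtheta_term a b \<tau> z n)
    \<le> exp (pi * r * \<bar>a\<bar>) * exp ((2 * pi * r + pi * Im \<tau> * \<bar>a\<bar>) * \<bar>of_int n\<bar> - pi * Im \<tau> * (of_int n)\<^sup>2)"
proof -
  define x where "x = of_int n + a / 2"
  have r: "r \<ge> 0" "\<bar>Im z\<bar> \<le> r" using assms(2) norm_ge_zero[of z] abs_Im_le_cmod[of z] by linarith+
  have xx: "\<bar>x\<bar> \<le> \<bar>of_int n\<bar> + \<bar>a\<bar> / 2" unfolding x_def by linarith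
  have "- (x * Im z) \<le> \<bar>x\<bar> * r"
    using mult_left_mono[OF r(2), of "\<bar>x\<bar>"] by (simp flip: abs_mult)
  also have "\<dots> \<le> (\<bar>of_int n\<bar> + \<bar>a\<bar> / 2) * r" using xx r by (intro mult_right_mono)
  finally have 1: "- (x * Im z) \<le> (\<bar>of_int n\<bar> + \<bar>a\<bar> / 2) * r" .
  have "(of_int n)\<^sup>2 - \<bar>a\<bar> * \<bar>of_int n\<bar> \<le> x\<^sup>2"
  proof -
    have "x\<^sup>2 = (of_int n)\<^sup>2 + a * of_int n + a\<^sup>2 / 4" unfolding x_def by (simp add: power2_eq_square field_simps)
    moreover have "- (\<bar>a\<bar> * \<bar>of_int n\<bar>) \<le> a * of_int n" by (simp flip: abs_mult)
    moreover have "0 \<le> a\<^sup>2" by simp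
    ultimately show ?thesis by linarith
  qed
  then have 2: "Im \<tau> * ((of_int n)\<^sup>2 - \<bar>a\<bar> * \<bar>of_int n\<bar>) \<le> Im \<tau> * x\<^sup>2"
    using assms(1) by (intro mult_left_mono) auto
  have "- 2 * pi * (Im \<tau> * x\<^sup>2 / 2 + x * Im z) = pi * (2 * (- (x * Im z)) - Im \<tau> * x\<^sup>2)"
    by (simp add: algebra_simps)
  also have "\<dots> \<le> pi * (2 * ((\<bar>of_int n\<bar> + \<bar>a\<bar> / 2) * r) - Im \<tau> * ((of_int n)\<^sup>2 - \<bar>a\<bar> * \<bar>of_int n\<bar>))"
    using 1 2 by (intro mult_left_mono) auto
  also have "\<dots> = pi * r * \<bar>a\<bar> + ((2 * pi * r + pi * Im \<tau> * \<bar>a\<bar>) * \<bar>of_int n\<bar> - pi * Im \<tau> * (of_int n)\<^sup>2)"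
    by (simp add: field_simps)
  finally have "- 2 * pi * (Im \<tau> * x\<^sup>2 / 2 + x * Im z) \<le> pi * r * \<bar>a\<bar> + ((2 * pi * r + pi * Im \<tau> * \<bar>a\<bar>) * \<bar>of_int n\<bar> - pi * Im \<tau> * (of_int n)\<^sup>2)" .
  moreover have "Im (\<tau> * of_real (x\<^sup>2) / 2 + of_real x * (z + of_real (b / 2))) = Im \<tau> * x\<^sup>2 / 2 + x * Im z"
    by simp
  ultimately show ?thesis
    unfolding norm_e2pi exp_add[symmetric] x_def[symmetric] exp_le_cancel_iff by (simp only:)
qed

lemma jtheta_bound_exists:
  assumes "Im \<tau> > 0"
  shows "\<exists>M. M summable_on (UNIV :: int set) \<and> (\<forall>n\<in>UNIV. \<forall>w. norm w \<le> r \<longrightarrow>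
     norm (jtheta_term a b \<tau> w n) \<le> M n)"
proof (intro exI conjI ballI allI impI)
  show "(\<lambda>n. exp (pi * r * \<bar>a\<bar>) * exp ((2 * pi * r + pi * Im \<tau> * \<bar>a\<bar>) * \<bar>of_int n\<bar> - (pi * Im \<tau>) * (of_int n)\<^sup>2)) summable_on (UNIV :: int set)"
    by (intro summable_on_cmult_right summable_on_gauss_int) (use assms in simp)
qed (rule jtheta_term_bound[OF assms])

lemma jtheta_deriv:
  assumes "Im \<tau> > 0"
  shows "(jtheta a b \<tau> has_field_derivative
      (\<Sum>\<^sub>\<infinity>n::int. 2 * of_real pi * \<i> * of_real (of_int n + a / 2) *
        jtheta_term a b \<tau> z n)) (at z)"
    and "(\<lambda>n::int. 2 * of_real pi * \<i> * of_real (of_int n + a / 2) *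
        jtheta_term a b \<tau> z n) summable_on UNIV"
proof -
  let ?f = "\<lambda>(n::int) w. jtheta_term a b \<tau> w n"
  have d: "(?f n has_field_derivative 2 * of_real pi * \<i> * of_real (of_int n + a / 2) * ?f n w) (at w)" for n w
    by (rule derivative_eq_intros refl)+ simp
  note * = has_field_derivative_infsum[where f = ?f, OF d jtheta_bound_exists[OF assms], where z = z]
  have "jtheta a b \<tau> = (\<lambda>w. \<Sum>\<^sub>\<infinity>n. ?f n w)"
    by (rule ext) (rule jtheta_e2pi)
  with * show "(jtheta a b \<tau> has_field_derivative
      (\<Sum>\<^sub>\<infinity>n::int. 2 * of_real pi * \<i> * of_real (of_int n + a / 2) * ?f n z)) (at z)" by simp
  show "(\<lambda>n::int. 2 * of_real pi * \<i> * of_real (of_int n + a / 2) * ?f n z) summable_on UNIV"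
    by (rule *(2))
qed

lemma jtheta_holomorphic: "Im \<tau> > 0 \<Longrightarrow> jtheta a b \<tau> holomorphic_on A"
  by (rule holomorphic_on_subset[of _ UNIV])
     (auto simp: holomorphic_on_open field_differentiable_def intro: jtheta_deriv(1) intro!: exI)

lemma jtheta_00:
  "jtheta 0 0 \<tau> z = (\<Sum>\<^sub>\<infinity>n::int. e2pi (\<tau> * of_int (n\<^sup>2) / 2 + of_int n * z))"
  unfolding jtheta_e2pi by simp

text \<open>All theta functions are translates of a single one, up to an elementary factor.\<close>

lemma jtheta_eq_jtheta_00:
  "jtheta a b \<tau> z = e2pi (\<tau> * of_real a ^ 2 / 8 + of_real a * (z + of_real b / 2) / 2) * jtheta 0 0 \<tau> (z + of_real b / 2 + of_real a * \<tau> / 2)"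
  unfolding jtheta_00 unfolding jtheta_e2pi infsum_cmult_right'[symmetric] e2pi_add[symmetric]
  by (intro infsum_cong arg_cong[where f=e2pi]) (simp add: field_simps power2_eq_square)

lemma jtheta_00_add_int: "jtheta 0 0 \<tau> (z + of_int k) = jtheta 0 0 \<tau> z"
  unfolding jtheta_00
proof (rule infsum_cong)
  fix n :: int
  have "\<tau> * of_int (n\<^sup>2) / 2 + of_int n * (z + of_int k) = (\<tau> * of_int (n\<^sup>2) / 2 + of_int n * z) + of_int (n * k)"
    by (simp add: algebra_simps)
  then show "e2pi (\<tau> * of_int (n\<^sup>2) / 2 + of_int n * (z + of_int k)) = e2pi (\<tau> * of_int (n\<^sup>2) / 2 + of_int n * z)"
    by (simp only: e2pi_add_int)
qed

lemma jtheta_00_add_tau: "jtheta 0 0 \<tau> (z + \<tau>) = e2pi (- \<tau> / 2 - z) * jtheta 0 0 \<tau> z"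
proof -
  have "jtheta 0 0 \<tau> (z + \<tau>) = (\<Sum>\<^sub>\<infinity>n::int. e2pi (- \<tau> / 2 - z) * e2pi (\<tau> * of_int ((n + 1)\<^sup>2) / 2 + of_int (n + 1) * z))"
    unfolding jtheta_00 e2pi_add[symmetric]
    by (intro infsum_cong arg_cong[where f=e2pi]) (simp add: field_simps power2_eq_square)
  also have "\<dots> = e2pi (- \<tau> / 2 - z) * (\<Sum>\<^sub>\<infinity>n::int. e2pi (\<tau> * of_int ((n + 1)\<^sup>2) / 2 + of_int (n + 1) * z))"
    by (rule infsum_cmult_right')
  also have "(\<Sum>\<^sub>\<infinity>n::int. e2pi (\<tau> * of_int ((n + 1)\<^sup>2) / 2 + of_int (n + 1) * z)) = jtheta 0 0 \<tau> z"
    unfolding jtheta_00 by (rule infsum_reindex_bij_witness[where i = "\<lambda>n. n - 1" and j = "\<lambda>n. n + 1"]) auto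
  finally show ?thesis .
qed

lemma Im_minus_inverse: "Im \<tau> > 0 \<Longrightarrow> Im (- 1 / \<tau>) > 0"
  by (auto simp: Im_divide complex_neq_0[symmetric] intro!: divide_pos_pos)

section \<open>The derivative of a theta function at zero\<close>

lemma two_dvd_mult_Suc: "(2::nat) dvd k * (k + 1)" and two_dvd_mult_succ_int: "(2::int) dvd n * (n + 1)"
  by simp_all

text \<open>
  The reflection \<open>n \<mapsto> - 1 - n\<close> exchanges the negative and the non-negative integers.
\<close>

lemma infsum_int_reflection:
  fixes f :: "int \<Rightarrow> complex"
  assumes sum: "f summable_on UNIV" and refl: "\<And>n. f (- 1 - n) = f n"
  shows "infsum f UNIV = 2 * suminf (\<lambda>k::nat. f (int k))"
proof -
  have U: "(UNIV :: int set) = range int \<union> range (\<lambda>k. - 1 - int k)"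
  proof (intro equalityI subsetI)
    fix x :: int
    show "x \<in> range int \<union> range (\<lambda>k. - 1 - int k)"
    proof (cases "x \<ge> 0")
      case True
      then have "x = int (nat x)" by simp
      then show ?thesis by blast
    next
      case False
      then have "x = - 1 - int (nat (- 1 - x))" by simp
      then show ?thesis by blast
    qed
  qed auto
  have s1: "f summable_on range int" "f summable_on range (\<lambda>k. - 1 - int k)"
    using sum summable_on_subset_banach by blast+
  have "infsum f UNIV = infsum f (range int) + infsum f (range (\<lambda>k. - 1 - int k))"
    unfolding U by (rule infsum_Un_disjoint[OF s1]) auto
  also have "infsum f (range int) = infsum (\<lambda>k. f (int k)) UNIV"
    by (subst infsum_reindex) (auto simp: o_def)
  also have "infsum f (range (\<lambda>k. - 1 - int k)) = infsum (\<lambda>k. f (int k)) UNIV"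
    by (subst infsum_reindex) (auto simp: o_def inj_on_def refl)
  also have "infsum (\<lambda>k. f (int k)) UNIV = suminf (\<lambda>k. f (int k))"
  proof -
    have "(\<lambda>k. f (int k)) summable_on UNIV"
      using s1(1) by (subst (asm) summable_on_reindex) (auto simp: o_def)
    then have "((\<lambda>k. f (int k)) has_sum infsum (\<lambda>k. f (int k)) UNIV) UNIV" by (rule has_sum_infsum)
    then show ?thesis using has_sum_imp_sums sums_unique by blast
  qed
  finally show ?thesis by simp
qed

lemma norm_q: "Im \<tau> > 0 \<Longrightarrow> norm (e2pi \<tau>) < 1"
  by (simp add: norm_e2pi)

lemma eta_cubed: "eta \<tau> ^ 3 = e2pi (\<tau> / 8) * (\<Prod>i. 1 - e2pi \<tau> ^ Suc i) ^ 3"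
proof -
  have "eta \<tau> = e2pi (\<tau> / 24) * (\<Prod>i. 1 - e2pi \<tau> ^ Suc i)"
    unfolding eta_def qpow_def e2pi_power by simp
  then show ?thesis by (simp add: power_mult_distrib e2pi_power del: power_Suc)
qed

lemma eta_cubed_nonzero: "Im \<tau> > 0 \<Longrightarrow> eta \<tau> ^ 3 \<noteq> 0"
  unfolding eta_cubed using qfact_tendsto(2)[OF norm_q] by simp

lemma e2pi_quarter: "e2pi (1 / 4) = \<i>"
  by (simp add: e2pi_def exp_Euler complex_eq_iff cos_of_real sin_of_real Re_exp Im_exp)

lemma e2pi_half: "e2pi (1 / 2) = - 1"
  by (simp add: e2pi_def)

lemma e2pi_half_int: "e2pi (of_nat k / 2) = (- 1) ^ k"
proof -
  have "e2pi (1/2) ^ k = e2pi (of_nat k / 2)" by (simp add: e2pi_power)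
  then show ?thesis by (simp add: e2pi_half)
qed

text \<open>
  The differentiated series is invariant under \<open>n \<mapsto> - 1 - n\<close>, and its non-negative half is the series of \<open>jacobi_cube\<close>.
\<close>

lemma jtheta_11_deriv_0:
  assumes "Im \<tau> > 0"
  shows "(jtheta 1 1 \<tau> has_field_derivative - 2 * of_real pi * eta \<tau> ^ 3) (at 0)"
proof -
  define f where "f = (\<lambda>n::int. 2 * of_real pi * \<i> * of_real (of_int n + 1 / 2) *
        jtheta_term 1 1 \<tau> 0 n)"
  have der: "(jtheta 1 1 \<tau> has_field_derivative infsum f UNIV) (at 0)" and sum: "f summable_on UNIV"
    unfolding f_def by (rule jtheta_deriv[OF assms, where a = 1 and b = 1 and z = 0])+
  have refl: "f (- 1 - n) = f n" for n
  proof -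
    have a: "of_int (- 1 - n) + 1 / 2 = - (of_int n + 1 / 2 :: real)" by simp
    have "\<tau> * of_real ((of_int n + 1 / 2)\<^sup>2) / 2 + of_real (of_int n + 1 / 2) * (0 + of_real (1 / 2))
       = (\<tau> * of_real ((- (of_int n + 1 / 2))\<^sup>2) / 2 + of_real (- (of_int n + 1 / 2)) * (0 + of_real (1 / 2))) + of_int n + 1 / 2"
      by (simp add: field_simps)
    then have "jtheta_term 1 1 \<tau> 0 n
      = - e2pi (\<tau> * of_real ((- (of_int n + 1 / 2))\<^sup>2) / 2 + of_real (- (of_int n + 1 / 2)) * (0 + of_real (1 / 2)))"
      by (simp only: e2pi_add[of _ "1/2"] e2pi_add_int e2pi_half mult_minus_right mult_1_right)
    then show ?thesis
      unfolding f_def a by (simp only: of_real_minus mult_minus_left mult_minus_right minus_minus)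
  qed
  have fk: "f (int k) = - of_real pi * e2pi (\<tau> / 8) * ((-1) ^ k * of_nat (2 * k + 1) * e2pi \<tau> ^ (k * (k + 1) div 2))" for k
  proof -
    have "complex_of_nat (k * (k + 1) div 2) * 2 = of_nat (k * (k + 1))"
      by (metis dvd_div_mult_self two_dvd_mult_Suc of_nat_mult of_nat_numeral)
    then have tri: "complex_of_nat (k * (k + 1) div 2) = of_nat (k * (k + 1)) / 2" by simp
    have "\<tau> * of_real ((of_int (int k) + 1 / 2)\<^sup>2) / 2 + of_real (of_int (int k) + 1 / 2) * (0 + of_real (1 / 2))
       = \<tau> / 8 + (1 / 4 + (of_nat k / 2 + of_nat (k * (k + 1) div 2) * \<tau>))"
      unfolding tri by (simp add: field_simps power2_eq_square)
    then have "e2pi (\<tau> * of_real ((of_int (int k) + 1 / 2)\<^sup>2) / 2 + of_real (of_int (int k) + 1 / 2) * (0 + of_real (1 / 2)))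
       = e2pi (\<tau> / 8) * (\<i> * ((-1) ^ k * e2pi \<tau> ^ (k * (k + 1) div 2)))"
      by (simp only: e2pi_add e2pi_quarter e2pi_half_int e2pi_power)
    then show ?thesis unfolding f_def by (simp add: field_simps)
  qed
  have "(\<lambda>k. f (int k)) sums (- of_real pi * e2pi (\<tau> / 8) * (\<Prod>i. 1 - e2pi \<tau> ^ Suc i) ^ 3)"
    unfolding fk by (intro sums_mult jacobi_cube norm_q assms) simp
  then have "infsum f UNIV = 2 * (- of_real pi * e2pi (\<tau> / 8) * (\<Prod>i. 1 - e2pi \<tau> ^ Suc i) ^ 3)"
    unfolding infsum_int_reflection[OF sum refl] by (simp add: sums_iff)
  then have "infsum f UNIV = - 2 * of_real pi * eta \<tau> ^ 3"
    by (simp add: eta_cubed)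
  with der show ?thesis by simp
qed

text \<open>
  Otherwise its translate \<open>jtheta 1 1 \<tau>\<close> would vanish too, but the derivative of that function at \<open>0\<close> is not zero.
\<close>

lemma jtheta_00_not_identically_zero:
  assumes "Im \<tau> > 0"
  obtains z where "jtheta 0 0 \<tau> z \<noteq> 0"
proof -
  have "\<exists>z. jtheta 0 0 \<tau> z \<noteq> 0"
  proof (rule ccontr)
    assume "\<nexists>z. jtheta 0 0 \<tau> z \<noteq> 0"
    then have "jtheta 1 1 \<tau> = (\<lambda>z. 0)"
      by (intro ext) (subst jtheta_eq_jtheta_00, simp)
    then have "((\<lambda>z. 0) has_field_derivative - 2 * of_real pi * eta \<tau> ^ 3) (at 0)"
      using jtheta_11_deriv_0[OF assms] by simp
    then have "- 2 * of_real pi * eta \<tau> ^ 3 = 0"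
      using DERIV_unique DERIV_const by blast
    then show False using eta_cubed_nonzero[OF assms] by simp
  qed
  then show ?thesis using that by blast
qed

section \<open>Inversion of theta functions and of the eta function\<close>

text \<open>
  Once the Gaussian factor is moved to the other side, both functions of \<open>z\<close> have the periodicity of \<open>jtheta 0 0 \<tau>\<close>: inversion
  exchanges the two periods. They are proportional by \<open>quasi_periodic_unique\<close>, and neither is identically zero.
\<close>

lemma jtheta_00_inversion:
  assumes "Im \<tau> > 0"
  obtains C where "C \<noteq> 0" "\<And>z. jtheta 0 0 (- 1 / \<tau>) (z / \<tau>) = C * e2pi (z\<^sup>2 / (2 * \<tau>)) * jtheta 0 0 \<tau> z"
proof -
  have t0: "\<tau> \<noteq> 0" using assms by auto
  define f where "f = (\<lambda>z. e2pi (- (z\<^sup>2) / (2 * \<tau>)) * jtheta 0 0 (- 1 / \<tau>) (z / \<tau>))"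
  have per: "f (z + 1) = f z" for z
  proof -
    have "jtheta 0 0 (- 1 / \<tau>) (z / \<tau>) = jtheta 0 0 (- 1 / \<tau>) ((z + 1) / \<tau> + - 1 / \<tau>)"
      by (simp add: add_divide_distrib)
    also have "\<dots> = e2pi (- (- 1 / \<tau>) / 2 - (z + 1) / \<tau>) * jtheta 0 0 (- 1 / \<tau>) ((z + 1) / \<tau>)"
      by (rule jtheta_00_add_tau)
    finally have "f z = e2pi (- (z\<^sup>2) / (2 * \<tau>) + (- (- 1 / \<tau>) / 2 - (z + 1) / \<tau>)) * jtheta 0 0 (- 1 / \<tau>) ((z + 1) / \<tau>)"
      unfolding f_def e2pi_add by simp
    also have "- (z\<^sup>2) / (2 * \<tau>) + (- (- 1 / \<tau>) / 2 - (z + 1) / \<tau>) = - ((z + 1)\<^sup>2) / (2 * \<tau>)"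
      using t0 by (simp add: field_simps power2_eq_square)
    finally show ?thesis by (simp add: f_def)
  qed
  have quasi: "f (z + \<tau>) = e2pi (- \<tau> / 2 - z) * f z" for z
  proof -
    have "jtheta 0 0 (- 1 / \<tau>) ((z + \<tau>) / \<tau>) = jtheta 0 0 (- 1 / \<tau>) (z / \<tau>)"
      using jtheta_00_add_int[of "- 1 / \<tau>" "z / \<tau>" 1] t0 by (simp add: add_divide_distrib)
    moreover have "- ((z + \<tau>)\<^sup>2) / (2 * \<tau>) = (- \<tau> / 2 - z) + - (z\<^sup>2) / (2 * \<tau>)"
      using t0 by (simp add: field_simps power2_eq_square)
    ultimately show ?thesis unfolding f_def by (simp only: e2pi_add mult.assoc)
  qed
  have "jtheta 0 0 (- 1 / \<tau>) \<circ> (\<lambda>z. z / \<tau>) holomorphic_on UNIV"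
    by (rule holomorphic_on_compose_gen[OF _ jtheta_holomorphic[OF Im_minus_inverse[OF assms]]])
       (use t0 in \<open>auto intro!: holomorphic_intros\<close>)
  then have hol: "f holomorphic_on UNIV"
    unfolding f_def using t0 by (auto intro!: holomorphic_intros simp: o_def)
  obtain c d where cd: "c \<noteq> 0 \<or> d \<noteq> 0" "\<And>z. c * f z = d * jtheta 0 0 \<tau> z"
    using quasi_periodic_unique[OF hol jtheta_holomorphic[OF assms] per _ quasi jtheta_00_add_tau]
      jtheta_00_add_int[of \<tau> _ 1] by (metis of_int_1)
  obtain z1 where z1: "jtheta 0 0 \<tau> z1 \<noteq> 0" using jtheta_00_not_identically_zero[OF assms] .
  obtain z2 where "jtheta 0 0 (- 1 / \<tau>) z2 \<noteq> 0"
    using jtheta_00_not_identically_zero[OF Im_minus_inverse[OF assms]] .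
  then have z2: "f (z2 * \<tau>) \<noteq> 0" using t0 by (simp add: f_def)
  have "c \<noteq> 0" using cd(1) cd(2)[of z1] z1 by auto
  moreover have "d \<noteq> 0" using cd(1) cd(2)[of "z2 * \<tau>"] z2 by auto
  ultimately have "d / c \<noteq> 0" by simp
  moreover have "jtheta 0 0 (- 1 / \<tau>) (z / \<tau>) = d / c * e2pi (z\<^sup>2 / (2 * \<tau>)) * jtheta 0 0 \<tau> z" for z
  proof -
    have "f z = d / c * jtheta 0 0 \<tau> z" using cd(2)[of z] \<open>c \<noteq> 0\<close> by (simp add: field_simps)
    then have "e2pi (z\<^sup>2 / (2 * \<tau>)) * f z = d / c * e2pi (z\<^sup>2 / (2 * \<tau>)) * jtheta 0 0 \<tau> z"
      by (simp only: mult.assoc mult.left_commute)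
    then have "e2pi (z\<^sup>2 / (2 * \<tau>)) * e2pi (- (z\<^sup>2) / (2 * \<tau>)) * jtheta 0 0 (- 1 / \<tau>) (z / \<tau>) = d / c * e2pi (z\<^sup>2 / (2 * \<tau>)) * jtheta 0 0 \<tau> z"
      unfolding f_def by (simp only: mult.assoc)
    moreover have "e2pi (z\<^sup>2 / (2 * \<tau>)) * e2pi (- (z\<^sup>2) / (2 * \<tau>)) = 1"
      unfolding e2pi_add[symmetric] by simp
    ultimately show ?thesis by simp
  qed
  ultimately show ?thesis by (rule that)
qed

text \<open>
  The same \<open>C\<close> serves all theta functions, because they are translates of \<open>\<vartheta>\<^sub>0\<^sub>0\<close>. Comparing the derivatives of
  \<open>\<vartheta>\<^sub>1\<^sub>1\<close> at \<open>0\<close> on both sides extends this to the cube of \<open>\<eta>\<close>.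
\<close>

lemma jtheta_inversion:
  assumes "Im \<tau> > 0"
  obtains C where "C \<noteq> 0"
    "\<And>(a::int) b z. jtheta (of_int a) b (- 1 / \<tau>) (z / \<tau>) = C * e2pi (z\<^sup>2 / (2 * \<tau>) - of_int a * of_real b / 4) * jtheta b (of_int a) \<tau> z"
    "eta (- 1 / \<tau>) ^ 3 = - \<i> * \<tau> * C * eta \<tau> ^ 3"
proof -
  have t0: "\<tau> \<noteq> 0" using assms by auto
  obtain C where C: "C \<noteq> 0" "\<And>z. jtheta 0 0 (- 1 / \<tau>) (z / \<tau>) = C * e2pi (z\<^sup>2 / (2 * \<tau>)) * jtheta 0 0 \<tau> z"
    using jtheta_00_inversion[OF assms] by blast
  have tr: "jtheta (of_int a) b (- 1 / \<tau>) (z / \<tau>) = C * e2pi (z\<^sup>2 / (2 * \<tau>) - of_int a * of_real b / 4) * jtheta b (of_int a) \<tau> z"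
    for a :: int and b z
  proof -
    let ?w = "z + of_real b * \<tau> / 2 - of_int a / 2"
    have "jtheta (of_int a) b (- 1 / \<tau>) (z / \<tau>)
        = e2pi (- 1 / \<tau> * of_int a ^ 2 / 8 + of_int a * (z / \<tau> + of_real b / 2) / 2) * jtheta 0 0 (- 1 / \<tau>) (z / \<tau> + of_real b / 2 + of_int a * (- 1 / \<tau>) / 2)"
      by (subst jtheta_eq_jtheta_00) simp
    also have "z / \<tau> + of_real b / 2 + of_int a * (- 1 / \<tau>) / 2 = ?w / \<tau>"
      using t0 by (simp add: field_simps)
    also have "jtheta 0 0 (- 1 / \<tau>) (?w / \<tau>) = C * e2pi (?w\<^sup>2 / (2 * \<tau>)) * jtheta 0 0 \<tau> ?w" by (rule C(2))
    also have "jtheta 0 0 \<tau> ?w = jtheta 0 0 \<tau> (z + of_int a / 2 + of_real b * \<tau> / 2)"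
      using jtheta_00_add_int[of \<tau> ?w a] by (simp add: algebra_simps)
    also have "e2pi (- 1 / \<tau> * of_int a ^ 2 / 8 + of_int a * (z / \<tau> + of_real b / 2) / 2) *
        (C * e2pi (?w\<^sup>2 / (2 * \<tau>)) * jtheta 0 0 \<tau> (z + of_int a / 2 + of_real b * \<tau> / 2))
       = C * e2pi ((- 1 / \<tau> * of_int a ^ 2 / 8 + of_int a * (z / \<tau> + of_real b / 2) / 2) + ?w\<^sup>2 / (2 * \<tau>)) * jtheta 0 0 \<tau> (z + of_int a / 2 + of_real b * \<tau> / 2)"
      unfolding e2pi_add by simp
    also have "(- 1 / \<tau> * of_int a ^ 2 / 8 + of_int a * (z / \<tau> + of_real b / 2) / 2) + ?w\<^sup>2 / (2 * \<tau>)
       = (z\<^sup>2 / (2 * \<tau>) - of_int a * of_real b / 4) + (\<tau> * of_real b ^ 2 / 8 + of_real b * (z + of_int a / 2) / 2)"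
      using t0 by (simp add: field_simps power2_eq_square)
    also have "C * e2pi \<dots> * jtheta 0 0 \<tau> (z + of_int a / 2 + of_real b * \<tau> / 2) = C * e2pi (z\<^sup>2 / (2 * \<tau>) - of_int a * of_real b / 4) * jtheta b (of_int a) \<tau> z"
      unfolding jtheta_eq_jtheta_00[of b "of_int a"] e2pi_add[of "z\<^sup>2 / (2 * \<tau>) - of_int a * of_real b / 4"] by simp
    finally show ?thesis .
  qed
  have d1: "((\<lambda>z. jtheta 1 1 (- 1 / \<tau>) (z / \<tau>)) has_field_derivative (- 2 * of_real pi * eta (- 1 / \<tau>) ^ 3) * (1 / \<tau>)) (at 0)"
  proof (rule DERIV_chain2[where f = "jtheta 1 1 (- 1 / \<tau>)" and g = "\<lambda>z. z / \<tau>"])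
    show "(jtheta 1 1 (- 1 / \<tau>) has_field_derivative (- 2 * of_real pi * eta (- 1 / \<tau>) ^ 3)) (at (0 / \<tau>))"
      using jtheta_11_deriv_0[OF Im_minus_inverse[OF assms]] by simp
    show "((\<lambda>z. z / \<tau>) has_field_derivative 1 / \<tau>) (at 0)" by (intro DERIV_cdivide DERIV_ident)
  qed
  have eq: "(\<lambda>z. jtheta 1 1 (- 1 / \<tau>) (z / \<tau>)) = (\<lambda>z. C * e2pi (z\<^sup>2 / (2 * \<tau>) - 1 / 4) * jtheta 1 1 \<tau> z)"
    using tr[of 1 1] by auto
  have d2: "((\<lambda>z. C * e2pi (z\<^sup>2 / (2 * \<tau>) - 1 / 4) * jtheta 1 1 \<tau> z) has_field_derivative
      C * e2pi (- (1 / 4)) * (- 2 * of_real pi * eta \<tau> ^ 3)) (at 0)"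
  proof -
    have "((\<lambda>z. z\<^sup>2 / (2 * \<tau>) - 1 / 4) has_field_derivative 0) (at 0)"
      by (auto intro!: derivative_eq_intros simp: t0)
    from DERIV_mult[OF DERIV_cmult[OF DERIV_e2pi[OF this], of C] jtheta_11_deriv_0[OF assms]]
    show ?thesis by (simp add: algebra_simps)
  qed
  have "- 2 * of_real pi * eta (- 1 / \<tau>) ^ 3 * (1 / \<tau>) = C * e2pi (- (1 / 4)) * (- 2 * of_real pi * eta \<tau> ^ 3)"
    by (rule DERIV_unique[OF d1[unfolded eq] d2])
  moreover have "e2pi (- (1 / 4)) = - \<i>" by (simp add: e2pi_minus e2pi_quarter)
  ultimately have "(- 2 * of_real pi) * (eta (- 1 / \<tau>) ^ 3 * (1 / \<tau>)) = (- 2 * of_real pi) * (- \<i> * C * eta \<tau> ^ 3)"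
    by (simp only: mult.assoc mult.left_commute)
  then have "eta (- 1 / \<tau>) ^ 3 * (1 / \<tau>) = - \<i> * C * eta \<tau> ^ 3"
    by (rule mult_left_cancel[THEN iffD1, rotated]) simp
  then have "eta (- 1 / \<tau>) ^ 3 * (1 / \<tau>) * \<tau> = - \<i> * C * eta \<tau> ^ 3 * \<tau>" by (simp only:)
  then have et: "eta (- 1 / \<tau>) ^ 3 = - \<i> * \<tau> * C * eta \<tau> ^ 3"
    using t0 by (simp add: algebra_simps)
  show ?thesis by (rule that[OF C(1) tr et])
qed

section \<open>Transformation of the denominators\<close>

lemma minus_one_powr: "(- 1 :: complex) powr 1 = - 1"
  by (simp add: powr_def)

text \<open>
  The two factors \<open>C\<close> from \<open>jtheta_inversion\<close> in the numerator cancel those in the denominator. As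
  \<open>(z1 + z2)\<^sup>2 - z1\<^sup>2 - z2\<^sup>2 = 2 * z1 * z2\<close>, the Gaussian factors cancel against the shift of \<open>t\<close>, and what remains is a
  sign, found by inspection of the four cases.
\<close>

lemma R_hat_inversion:
  assumes "Im \<tau> > 0" "\<epsilon> \<in> {0, 1/2}" "\<epsilon>' \<in> {0, 1/2}"
  shows "R_hat \<epsilon> \<epsilon>' (- 1 / \<tau>) (z1 / \<tau>) (z2 / \<tau>) (t - z1 * z2 / \<tau>)
     = (-1) powr of_real (4 * \<epsilon> * \<epsilon>') * \<tau> * R_hat \<epsilon>' \<epsilon> \<tau> z1 z2 t"
proof -
  have t0: "\<tau> \<noteq> 0" using assms by auto
  obtain C where C: "C \<noteq> 0"
    and tr: "\<And>(a::int) b z. jtheta (of_int a) b (- 1 / \<tau>) (z / \<tau>) = C * e2pi (z\<^sup>2 / (2 * \<tau>) - of_int a * of_real b / 4) * jtheta b (of_int a) \<tau> z"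
    and et: "eta (- 1 / \<tau>) ^ 3 = - \<i> * \<tau> * C * eta \<tau> ^ 3"
    using jtheta_inversion[OF assms(1)] by blast
  \<comment> \<open>the theta functions have integral characteristics \<open>1 - 2 * \<epsilon>'\<close> and \<open>1 - 2 * \<epsilon>\<close>\<close>
  define a b :: int where "a = (if \<epsilon>' = 0 then 1 else 0)" and "b = (if \<epsilon> = 0 then 1 else 0)"
  have ab: "1 - 2 * \<epsilon>' = of_int a" "1 - 2 * \<epsilon> = of_int b" using assms by (auto simp: a_def b_def)
  let ?E1 = "e2pi (z1\<^sup>2 / (2 * \<tau>))" and ?E2 = "e2pi (z2\<^sup>2 / (2 * \<tau>))" and ?g = "e2pi (- (of_int (a * b) / 4))"
  have th: "jtheta (of_int a) (of_int b) (- 1 / \<tau>) (z / \<tau>) = C * (e2pi (z\<^sup>2 / (2 * \<tau>)) * ?g) * jtheta (of_int b) (of_int a) \<tau> z" for z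
    using tr[of a "of_int b" z] unfolding e2pi_add[symmetric] by simp
  have sq: "(z1 + z2)\<^sup>2 / (2 * \<tau>) - 1 * 1 / 4 = (z1 * z2 / \<tau>) + (z1\<^sup>2 / (2 * \<tau>) + (z2\<^sup>2 / (2 * \<tau>) + - (1 / 4)))"
    using t0 by (simp add: field_simps power2_eq_square)
  have th1: "jtheta 1 1 (- 1 / \<tau>) (z1 / \<tau> + z2 / \<tau>) = C * (e2pi (z1 * z2 / \<tau>) * (?E1 * (?E2 * (- \<i>)))) * jtheta 1 1 \<tau> (z1 + z2)"
  proof -
    have "jtheta 1 1 (- 1 / \<tau>) (z1 / \<tau> + z2 / \<tau>) = C * e2pi ((z1 + z2)\<^sup>2 / (2 * \<tau>) - 1 * 1 / 4) * jtheta 1 1 \<tau> (z1 + z2)"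
      using tr[of 1 1 "z1 + z2"] by (simp add: add_divide_distrib)
    then show ?thesis unfolding sq e2pi_add e2pi_minus[of "1/4"] e2pi_quarter by simp
  qed
  have et2: "e2pi (t - z1 * z2 / \<tau>) = e2pi t / e2pi (z1 * z2 / \<tau>)"
    by (simp add: diff_conv_add_uminus e2pi_add e2pi_minus divide_inverse del: add_uminus_conv_diff)
  have main: "e2pi (t - z1 * z2 / \<tau>) * (eta (- 1 / \<tau>) ^ 3 * jtheta 1 1 (- 1 / \<tau>) (z1 / \<tau> + z2 / \<tau>)
        / (jtheta (of_int a) (of_int b) (- 1 / \<tau>) (z1 / \<tau>) * jtheta (of_int a) (of_int b) (- 1 / \<tau>) (z2 / \<tau>)))
     = - \<tau> / ?g\<^sup>2 * (e2pi t * (eta \<tau> ^ 3 * jtheta 1 1 \<tau> (z1 + z2) / (jtheta (of_int b) (of_int a) \<tau> z1 * jtheta (of_int b) (of_int a) \<tau> z2)))"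
    unfolding et th1 th et2 using C
    by (cases "jtheta (of_int b) (of_int a) \<tau> z1 = 0 \<or> jtheta (of_int b) (of_int a) \<tau> z2 = 0")
       (auto simp: field_simps power2_eq_square)
  have sign: "(-1) powr of_real (2 * \<epsilon> * (1 - 2 * \<epsilon>')) * (- \<tau> / ?g\<^sup>2) = (-1) powr of_real (4 * \<epsilon> * \<epsilon>') * \<tau> * (-1) powr of_real (2 * \<epsilon>' * (1 - 2 * \<epsilon>))"
    using assms(2,3) unfolding a_def b_def
    by (elim insertE emptyE; hypsubst) (simp_all add: minus_one_powr e2pi_minus e2pi_quarter)
  have "R_hat \<epsilon> \<epsilon>' (- 1 / \<tau>) (z1 / \<tau>) (z2 / \<tau>) (t - z1 * z2 / \<tau>)
      = (-1) powr of_real (2 * \<epsilon> * (1 - 2 * \<epsilon>')) * \<i> * (e2pi (t - z1 * z2 / \<tau>) * (eta (- 1 / \<tau>) ^ 3 * jtheta 1 1 (- 1 / \<tau>) (z1 / \<tau> + z2 / \<tau>)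
        / (jtheta (of_int a) (of_int b) (- 1 / \<tau>) (z1 / \<tau>) * jtheta (of_int a) (of_int b) (- 1 / \<tau>) (z2 / \<tau>))))"
    unfolding R_hat_def ab by (simp only: mult.assoc)
  also have "\<dots> = ((-1) powr of_real (2 * \<epsilon> * (1 - 2 * \<epsilon>')) * (- \<tau> / ?g\<^sup>2)) * (\<i> * (e2pi t * (eta \<tau> ^ 3 * jtheta 1 1 \<tau> (z1 + z2) / (jtheta (of_int b) (of_int a) \<tau> z1 * jtheta (of_int b) (of_int a) \<tau> z2))))"
    unfolding main by (simp only: mult.assoc mult.left_commute)
  also have "\<dots> = (-1) powr of_real (4 * \<epsilon> * \<epsilon>') * \<tau> * R_hat \<epsilon>' \<epsilon> \<tau> z1 z2 t"
    unfolding sign unfolding R_hat_def ab by (simp only: mult.assoc)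
  finally show ?thesis .
qed

text \<open>
  The new factors are \<open>e2pi (n * (n + 1) / 2 + 1 / 8)\<close> for \<open>a = 1\<close> and \<open>e2pi (n\<^sup>2 / 2)\<close> for \<open>a = 0\<close>. The product \<open>n * (n + 1)\<close> is even, and
  \<open>n\<^sup>2\<close> has the parity of \<open>n\<close>.
\<close>

lemma jtheta_translate:
  assumes "a \<in> {0, 1}" "b \<in> {0, 1}"
  shows "jtheta a b (\<tau> + 1) z = (if a = 1 then e2pi (1 / 8) * jtheta 1 b \<tau> z else jtheta 0 (1 - b) \<tau> z)"
proof (cases "a = 1")
  case True
  have "jtheta 1 b (\<tau> + 1) z = e2pi (1 / 8) * jtheta 1 b \<tau> z"
    unfolding jtheta_e2pi infsum_cmult_right'[symmetric]
  proof (rule infsum_cong)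
    fix n :: int
    have "of_int (n * (n + 1) div 2) * 2 = (of_int (n * (n + 1)) :: complex)"
      by (metis dvd_div_mult_self two_dvd_mult_succ_int of_int_mult of_int_numeral)
    then have tri: "(of_int (n * (n + 1) div 2) :: complex) = of_int (n * (n + 1)) / 2" by simp
    have "(\<tau> + 1) * of_real ((of_int n + 1 / 2)\<^sup>2) / 2 + of_real (of_int n + 1 / 2) * (z + of_real (b / 2))
       = (1 / 8 + (\<tau> * of_real ((of_int n + 1 / 2)\<^sup>2) / 2 + of_real (of_int n + 1 / 2) * (z + of_real (b / 2)))) + of_int (n * (n + 1) div 2)"
      unfolding tri by (simp add: field_simps power2_eq_square)
    then show "e2pi ((\<tau> + 1) * of_real ((of_int n + 1 / 2)\<^sup>2) / 2 + of_real (of_int n + 1 / 2) * (z + of_real (b / 2)))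
       = e2pi (1 / 8) * e2pi (\<tau> * of_real ((of_int n + 1 / 2)\<^sup>2) / 2 + of_real (of_int n + 1 / 2) * (z + of_real (b / 2)))"
      by (simp only: e2pi_add_int e2pi_add[of "1/8"])
  qed
  with True show ?thesis by simp
next
  case False
  with assms have a: "a = 0" by simp
  have "jtheta 0 b (\<tau> + 1) z = jtheta 0 (1 - b) \<tau> z"
    unfolding jtheta_e2pi
  proof (rule infsum_cong)
    fix n :: int
    obtain k :: int where k: "n\<^sup>2 + n * (2 * (if b = 0 then 0 else 1) - 1) = 2 * k"
    proof -
      have "even (n\<^sup>2 + n * (2 * (if b = 0 then 0 else 1) - 1))" by simp
      then show ?thesis using that by (elim evenE)
    qed
    have bb: "b = of_int (if b = 0 then 0 else 1)" using assms by auto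
    have "of_int (n\<^sup>2 + n * (2 * (if b = 0 then 0 else 1) - 1)) = (of_int (2 * k) :: complex)" using k by simp
    then have k': "(of_int n)\<^sup>2 / 2 + of_int n * (of_real b - 1 / 2) = (of_int k :: complex)"
      by (subst bb) (simp add: field_simps)
    have "(\<tau> + 1) * of_real ((of_int n + 0 / 2)\<^sup>2) / 2 + of_real (of_int n + 0 / 2) * (z + of_real (b / 2))
      = (\<tau> * of_real ((of_int n + 0 / 2)\<^sup>2) / 2 + of_real (of_int n + 0 / 2) * (z + of_real ((1 - b) / 2))) + of_int k"
      unfolding k'[symmetric] by (simp add: field_simps)
    then show "e2pi ((\<tau> + 1) * of_real ((of_int n + 0 / 2)\<^sup>2) / 2 + of_real (of_int n + 0 / 2) * (z + of_real (b / 2)))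
      = e2pi (\<tau> * of_real ((of_int n + 0 / 2)\<^sup>2) / 2 + of_real (of_int n + 0 / 2) * (z + of_real ((1 - b) / 2)))"
      by (simp only: e2pi_add_int)
  qed
  with a show ?thesis by simp
qed

lemma eta_cubed_translate: "eta (\<tau> + 1) ^ 3 = e2pi (1 / 8) * eta \<tau> ^ 3"
  unfolding eta_cubed using e2pi_add_int[of \<tau> 1] by (simp add: add_divide_distrib e2pi_add)

lemma R_hat_translate:
  assumes "\<epsilon> \<in> {0, 1/2}" "\<epsilon>' \<in> {0, 1/2}"
  shows "R_hat \<epsilon> \<epsilon>' (\<tau> + 1) z1 z2 t = e2pi (of_real \<epsilon>' / 2) * R_hat \<bar>\<epsilon> - \<epsilon>'\<bar> \<epsilon>' \<tau> z1 z2 t"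
proof -
  have e: "e2pi (1/4) = e2pi (1/8) * e2pi (1/8)" unfolding e2pi_add[symmetric] by simp
  show ?thesis
    using assms unfolding R_hat_def
    by (elim insertE emptyE; hypsubst) (simp_all add: jtheta_translate eta_cubed_translate minus_one_powr e)
qed

section \<open>The error function\<close>

lemma E_fun_0 [simp]: "E_fun 0 = 0"
  by (simp add: E_fun_def zero_ereal_def[symmetric])

lemma E_fun_deriv: "(E_fun has_real_derivative 2 * exp (- pi * x\<^sup>2)) (at x)"
proof -
  define R where "R = \<bar>x\<bar> + 1"
  have "((\<lambda>u. LBINT y=ereal 0..ereal u. exp (- pi * y\<^sup>2)) has_vector_derivative exp (- pi * x\<^sup>2)) (at x within {-R..R})"
    by (rule interval_integral_FTC2) (auto simp: R_def intro!: continuous_intros)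
  moreover have "at x within {-R..R} = at x"
    by (rule at_within_interior) (auto simp: R_def)
  ultimately have "((\<lambda>u. LBINT y=ereal 0..ereal u. exp (- pi * y\<^sup>2)) has_real_derivative exp (- pi * x\<^sup>2)) (at x)"
    by (simp only: has_real_derivative_iff_has_vector_derivative)
  from DERIV_cmult[OF this, of 2] show ?thesis
    unfolding E_fun_def[abs_def] zero_ereal_def .
qed

lemma E_fun_minus: "E_fun (- x) = - E_fun x"
proof -
  have "(\<lambda>x. E_fun x + E_fun (- x)) x = (\<lambda>x. E_fun x + E_fun (- x)) 0"
  proof (rule DERIV_isconst_all[where f = "\<lambda>x. E_fun x + E_fun (- x)"], intro allI)
    fix y
    have "((\<lambda>x. E_fun (- x)) has_real_derivative 2 * exp (- pi * (- y)\<^sup>2) * (-1)) (at y)"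
      by (rule DERIV_chain2[where f = E_fun and g = "\<lambda>x. - x"]) (rule E_fun_deriv, auto intro!: derivative_eq_intros)
    from DERIV_add[OF E_fun_deriv[of y] this]
    show "((\<lambda>x. E_fun x + E_fun (- x)) has_real_derivative 0) (at y)" by simp
  qed
  then show ?thesis by simp
qed

lemma E_fun_mono: "x \<le> y \<Longrightarrow> E_fun x \<le> E_fun y"
  by (rule DERIV_nonneg_imp_nondecreasing[of x y E_fun]) (auto intro!: exI E_fun_deriv)

text \<open>The Gaussian integral over the half-line, rescaled by \<open>sqrt pi\<close>.\<close>

lemma E_fun_tendsto_1: "(E_fun \<longlongrightarrow> 1) at_top"
proof -
  define F where "F = (\<lambda>x. sqrt pi / 2 * E_fun (x / sqrt pi))"
  have F: "(F has_real_derivative exp (- x\<^sup>2)) (at x)" for x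
  proof -
    have "((\<lambda>x. E_fun (x / sqrt pi)) has_real_derivative 2 * exp (- pi * (x / sqrt pi)\<^sup>2) * (1 / sqrt pi)) (at x)"
      by (rule DERIV_chain2[where f = E_fun and g = "\<lambda>x. x / sqrt pi"]) (rule E_fun_deriv, intro DERIV_cdivide DERIV_ident)
    from DERIV_cmult[OF this, of "sqrt pi / 2"] show ?thesis
      unfolding F_def by (simp add: power_divide)
  qed
  have g: "integrable lborel (\<lambda>x. indicator {0..} x *\<^sub>R exp (- x\<^sup>2) :: real)"
    "(\<integral>x. indicator {0..} x *\<^sub>R exp (- x\<^sup>2) \<partial>lborel) = sqrt pi / 2"
    using gaussian_moment_0 by (auto simp: has_bochner_integral_iff)
  have "((\<lambda>y. \<integral>x. indicator {..y} x *\<^sub>R (indicator {0..} x *\<^sub>R exp (- x\<^sup>2)) \<partial>lborel) \<longlongrightarrow> sqrt pi / 2) at_top"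
    using tendsto_integral_at_top[OF _ g(1)] unfolding g(2) by simp
  moreover have "eventually (\<lambda>y. (\<integral>x. indicator {..y} x *\<^sub>R (indicator {0..} x *\<^sub>R exp (- x\<^sup>2)) \<partial>lborel) = F y) at_top"
    using eventually_ge_at_top[of 0]
  proof eventually_elim
    case (elim y)
    have "(\<integral>x. indicator {..y} x *\<^sub>R (indicator {0..} x *\<^sub>R exp (- x\<^sup>2)) \<partial>lborel) = (\<integral>x. indicator {0..y} x *\<^sub>R exp (- x\<^sup>2) \<partial>lborel)"
      by (rule Bochner_Integration.integral_cong) (auto simp: indicator_def)
    also have "\<dots> = F y - F 0"
      by (rule integral_FTC_atLeastAtMost[OF elim])
         (auto intro!: continuous_intros has_vector_derivative_at_within F simp flip: has_real_derivative_iff_has_vector_derivative intro: DERIV_subset)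
    finally show ?case by (simp add: F_def)
  qed
  ultimately have "(F \<longlongrightarrow> sqrt pi / 2) at_top" by (rule Lim_transform_eventually)
  moreover have "filterlim (\<lambda>x::real. x * sqrt pi) at_top at_top"
    by (rule filterlim_at_top_mult_tendsto_pos[OF tendsto_const _ filterlim_ident]) simp
  ultimately have "((\<lambda>x. F (x * sqrt pi)) \<longlongrightarrow> sqrt pi / 2) at_top"
    by (rule filterlim_compose)
  then have "((\<lambda>x. F (x * sqrt pi) / (sqrt pi / 2)) \<longlongrightarrow> (sqrt pi / 2) / (sqrt pi / 2)) at_top"
    by (intro tendsto_divide tendsto_const) auto
  then show ?thesis by (simp add: F_def)
qed

lemma E_fun_le_1: "E_fun x \<le> 1"
  by (rule tendsto_lowerbound[OF E_fun_tendsto_1])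
     (auto intro!: eventually_mono[OF eventually_ge_at_top[of x]] E_fun_mono)

text \<open>
  On \<open>x \<ge> 1 / (2 * pi)\<close> the function \<open>2 * exp (- pi * x\<^sup>2) + E_fun x\<close> decreases to its limit \<open>1\<close>; for smaller \<open>x\<close> the
  exponential alone is at least \<open>1 / 2\<close>.
\<close>

lemma E_fun_tail:
  assumes "x \<ge> 0"
  shows "1 - E_fun x \<le> 2 * exp (- pi * x\<^sup>2)"
proof (cases "x \<ge> 1 / (2 * pi)")
  case True
  define h where "h = (\<lambda>x. 2 * exp (- pi * x\<^sup>2) + E_fun x)"
  have dh: "(h has_real_derivative (2 - 4 * pi * y) * exp (- pi * y\<^sup>2)) (at y)" for y
  proof -
    have "((\<lambda>x. 2 * exp (- pi * x\<^sup>2)) has_real_derivative - 4 * pi * y * exp (- pi * y\<^sup>2)) (at y)"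
      by (auto intro!: derivative_eq_intros)
    from DERIV_add[OF this E_fun_deriv] show ?thesis unfolding h_def by (simp add: algebra_simps)
  qed
  have dec: "h b \<le> h x" if "x \<le> b" for b
  proof (rule DERIV_nonpos_imp_nonincreasing[OF that])
    fix y assume "x \<le> y" "y \<le> b"
    with True have "y \<ge> 1 / (2 * pi)" by linarith
    then have "2 - 4 * pi * y \<le> 0" by (simp add: field_simps)
    then show "\<exists>d. (h has_real_derivative d) (at y) \<and> d \<le> 0"
      using dh[of y] by (intro exI conjI) (auto simp: mult_le_0_iff)
  qed
  have "((\<lambda>b. 2 * exp (- (pi * b\<^sup>2)) + E_fun b) \<longlongrightarrow> 2 * 0 + 1) at_top"
    by (intro tendsto_intros E_fun_tendsto_1 filterlim_compose[OF exp_at_bot]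
        filterlim_compose[OF filterlim_uminus_at_bot_at_top] filterlim_tendsto_pos_mult_at_top[OF tendsto_const] filterlim_pow_at_top filterlim_ident) auto
  then have "(h \<longlongrightarrow> 1) at_top" by (simp add: h_def)
  then have "1 \<le> h x"
    by (rule tendsto_upperbound) (auto intro!: eventually_mono[OF eventually_ge_at_top[of x]] dec)
  then show ?thesis by (simp add: h_def)
next
  case False
  then have x: "x < 1 / (2 * pi)" by simp
  have "x\<^sup>2 \<le> (1 / (2 * pi))\<^sup>2" using assms x by (intro power_mono) auto
  then have "pi * x\<^sup>2 \<le> pi * (1 / (2 * pi))\<^sup>2" by (intro mult_left_mono) auto
  also have "\<dots> = 1 / (4 * pi)" by (simp add: power2_eq_square)
  also have "\<dots> \<le> 1 / 8" using pi_ge_two by (simp add: field_simps)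
  finally have "1 / 2 \<le> 1 + (- pi * x\<^sup>2)" by simp
  also have "\<dots> \<le> exp (- pi * x\<^sup>2)" by (rule exp_ge_add_one_self)
  finally have "1 \<le> 2 * exp (- pi * x\<^sup>2)" by simp
  moreover have "E_fun x \<ge> 0" using E_fun_mono[OF assms] by simp
  ultimately show ?thesis by linarith
qed

lemma sgn_minus_E_fun_bound: "\<bar>sgn x - E_fun x\<bar> \<le> 2 * exp (- pi * x\<^sup>2)"
proof (cases x "0::real" rule: linorder_cases)
  case less
  then have "1 - E_fun (- x) \<le> 2 * exp (- pi * (- x)\<^sup>2)" "E_fun (- x) \<le> 1"
    using E_fun_tail[of "- x"] E_fun_le_1[of "- x"] by simp_all
  with less show ?thesis by (simp add: E_fun_minus)
next
  case greater
  then show ?thesis using E_fun_tail[of x] E_fun_le_1[of x] by simp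
qed simp

section \<open>Differentiation of sums in a real parameter\<close>

lemma sums_infsum_int_decode:
  fixes f :: "int \<Rightarrow> 'a::{t2_space, topological_comm_monoid_add}"
  assumes "f summable_on UNIV"
  shows "(\<lambda>i. f (int_decode i)) sums infsum f UNIV"
proof -
  have "((\<lambda>i. f (int_decode i)) has_sum infsum f UNIV) UNIV"
    using has_sum_reindex_bij_betw[OF bij_int_decode, of f "infsum f UNIV"] has_sum_infsum[OF assms] by simp
  then show ?thesis by (rule has_sum_imp_sums)
qed

text \<open>
  An enumeration of the integers turns the unordered sum into a series, which is differentiated by
  uniform convergence of the derivatives on bounded intervals.
\<close>

lemma has_vector_derivative_infsum_int:
  fixes f :: "int \<Rightarrow> real \<Rightarrow> complex"
  assumes d: "\<And>n x. (f n has_vector_derivative f' n x) (at x)"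
    and sum: "\<And>x. (\<lambda>n. f n x) summable_on UNIV"
    and bound: "\<And>K. \<exists>M. M summable_on UNIV \<and> (\<forall>n x. \<bar>x\<bar> \<le> K \<longrightarrow> norm (f' n x) \<le> M n)"
  shows "((\<lambda>x. \<Sum>\<^sub>\<infinity>n. f n x) has_vector_derivative (\<Sum>\<^sub>\<infinity>n. f' n x)) (at x)"
proof -
  define K where "K = \<bar>x\<bar> + 1"
  obtain M where M: "M summable_on UNIV" "\<And>n x. \<bar>x\<bar> \<le> K \<Longrightarrow> norm (f' n x) \<le> M n"
    using bound[of K] by blast
  define S where "S = {-K<..<K}"
  have xS: "x \<in> S" and opS: "open S" by (auto simp: S_def K_def)
  let ?g' = "\<lambda>y. \<Sum>i. f' (int_decode i) y"
  have summable_M: "summable (\<lambda>i. M (int_decode i))"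
    using sums_infsum_int_decode[OF M(1)] by (rule sums_summable)
  have ul: "uniform_limit S (\<lambda>n y. \<Sum>i<n. f' (int_decode i) y) ?g' sequentially"
    by (rule Weierstrass_m_test[OF _ summable_M]) (auto intro!: M(2) simp: S_def)
  have "\<exists>g. \<forall>y\<in>S. (\<lambda>i. f (int_decode i) y) sums g y \<and> (g has_derivative (\<lambda>h. h *\<^sub>R ?g' y)) (at y within S)"
  proof (rule has_derivative_series[where f' = "\<lambda>i y h. h *\<^sub>R f' (int_decode i) y" and x = x])
    show "convex S" by (simp add: S_def)
    show "(f (int_decode n) has_derivative (\<lambda>h. h *\<^sub>R f' (int_decode n) y)) (at y within S)" for n y
      using d[of "int_decode n" y] unfolding has_vector_derivative_def by (rule has_derivative_at_withinI)
    show "(\<lambda>n. f (int_decode n) x) sums (\<Sum>\<^sub>\<infinity>n. f n x)"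
      using sums_infsum_int_decode[OF sum] .
    fix e :: real assume "e > 0"
    from uniform_limitD[OF ul this]
    show "\<forall>\<^sub>F n in sequentially. \<forall>y\<in>S. \<forall>h. norm ((\<Sum>i<n. h *\<^sub>R f' (int_decode i) y) - h *\<^sub>R ?g' y) \<le> e * norm h"
    proof eventually_elim
      case (elim n)
      show ?case
      proof (intro ballI allI)
        fix y h :: real assume "y \<in> S"
        then have "norm ((\<Sum>i<n. f' (int_decode i) y) - ?g' y) \<le> e"
          using elim by (auto simp: dist_norm intro: less_imp_le)
        then have "\<bar>h\<bar> * norm ((\<Sum>i<n. f' (int_decode i) y) - ?g' y) \<le> \<bar>h\<bar> * e"
          by (intro mult_left_mono) auto
        then show "norm ((\<Sum>i<n. h *\<^sub>R f' (int_decode i) y) - h *\<^sub>R ?g' y) \<le> e * norm h"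
          unfolding scaleR_sum_right[symmetric] scaleR_right_diff_distrib[symmetric] norm_scaleR
          by (simp only: real_norm_def mult.commute)
      qed
    qed
  qed (rule xS)
  then obtain g where g: "\<And>y. y \<in> S \<Longrightarrow> (\<lambda>i. f (int_decode i) y) sums g y"
    "(g has_derivative (\<lambda>h. h *\<^sub>R ?g' x)) (at x within S)" using xS by blast
  have gx: "g y = (\<Sum>\<^sub>\<infinity>n. f n y)" if "y \<in> S" for y
    using sums_unique2[OF g(1)[OF that] sums_infsum_int_decode[OF sum]] .
  have "(g has_vector_derivative ?g' x) (at x)"
    using g(2) unfolding has_vector_derivative_def at_within_open[OF xS opS] .
  then have "((\<lambda>x. \<Sum>\<^sub>\<infinity>n. f n x) has_vector_derivative ?g' x) (at x)"
    by (rule has_vector_derivative_transform_within_open[OF _ opS xS]) (rule gx)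
  moreover have "(\<lambda>n. f' n x) summable_on UNIV"
  proof (rule abs_summable_summable, rule summable_on_comparison_test[OF M(1)])
    show "norm (f' n x) \<le> M n" for n by (rule M(2)) (simp add: K_def)
  qed auto
  from sums_unique[OF sums_infsum_int_decode[OF this]] have "?g' x = (\<Sum>\<^sub>\<infinity>n. f' n x)"
    by simp
  ultimately show ?thesis by simp
qed

section \<open>The kernel identity\<close>

text \<open>
  Written with \<open>k = - n\<close>, the sign in the sum \<open>R_corr j\<close> with \<open>j \<in> {- s..- s + 2 * m + 1}\<close> depends on \<open>k\<close>
  and \<open>s\<close> alone: see \<open>R_corr_eq\<close>.
\<close>

definition sgn_cut :: "int \<Rightarrow> int \<Rightarrow> real" where
  "sgn_cut s k = (if k < - s then 1 else -1)"

abbreviation fourier_term :: "real \<Rightarrow> int \<Rightarrow> real \<Rightarrow> complex \<Rightarrow> int \<Rightarrow> complex" where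
  "fourier_term \<kappa> s r z k \<equiv> of_real (sgn_cut s k - E_fun ((r - of_int k) * sqrt \<kappa>)) * e2pi (of_int k * z)"

abbreviation gauss_term :: "real \<Rightarrow> real \<Rightarrow> complex \<Rightarrow> int \<Rightarrow> complex" where
  "gauss_term \<kappa> r z b \<equiv> exp (- (of_real (pi / \<kappa>) * (z + of_int b)\<^sup>2)) * e2pi (of_real r * (z + of_int b))"

abbreviation heat_term :: "real \<Rightarrow> real \<Rightarrow> complex \<Rightarrow> int \<Rightarrow> complex" where
  "heat_term \<kappa> r z k \<equiv> of_real (exp (- pi * \<kappa> * (r - of_int k)\<^sup>2)) * e2pi (of_int k * z)"

text \<open>
  The two sides of the kernel identity. They occur below with \<open>\<kappa> = Im \<tau> / N\<close>, \<open>r = N * Im (z1 - z2) / Im \<tau>\<close> and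
  \<open>z = z1 + a * \<tau>\<close>: up to a common factor, \<open>kernel_fourier\<close> is then the part of the completed Appell sum
  that belongs to the summation index \<open>a\<close>, and \<open>kernel_gauss\<close> the corresponding row of a sum over the lattice
  \<open>\<int> \<tau> + \<int>\<close>.
\<close>

definition kernel_fourier :: "real \<Rightarrow> int \<Rightarrow> real \<Rightarrow> complex \<Rightarrow> complex" where
  "kernel_fourier \<kappa> s r z = e2pi (- of_int s * z) / (1 - e2pi z)
     + 1 / 2 * (\<Sum>\<^sub>\<infinity>k::int. fourier_term \<kappa> s r z k)"

definition kernel_gauss :: "real \<Rightarrow> real \<Rightarrow> complex \<Rightarrow> complex" where
  "kernel_gauss \<kappa> r z = \<i> / (2 * of_real pi) *
     (\<Sum>\<^sub>\<infinity>b::int. gauss_term \<kappa> r z b / (z + of_int b))"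

lemma mult_le_bound_abs:
  fixes r k K :: real
  assumes "\<bar>r\<bar> \<le> K"
  shows "r * k \<le> K * \<bar>k\<bar>" "- (r * k) \<le> K * \<bar>k\<bar>"
proof -
  have "\<bar>r * k\<bar> \<le> K * \<bar>k\<bar>"
    unfolding abs_mult using assms by (intro mult_right_mono) auto
  then show "r * k \<le> K * \<bar>k\<bar>" "- (r * k) \<le> K * \<bar>k\<bar>" by linarith+
qed

text \<open>
  The function \<open>E_fun\<close> approaches the sign of its argument at a Gaussian rate, and for \<open>\<bar>k\<bar> > K\<close> the value of \<open>sgn_cut s k\<close> is the
  sign of \<open>r - k\<close>. The finitely many other values of \<open>k\<close> are absorbed by the constant.
\<close>

lemma sgn_cut_minus_E_fun_bound:
  assumes "\<kappa> > 0" "\<bar>r\<bar> + \<bar>of_int s\<bar> + 1 \<le> K"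
  shows "\<bar>sgn_cut s k - E_fun ((r - of_int k) * sqrt \<kappa>)\<bar> \<le> (2 + 2 * exp (pi * \<kappa> * K\<^sup>2)) * exp (2 * pi * \<kappa> * K * \<bar>of_int k\<bar> - pi * \<kappa> * (of_int k)\<^sup>2)"
proof -
  let ?G = "exp (2 * pi * \<kappa> * K * \<bar>of_int k\<bar> - pi * \<kappa> * (of_int k)\<^sup>2)"
  have K: "K \<ge> 1" "\<bar>r\<bar> \<le> K" using assms by linarith+
  have "\<bar>sgn ((r - of_int k) * sqrt \<kappa>) - E_fun ((r - of_int k) * sqrt \<kappa>)\<bar> \<le> 2 * exp (- pi * ((r - of_int k) * sqrt \<kappa>)\<^sup>2)"
    by (rule sgn_minus_E_fun_bound)
  moreover have "exp (- pi * ((r - of_int k) * sqrt \<kappa>)\<^sup>2) \<le> ?G"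
  proof -
    have "r * of_int k \<le> K * \<bar>of_int k\<bar>"
      by (rule mult_le_bound_abs[OF K(2)])
    then have "(of_int k)\<^sup>2 - 2 * K * \<bar>of_int k\<bar> \<le> (r - of_int k)\<^sup>2"
      unfolding power2_diff using zero_le_power2[of r] by linarith
    then have "pi * \<kappa> * ((of_int k)\<^sup>2 - 2 * K * \<bar>of_int k\<bar>) \<le> pi * \<kappa> * (r - of_int k)\<^sup>2"
      using assms by (intro mult_left_mono) auto
    moreover have "- pi * ((r - of_int k) * sqrt \<kappa>)\<^sup>2 = - (pi * \<kappa> * (r - of_int k)\<^sup>2)"
      using assms by (simp add: power_mult_distrib)
    ultimately show ?thesis by (simp add: algebra_simps)
  qed
  moreover have "\<bar>sgn_cut s k - sgn ((r - of_int k) * sqrt \<kappa>)\<bar> \<le> 2 * exp (pi * \<kappa> * K\<^sup>2) * ?G"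
  proof (cases "\<bar>of_int k\<bar> \<le> K")
    case True
    have "\<bar>sgn_cut s k - sgn ((r - of_int k) * sqrt \<kappa>)\<bar> \<le> 2"
      by (auto simp: sgn_cut_def sgn_if)
    also have "2 \<le> 2 * exp (pi * \<kappa> * K\<^sup>2 + (2 * pi * \<kappa> * K * \<bar>of_int k\<bar> - pi * \<kappa> * (of_int k)\<^sup>2))"
    proof -
      have "(of_int k)\<^sup>2 \<le> K\<^sup>2" using True K by (simp add: abs_le_square_iff[symmetric])
      then have "pi * \<kappa> * (of_int k)\<^sup>2 \<le> pi * \<kappa> * K\<^sup>2" using assms by (intro mult_left_mono) auto
      moreover have "0 \<le> 2 * pi * \<kappa> * K * \<bar>of_int k\<bar>" using assms K by simp
      ultimately have "0 \<le> pi * \<kappa> * K\<^sup>2 + (2 * pi * \<kappa> * K * \<bar>of_int k\<bar> - pi * \<kappa> * (of_int k)\<^sup>2)" by linarith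
      then have "1 \<le> exp (pi * \<kappa> * K\<^sup>2 + (2 * pi * \<kappa> * K * \<bar>of_int k\<bar> - pi * \<kappa> * (of_int k)\<^sup>2))"
        by (simp only: one_le_exp_iff)
      then show ?thesis by linarith
    qed
    finally show ?thesis by (simp add: exp_add)
  next
    case False
    then consider "of_int k > K" | "of_int k < - K" by linarith
    then have "sgn_cut s k = sgn ((r - of_int k) * sqrt \<kappa>)"
    proof cases
      case 1
      then have "r - of_int k < 0" "real_of_int (- s) < of_int k" using assms(2) by auto
      then show ?thesis using assms(1) by (simp add: sgn_cut_def sgn_mult)
    next
      case 2
      then have "r - of_int k > 0" "real_of_int k < of_int (- s)" using assms(2) by auto
      then show ?thesis using assms(1) by (simp add: sgn_cut_def sgn_mult)
    qed
    then show ?thesis by simp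
  qed
  ultimately show ?thesis unfolding distrib_right by linarith
qed

lemma kernel_fourier_term_bound:
  assumes "\<kappa> > 0" "\<bar>r\<bar> + \<bar>of_int s\<bar> + 1 \<le> K"
  shows "norm (fourier_term \<kappa> s r z k)
    \<le> (2 + 2 * exp (pi * \<kappa> * K\<^sup>2)) * exp ((2 * pi * \<kappa> * K + 2 * pi * \<bar>Im z\<bar>) * \<bar>of_int k\<bar> - pi * \<kappa> * (of_int k)\<^sup>2)"
proof -
  have "- (Im z * of_int k) \<le> \<bar>Im z\<bar> * \<bar>of_int k\<bar>" by (rule mult_le_bound_abs) simp
  then have "2 * pi * (- (Im z * of_int k)) \<le> 2 * pi * (\<bar>Im z\<bar> * \<bar>of_int k\<bar>)"
    by (rule mult_left_mono) simp
  then have "norm (e2pi (of_int k * z)) \<le> exp (2 * pi * \<bar>Im z\<bar> * \<bar>of_int k\<bar>)"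
    unfolding norm_e2pi exp_le_cancel_iff by (simp add: algebra_simps)
  then have "norm (fourier_term \<kappa> s r z k)
    \<le> ((2 + 2 * exp (pi * \<kappa> * K\<^sup>2)) * exp (2 * pi * \<kappa> * K * \<bar>of_int k\<bar> - pi * \<kappa> * (of_int k)\<^sup>2)) * exp (2 * pi * \<bar>Im z\<bar> * \<bar>of_int k\<bar>)"
    unfolding norm_mult norm_of_real
    by (intro mult_mono sgn_cut_minus_E_fun_bound assms) auto
  also have "\<dots> = (2 + 2 * exp (pi * \<kappa> * K\<^sup>2)) * exp ((2 * pi * \<kappa> * K + 2 * pi * \<bar>Im z\<bar>) * \<bar>of_int k\<bar> - pi * \<kappa> * (of_int k)\<^sup>2)"
    by (simp add: mult.assoc exp_add[symmetric] algebra_simps)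
  finally show ?thesis .
qed

lemma kernel_fourier_summable:
  assumes "\<kappa> > 0"
  shows "(\<lambda>k. norm (fourier_term \<kappa> s r z k)) summable_on UNIV"
proof -
  let ?K = "\<bar>r\<bar> + \<bar>of_int s\<bar> + 1"
  have "(\<lambda>k::int. (2 + 2 * exp (pi * \<kappa> * ?K\<^sup>2)) * exp ((2 * pi * \<kappa> * ?K + 2 * pi * \<bar>Im z\<bar>) * \<bar>of_int k\<bar> - (pi * \<kappa>) * (of_int k)\<^sup>2)) summable_on UNIV"
    by (intro summable_on_cmult_right summable_on_gauss_int) (use assms in simp)
  then show ?thesis
    by (rule summable_on_comparison_test) (use kernel_fourier_term_bound[OF assms order_refl] in auto)
qed

text \<open>
  Passing from \<open>s\<close> to \<open>s + 1\<close> changes the Fourier coefficient of \<open>k = - s - 1\<close> only. The change cancels the one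
  of \<open>e2pi (- s * z) / (1 - e2pi z)\<close>, so \<open>kernel_fourier\<close> is the same for all \<open>s\<close>.
\<close>

lemma kernel_fourier_cut:
  assumes "\<kappa> > 0" "z \<notin> \<int>"
  shows "kernel_fourier \<kappa> (s + 1) r z = kernel_fourier \<kappa> s r z"
proof -
  let ?f = "\<lambda>s k. fourier_term \<kappa> s r z k"
  have X: "e2pi z \<noteq> 1" using assms by (simp add: e2pi_eq_1_iff)
  have "(?f s has_sum infsum (?f s) UNIV) UNIV"
    by (rule has_sum_infsum[OF abs_summable_summable[OF kernel_fourier_summable[OF assms(1)]]])
  moreover have "((\<lambda>k. if k = - s - 1 then - 2 * e2pi (of_int (- s - 1) * z) else 0) has_sum (- 2 * e2pi (of_int (- s - 1) * z))) UNIV"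
    by (rule has_sum_finite_neutralI[where B = "{- s - 1}"]) auto
  ultimately have "((\<lambda>k. ?f s k + (if k = - s - 1 then - 2 * e2pi (of_int (- s - 1) * z) else 0)) has_sum (infsum (?f s) UNIV + (- 2 * e2pi (of_int (- s - 1) * z)))) UNIV"
    by (rule has_sum_add)
  moreover have "?f s k + (if k = - s - 1 then - 2 * e2pi (of_int (- s - 1) * z) else 0) = ?f (s + 1) k" for k
  proof (cases "k = - s - 1")
    case True
    show ?thesis unfolding True by (simp add: sgn_cut_def ring_distribs)
  next
    case False
    then have "k < - (s + 1) \<longleftrightarrow> k < - s" by auto
    with False show ?thesis by (simp add: sgn_cut_def)
  qed
  ultimately have "infsum (?f (s + 1)) UNIV = infsum (?f s) UNIV + (- 2 * e2pi (of_int (- s - 1) * z))"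
    by (simp add: infsumI)
  moreover have "e2pi (- of_int (s + 1) * z) / (1 - e2pi z) = e2pi (- of_int s * z) / (1 - e2pi z) + e2pi (of_int (- s - 1) * z)"
  proof -
    have A: "e2pi (- of_int s * z) = e2pi (of_int (- s - 1) * z) * e2pi z"
      unfolding e2pi_add[symmetric] by (simp add: algebra_simps)
    have B: "- of_int (s + 1) * z = of_int (- s - 1) * z" by (simp add: algebra_simps)
    show ?thesis unfolding A B using X by (simp add: field_simps)
  qed
  ultimately show ?thesis unfolding kernel_fourier_def by (simp add: algebra_simps)
qed

text \<open>
  A shift of \<open>k\<close> by 1 turns \<open>r + 1\<close> into \<open>r\<close> and \<open>s\<close> into \<open>s + 1\<close>; then \<open>kernel_fourier_cut\<close> applies.
\<close>

lemma kernel_fourier_add_1: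
  assumes "\<kappa> > 0" "z \<notin> \<int>"
  shows "kernel_fourier \<kappa> s (r + 1) z = e2pi z * kernel_fourier \<kappa> s r z"
proof -
  let ?f = "\<lambda>s r k. fourier_term \<kappa> s r z k"
  have "infsum (?f s (r + 1)) UNIV = infsum (\<lambda>k. e2pi z * ?f (s + 1) r k) UNIV"
  proof (rule infsum_reindex_bij_witness[where i = "\<lambda>k. k + 1" and j = "\<lambda>k. k - 1"])
    fix k :: int
    have "of_int k * z = z + of_int (k - 1) * z" by (simp add: algebra_simps)
    then have "e2pi (of_int k * z) = e2pi z * e2pi (of_int (k - 1) * z)" by (metis e2pi_add)
    then show "e2pi z * ?f (s + 1) r (k - 1) = ?f s (r + 1) k"
      by (simp add: sgn_cut_def algebra_simps)
  qed auto
  then have "infsum (?f s (r + 1)) UNIV = e2pi z * infsum (?f (s + 1) r) UNIV"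
    by (simp add: infsum_cmult_right')
  moreover have "e2pi (- of_int s * z) = e2pi z * e2pi (- of_int (s + 1) * z)"
    unfolding e2pi_add[symmetric] by (simp add: algebra_simps)
  ultimately have "kernel_fourier \<kappa> s (r + 1) z = e2pi z * kernel_fourier \<kappa> (s + 1) r z"
    unfolding kernel_fourier_def by (simp add: algebra_simps)
  then show ?thesis using kernel_fourier_cut[OF assms] by simp
qed

lemma kernel_fourier_deriv:
  assumes "\<kappa> > 0"
  shows "((\<lambda>r. kernel_fourier \<kappa> s r z) has_vector_derivative
      - (of_real (sqrt \<kappa>) * (\<Sum>\<^sub>\<infinity>k::int. heat_term \<kappa> r z k))) (at r)"
proof -
  let ?f = "\<lambda>k r. fourier_term \<kappa> s r z k"
  let ?f' = "\<lambda>k r. of_real (- 2 * exp (- pi * \<kappa> * (r - of_int k)\<^sup>2) * sqrt \<kappa>) * e2pi (of_int k * z)"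
  have "((\<lambda>r. \<Sum>\<^sub>\<infinity>k. ?f k r) has_vector_derivative (\<Sum>\<^sub>\<infinity>k. ?f' k r)) (at r)"
  proof (rule has_vector_derivative_infsum_int)
    show "(\<lambda>k. ?f k x) summable_on UNIV" for x
      by (rule abs_summable_summable[OF kernel_fourier_summable[OF assms]])
    fix k x
    have "((\<lambda>r. E_fun ((r - of_int k) * sqrt \<kappa>)) has_real_derivative 2 * exp (- pi * ((x - of_int k) * sqrt \<kappa>)\<^sup>2) * sqrt \<kappa>) (at x)"
      by (rule DERIV_chain2[where f = E_fun and g = "\<lambda>r. (r - of_int k) * sqrt \<kappa>"]) (rule E_fun_deriv, auto intro!: derivative_eq_intros)
    from DERIV_diff[OF DERIV_const this]
    have "((\<lambda>r. sgn_cut s k - E_fun ((r - of_int k) * sqrt \<kappa>)) has_real_derivative 0 - 2 * exp (- pi * ((x - of_int k) * sqrt \<kappa>)\<^sup>2) * sqrt \<kappa>) (at x)" .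
    moreover have "((x - of_int k) * sqrt \<kappa>)\<^sup>2 = \<kappa> * (x - of_int k)\<^sup>2"
      using assms by (simp add: power_mult_distrib)
    then have "0 - 2 * exp (- pi * ((x - of_int k) * sqrt \<kappa>)\<^sup>2) * sqrt \<kappa> = - 2 * exp (- pi * \<kappa> * (x - of_int k)\<^sup>2) * sqrt \<kappa>"
      by (simp add: mult.assoc)
    ultimately have "((\<lambda>r. sgn_cut s k - E_fun ((r - of_int k) * sqrt \<kappa>)) has_real_derivative - 2 * exp (- pi * \<kappa> * (x - of_int k)\<^sup>2) * sqrt \<kappa>) (at x)"
      by (simp only:)
    then have "((\<lambda>r. of_real (sgn_cut s k - E_fun ((r - of_int k) * sqrt \<kappa>))) has_vector_derivative complex_of_real (- 2 * exp (- pi * \<kappa> * (x - of_int k)\<^sup>2) * sqrt \<kappa>)) (at x)"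
      by (intro has_vector_derivative_of_real)
    then show "(?f k has_vector_derivative ?f' k x) (at x)"
      by (rule has_vector_derivative_mult_left)
  next
    fix K :: real
    have "norm (?f' k x) \<le> 2 * sqrt \<kappa> * exp ((2 * pi * \<kappa> * \<bar>K\<bar> + 2 * pi * \<bar>Im z\<bar>) * \<bar>of_int k\<bar> - pi * \<kappa> * (of_int k)\<^sup>2)"
      if x: "\<bar>x\<bar> \<le> K" for k :: int and x
    proof -
      have xk: "x * of_int k \<le> \<bar>K\<bar> * \<bar>of_int k\<bar>"
        using x by (intro mult_le_bound_abs) linarith
      have "0 \<le> x\<^sup>2" by simp
      with xk have "(of_int k)\<^sup>2 - 2 * \<bar>K\<bar> * \<bar>of_int k\<bar> \<le> (x - of_int k)\<^sup>2"
        unfolding power2_diff by linarith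
      then have 1: "pi * \<kappa> * ((of_int k)\<^sup>2 - 2 * \<bar>K\<bar> * \<bar>of_int k\<bar>) \<le> pi * \<kappa> * (x - of_int k)\<^sup>2"
        using assms by (intro mult_left_mono) auto
      have "- (of_int k * Im z) \<le> \<bar>of_int k\<bar> * \<bar>Im z\<bar>" by (simp flip: abs_mult)
      then have 2: "pi * (- (of_int k * Im z)) \<le> pi * (\<bar>of_int k\<bar> * \<bar>Im z\<bar>)" by (intro mult_left_mono) auto
      have "norm (?f' k x) = (2 * exp (- pi * \<kappa> * (x - of_int k)\<^sup>2) * sqrt \<kappa>) * exp (- 2 * pi * Im (of_int k * z))"
        unfolding norm_mult norm_of_real norm_e2pi using assms by (simp add: abs_mult)
      also have "\<dots> = 2 * sqrt \<kappa> * exp (- pi * \<kappa> * (x - of_int k)\<^sup>2 - 2 * pi * (of_int k * Im z))"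
      proof -
        have e: "- pi * \<kappa> * (x - of_int k)\<^sup>2 - 2 * pi * (of_int k * Im z) = - pi * \<kappa> * (x - of_int k)\<^sup>2 + - 2 * pi * Im (of_int k * z)"
          by simp
        show ?thesis unfolding e exp_add by (simp only: mult_ac)
      qed
      also have "\<dots> \<le> 2 * sqrt \<kappa> * exp ((2 * pi * \<kappa> * \<bar>K\<bar> + 2 * pi * \<bar>Im z\<bar>) * \<bar>of_int k\<bar> - pi * \<kappa> * (of_int k)\<^sup>2)"
        using 1 2 assms by (intro mult_left_mono) (auto simp: algebra_simps)
      finally show ?thesis .
    qed
    moreover have "(\<lambda>k::int. 2 * sqrt \<kappa> * exp ((2 * pi * \<kappa> * \<bar>K\<bar> + 2 * pi * \<bar>Im z\<bar>) * \<bar>of_int k\<bar> - (pi * \<kappa>) * (of_int k)\<^sup>2)) summable_on UNIV"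
      by (intro summable_on_cmult_right summable_on_gauss_int) (use assms in simp)
    ultimately show "\<exists>M. M summable_on UNIV \<and> (\<forall>k x. \<bar>x\<bar> \<le> K \<longrightarrow> norm (?f' k x) \<le> M k)"
      by (intro exI[of _ "\<lambda>k::int. 2 * sqrt \<kappa> * exp ((2 * pi * \<kappa> * \<bar>K\<bar> + 2 * pi * \<bar>Im z\<bar>) * \<bar>of_int k\<bar> - (pi * \<kappa>) * (of_int k)\<^sup>2)"]) auto
  qed
  then have "((\<lambda>r. kernel_fourier \<kappa> s r z) has_vector_derivative 0 + 1 / 2 * (\<Sum>\<^sub>\<infinity>k. ?f' k r)) (at r)"
    unfolding kernel_fourier_def by (intro has_vector_derivative_add has_vector_derivative_const has_vector_derivative_mult_right)
  moreover have "(\<Sum>\<^sub>\<infinity>k. ?f' k r) = (- 2 * of_real (sqrt \<kappa>)) * (\<Sum>\<^sub>\<infinity>k::int. heat_term \<kappa> r z k)"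
    unfolding infsum_cmult_right'[symmetric] by (rule infsum_cong) simp
  then have "0 + 1 / 2 * (\<Sum>\<^sub>\<infinity>k. ?f' k r) = - (of_real (sqrt \<kappa>) * (\<Sum>\<^sub>\<infinity>k::int. heat_term \<kappa> r z k))"
    by simp
  ultimately show ?thesis by (simp only:)
qed

text \<open>Only finitely many of the numbers \<open>z + b\<close> lie in the unit disc.\<close>

lemma dist_Ints_lower_bound:
  fixes z :: complex
  assumes "z \<notin> \<int>"
  obtains \<delta> where "\<delta> > 0" "\<And>b::int. norm (z + of_int b) \<ge> \<delta>"
proof -
  define N where "N = \<lceil>norm z\<rceil> + 1"
  define F where "F = insert 1 ((\<lambda>b::int. norm (z + of_int b)) ` {-N..N})"
  have fin: "finite F" "F \<noteq> {}" by (auto simp: F_def)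
  have pos: "norm (z + of_int b) > 0" for b :: int
  proof -
    have "z + of_int b \<noteq> 0"
    proof
      assume "z + of_int b = 0"
      then have "z = of_int (- b)" by (simp add: eq_neg_iff_add_eq_0)
      with assms show False by auto
    qed
    then show ?thesis by simp
  qed
  have "Min F > 0" using fin pos by (auto simp: F_def)
  moreover have "norm (z + of_int b) \<ge> Min F" for b :: int
  proof (cases "b \<in> {-N..N}")
    case True
    then show ?thesis using fin by (intro Min_le) (auto simp: F_def)
  next
    case False
    then have "real_of_int \<bar>b\<bar> \<ge> norm z + 1" unfolding N_def by (auto simp: abs_if) linarith+
    then have "1 \<le> norm (z + of_int b)"
      using norm_triangle_ineq4[of "z + of_int b" z] by simp
    moreover have "Min F \<le> 1" using fin by (intro Min_le) (auto simp: F_def)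
    ultimately show ?thesis by linarith
  qed
  ultimately show ?thesis by (rule that)
qed

text \<open>
  Uniform in \<open>\<bar>r\<bar> \<le> K\<close>, so that it also dominates the series of derivatives with respect to \<open>r\<close>.
\<close>

lemma gauss_term_bound:
  assumes "\<kappa> > 0" "\<bar>r\<bar> \<le> K"
  shows "norm (gauss_term \<kappa> r z b)
    \<le> exp (pi / \<kappa> * (Im z)\<^sup>2 + 2 * pi * K * \<bar>Im z\<bar>) * exp (2 * pi / \<kappa> * \<bar>Re z\<bar> * \<bar>of_int b\<bar> - pi / \<kappa> * (of_int b)\<^sup>2)"
proof -
  have "- (r * Im z) \<le> K * \<bar>Im z\<bar>"
    by (rule mult_le_bound_abs[OF assms(2)])
  then have 1: "2 * pi * (- (r * Im z)) \<le> 2 * pi * (K * \<bar>Im z\<bar>)" by (intro mult_left_mono) auto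
  have "- (Re z * of_int b) \<le> \<bar>Re z\<bar> * \<bar>of_int b\<bar>" by (simp flip: abs_mult)
  moreover have "0 \<le> (Re z)\<^sup>2" by simp
  ultimately have "(of_int b)\<^sup>2 - 2 * \<bar>Re z\<bar> * \<bar>of_int b\<bar> \<le> (Re z + of_int b)\<^sup>2"
    unfolding power2_sum by linarith
  then have 2: "pi / \<kappa> * ((of_int b)\<^sup>2 - 2 * \<bar>Re z\<bar> * \<bar>of_int b\<bar>) \<le> pi / \<kappa> * (Re z + of_int b)\<^sup>2"
    using assms by (intro mult_left_mono) auto
  have "norm (gauss_term \<kappa> r z b)
    = exp (- (pi / \<kappa> * ((Re z + of_int b)\<^sup>2 - (Im z)\<^sup>2)) + 2 * pi * (- (r * Im z)))"
    unfolding norm_mult norm_e2pi norm_exp_eq_Re exp_add[symmetric]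
    by (simp add: power2_eq_square Re_divide_of_real)
  also have "\<dots> \<le> exp ((pi / \<kappa> * (Im z)\<^sup>2 + 2 * pi * K * \<bar>Im z\<bar>) + (2 * pi / \<kappa> * \<bar>Re z\<bar> * \<bar>of_int b\<bar> - pi / \<kappa> * (of_int b)\<^sup>2))"
    using 1 2 unfolding exp_le_cancel_iff by (simp add: algebra_simps)
  finally show ?thesis unfolding exp_add .
qed

lemma gauss_bound_summable:
  assumes "\<kappa> > 0"
  shows "(\<lambda>b::int. C * exp (c * \<bar>of_int b\<bar> - pi / \<kappa> * (of_int b)\<^sup>2)) summable_on UNIV"
  by (intro summable_on_cmult_right summable_on_gauss_int) (use assms in simp)

lemma kernel_gauss_summable:
  assumes "\<kappa> > 0" "z \<notin> \<int>"
  shows "(\<lambda>b::int. norm (gauss_term \<kappa> r z b / (z + of_int b))) summable_on UNIV"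
proof -
  obtain \<delta> where \<delta>: "\<delta> > 0" "\<And>b::int. norm (z + of_int b) \<ge> \<delta>"
    using dist_Ints_lower_bound[OF assms(2)] by blast
  show ?thesis
  proof (rule summable_on_comparison_test)
    show "(\<lambda>b::int. exp (pi / \<kappa> * (Im z)\<^sup>2 + 2 * pi * \<bar>r\<bar> * \<bar>Im z\<bar>) / \<delta> * exp (2 * pi / \<kappa> * \<bar>Re z\<bar> * \<bar>of_int b\<bar> - pi / \<kappa> * (of_int b)\<^sup>2)) summable_on UNIV"
      by (rule gauss_bound_summable[OF assms(1)])
    fix b :: int
    have "norm (gauss_term \<kappa> r z b / (z + of_int b))
      \<le> (exp (pi / \<kappa> * (Im z)\<^sup>2 + 2 * pi * \<bar>r\<bar> * \<bar>Im z\<bar>) * exp (2 * pi / \<kappa> * \<bar>Re z\<bar> * \<bar>of_int b\<bar> - pi / \<kappa> * (of_int b)\<^sup>2)) / \<delta>"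
      unfolding norm_divide by (intro frac_le gauss_term_bound assms \<delta>) auto
    then show "norm (gauss_term \<kappa> r z b / (z + of_int b))
      \<le> exp (pi / \<kappa> * (Im z)\<^sup>2 + 2 * pi * \<bar>r\<bar> * \<bar>Im z\<bar>) / \<delta> * exp (2 * pi / \<kappa> * \<bar>Re z\<bar> * \<bar>of_int b\<bar> - pi / \<kappa> * (of_int b)\<^sup>2)"
      by simp
  qed auto
qed

lemma kernel_gauss_add_1: "kernel_gauss \<kappa> (r + 1) z = e2pi z * kernel_gauss \<kappa> r z"
proof -
  have "e2pi (of_real (r + 1) * (z + of_int b)) = e2pi z * e2pi (of_real r * (z + of_int b))" for b :: int
  proof -
    have "of_real (r + 1) * (z + of_int b) = (z + of_real r * (z + of_int b)) + of_int b" by (simp add: algebra_simps)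
    then show ?thesis by (simp only: e2pi_add_int e2pi_add[of z])
  qed
  then have "(\<Sum>\<^sub>\<infinity>b::int. gauss_term \<kappa> (r + 1) z b / (z + of_int b))
     = (\<Sum>\<^sub>\<infinity>b::int. e2pi z * (gauss_term \<kappa> r z b / (z + of_int b)))"
    by (intro infsum_cong) simp
  then show ?thesis
    unfolding kernel_gauss_def infsum_cmult_right' by (simp only: mult.left_commute)
qed

text \<open>
  Differentiation with respect to \<open>r\<close> produces a factor \<open>2 * pi * \<i> * (z + b)\<close>, which removes the denominator.
\<close>

lemma kernel_gauss_deriv:
  assumes "\<kappa> > 0" "z \<notin> \<int>"
  shows "((\<lambda>r. kernel_gauss \<kappa> r z) has_vector_derivative
      - (\<Sum>\<^sub>\<infinity>b::int. gauss_term \<kappa> r z b)) (at r)"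
proof -
  let ?f = "\<lambda>(b::int) r. gauss_term \<kappa> r z b / (z + of_int b)"
  let ?g = "\<lambda>(b::int) r. gauss_term \<kappa> r z b"
  have nz: "z + of_int b \<noteq> 0" for b :: int
  proof
    assume "z + of_int b = 0"
    then have "z = of_int (- b)" by (simp add: eq_neg_iff_add_eq_0)
    with assms show False by auto
  qed
  have "((\<lambda>r. \<Sum>\<^sub>\<infinity>b. ?f b r) has_vector_derivative (\<Sum>\<^sub>\<infinity>b. 2 * of_real pi * \<i> * ?g b r)) (at r)"
  proof (rule has_vector_derivative_infsum_int)
    show "(\<lambda>b. ?f b x) summable_on UNIV" for x
      by (rule abs_summable_summable[OF kernel_gauss_summable[OF assms]])
    fix b :: int and x :: real
    have "((\<lambda>w. exp (- (of_real (pi / \<kappa>) * (z + of_int b)\<^sup>2)) * e2pi (w * (z + of_int b)) / (z + of_int b)) has_field_derivative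
        exp (- (of_real (pi / \<kappa>) * (z + of_int b)\<^sup>2)) * (2 * of_real pi * \<i> * (1 * (z + of_int b)) * e2pi (of_real x * (z + of_int b))) / (z + of_int b)) (at (of_real x))"
      by (intro DERIV_cdivide DERIV_cmult DERIV_e2pi DERIV_cmult_right DERIV_ident)
    then have "(?f b has_vector_derivative
        exp (- (of_real (pi / \<kappa>) * (z + of_int b)\<^sup>2)) * (2 * of_real pi * \<i> * (1 * (z + of_int b)) * e2pi (of_real x * (z + of_int b))) / (z + of_int b)) (at x)"
      by (rule has_vector_derivative_real_field)
    moreover have "exp (- (of_real (pi / \<kappa>) * (z + of_int b)\<^sup>2)) * (2 * of_real pi * \<i> * (1 * (z + of_int b)) * e2pi (of_real x * (z + of_int b))) / (z + of_int b) = 2 * of_real pi * \<i> * ?g b x"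
      using nz[of b] by (simp only: mult_1 times_divide_eq_right[symmetric]) (simp add: field_simps)
    ultimately show "(?f b has_vector_derivative 2 * of_real pi * \<i> * ?g b x) (at x)" by simp
  next
    fix K :: real
    let ?M = "\<lambda>b::int. (2 * pi * exp (pi / \<kappa> * (Im z)\<^sup>2 + 2 * pi * K * \<bar>Im z\<bar>)) * exp (2 * pi / \<kappa> * \<bar>Re z\<bar> * \<bar>of_int b\<bar> - pi / \<kappa> * (of_int b)\<^sup>2)"
    have "?M summable_on UNIV" by (rule gauss_bound_summable[OF assms(1)])
    moreover have "norm (2 * of_real pi * \<i> * ?g b x) \<le> ?M b" if "\<bar>x\<bar> \<le> K" for b x
    proof -
      have "norm (2 * of_real pi * \<i> * ?g b x) = 2 * pi * norm (?g b x)"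
        unfolding norm_mult[of "2 * of_real pi * \<i>"] by (simp add: norm_mult)
      also have "\<dots> \<le> 2 * pi * (exp (pi / \<kappa> * (Im z)\<^sup>2 + 2 * pi * K * \<bar>Im z\<bar>) * exp (2 * pi / \<kappa> * \<bar>Re z\<bar> * \<bar>of_int b\<bar> - pi / \<kappa> * (of_int b)\<^sup>2))"
        by (intro mult_left_mono gauss_term_bound assms that) auto
      finally show ?thesis by (simp only: mult.assoc)
    qed
    ultimately show "\<exists>M. M summable_on UNIV \<and> (\<forall>b x. \<bar>x\<bar> \<le> K \<longrightarrow> norm (2 * of_real pi * \<i> * ?g b x) \<le> M b)"
      by blast
  qed
  then have "((\<lambda>r. kernel_gauss \<kappa> r z) has_vector_derivative \<i> / (2 * of_real pi) * (\<Sum>\<^sub>\<infinity>b. 2 * of_real pi * \<i> * ?g b r)) (at r)"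
    unfolding kernel_gauss_def by (rule has_vector_derivative_mult_right)
  then show ?thesis by (simp add: infsum_cmult_right')
qed

text \<open>
  Poisson summation for Gaussians, obtained from the inversion of \<open>\<vartheta>\<^sub>0\<^sub>0\<close> at \<open>\<tau> = \<i> * \<kappa>\<close>. The factor \<open>c\<close> is independent of \<open>r\<close>
  and \<open>z\<close>; the proof of \<open>kernel_identity\<close> shows that it equals \<open>1\<close>.
\<close>

lemma poisson_gauss:
  assumes "\<kappa> > 0"
  obtains c :: complex where "\<And>r z. (\<Sum>\<^sub>\<infinity>b::int. gauss_term \<kappa> r z b)
     = c * (of_real (sqrt \<kappa>) * (\<Sum>\<^sub>\<infinity>k::int. heat_term \<kappa> r z k))"
proof -
  define \<tau> where "\<tau> = \<i> * of_real \<kappa>"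
  have im: "Im \<tau> > 0" using assms by (simp add: \<tau>_def)
  have t0: "\<tau> \<noteq> 0" using assms by (simp add: \<tau>_def)
  obtain C where C: "\<And>w. jtheta 0 0 (- 1 / \<tau>) (w / \<tau>) = C * e2pi (w\<^sup>2 / (2 * \<tau>)) * jtheta 0 0 \<tau> w"
    using jtheta_00_inversion[OF im] by blast
  have e1: "exp (- (of_real (pi / \<kappa>) * x\<^sup>2)) = e2pi (- (x\<^sup>2) / (2 * \<tau>))" for x
  proof -
    have "- (of_real (pi / \<kappa>) * x\<^sup>2) = 2 * of_real pi * \<i> * (- (x\<^sup>2) / (2 * \<tau>))"
      using assms by (simp add: \<tau>_def field_simps)
    then show ?thesis unfolding e2pi_def by (simp only:)
  qed
  have e2: "of_real (exp (- pi * \<kappa> * x\<^sup>2)) = e2pi (\<tau> * of_real (x\<^sup>2) / 2)" for x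
  proof -
    have "of_real (- pi * \<kappa> * x\<^sup>2) = 2 * of_real pi * \<i> * (\<tau> * of_real (x\<^sup>2) / 2)"
      by (simp add: \<tau>_def field_simps)
    then show ?thesis unfolding e2pi_def by (simp only: exp_of_real[symmetric])
  qed
  have "(\<Sum>\<^sub>\<infinity>b::int. gauss_term \<kappa> r z b)
     = C / of_real (sqrt \<kappa>) * (of_real (sqrt \<kappa>) * (\<Sum>\<^sub>\<infinity>k::int. heat_term \<kappa> r z k))" for r z
  proof -
    \<comment> \<open>completes the square in the exponents of both sums\<close>
  define w where "w = - z + of_real r * \<tau>"
    have "(\<Sum>\<^sub>\<infinity>b::int. gauss_term \<kappa> r z b)
       = (\<Sum>\<^sub>\<infinity>b::int. e2pi (- (z\<^sup>2) / (2 * \<tau>) + of_real r * z) * e2pi ((- 1 / \<tau>) * of_int (b\<^sup>2) / 2 + of_int b * (w / \<tau>)))"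
      unfolding e1 e2pi_add[symmetric]
      by (intro infsum_cong arg_cong[where f=e2pi]) (use t0 in \<open>simp add: w_def field_simps power2_eq_square\<close>)
    also have "\<dots> = e2pi (- (z\<^sup>2) / (2 * \<tau>) + of_real r * z) * jtheta 0 0 (- 1 / \<tau>) (w / \<tau>)"
      unfolding jtheta_00 by (rule infsum_cmult_right')
    also have "\<dots> = C * (e2pi ((- (z\<^sup>2) / (2 * \<tau>) + of_real r * z) + w\<^sup>2 / (2 * \<tau>)) * jtheta 0 0 \<tau> w)"
      unfolding C e2pi_add[of _ "w\<^sup>2 / (2 * \<tau>)"] by (simp only: mult.assoc mult.left_commute)
    also have "(- (z\<^sup>2) / (2 * \<tau>) + of_real r * z) + w\<^sup>2 / (2 * \<tau>) = \<tau> * of_real (r\<^sup>2) / 2"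
      using t0 by (simp add: w_def field_simps power2_eq_square)
    also have "e2pi (\<tau> * of_real (r\<^sup>2) / 2) * jtheta 0 0 \<tau> w = (\<Sum>\<^sub>\<infinity>k::int. heat_term \<kappa> r z k)"
      unfolding jtheta_00 infsum_cmult_right'[symmetric] e2 e2pi_add[symmetric]
      by (rule infsum_reindex_bij_witness[where i = "\<lambda>k. - k" and j = "\<lambda>k. - k"])
         (auto intro!: arg_cong[where f=e2pi] simp: w_def field_simps power2_eq_square)
    finally show ?thesis using assms by simp
  qed
  then show ?thesis by (rule that)
qed

text \<open>
  By the choice of \<open>c\<close> the difference of both sides has derivative \<open>0\<close> with respect to \<open>r\<close>. It is multiplied by \<open>e2pi z \<noteq> 1\<close> when
  \<open>r\<close> increases by 1, so it vanishes.
\<close>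

lemma kernel_identity_up_to_constant:
  assumes "\<kappa> > 0" "z \<notin> \<int>"
    and c: "\<And>r z. (\<Sum>\<^sub>\<infinity>b::int. gauss_term \<kappa> r z b)
     = c * (of_real (sqrt \<kappa>) * (\<Sum>\<^sub>\<infinity>k::int. heat_term \<kappa> r z k))"
  shows "kernel_gauss \<kappa> r z = c * kernel_fourier \<kappa> s r z"
proof -
  define D where "D = (\<lambda>r. kernel_gauss \<kappa> r z - c * kernel_fourier \<kappa> s r z)"
  have "(D has_vector_derivative 0) (at r)" for r
  proof -
    have "(D has_vector_derivative
        - (\<Sum>\<^sub>\<infinity>b::int. gauss_term \<kappa> r z b)
        - c * - (of_real (sqrt \<kappa>) * (\<Sum>\<^sub>\<infinity>k::int. heat_term \<kappa> r z k))) (at r)"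
      unfolding D_def
      by (intro has_vector_derivative_diff has_vector_derivative_mult_right kernel_gauss_deriv kernel_fourier_deriv assms(1,2))
    then show ?thesis unfolding c[where r = r and z = z] by simp
  qed
  then have "(D has_derivative (\<lambda>h. 0)) (at r within UNIV)" for r
    by (simp add: has_vector_derivative_def)
  then obtain d where d: "\<And>r. D r = d"
    using has_derivative_zero_constant[of UNIV D] by auto
  have "D (r + 1) = e2pi z * D r"
    unfolding D_def kernel_gauss_add_1 kernel_fourier_add_1[OF assms(1,2)] by (simp add: algebra_simps)
  then have "(1 - e2pi z) * d = 0" by (simp add: d algebra_simps)
  moreover have "e2pi z \<noteq> 1" using assms by (simp add: e2pi_eq_1_iff)
  ultimately have "d = 0" by simp
  then show ?thesis using d[of r] by (simp add: D_def)
qed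

text \<open>
  The pole comes from the term \<open>b = 0\<close>; the sum of all other terms stays bounded near \<open>0\<close>.
\<close>

lemma tendsto_times_kernel_gauss:
  assumes "\<kappa> > 0"
  shows "((\<lambda>x. of_real x * kernel_gauss \<kappa> 0 (of_real x)) \<longlongrightarrow> \<i> / (2 * of_real pi)) (at_right 0)"
proof -
  let ?g = "\<lambda>x (b::int). exp (- (of_real (pi / \<kappa>) * (of_real x + of_int b)\<^sup>2)) / (of_real x + of_int b) :: complex"
  define M where "M = (\<lambda>b::int. 2 * exp (1 * (pi / \<kappa>) * \<bar>of_int b\<bar> - pi / \<kappa> * (of_int b)\<^sup>2))"
  have M: "M summable_on UNIV" unfolding M_def by (rule gauss_bound_summable[OF assms])
  have bd: "norm (\<Sum>\<^sub>\<infinity>b\<in>-{0}. ?g x b) \<le> infsum M (-{0})" and split: "(\<Sum>\<^sub>\<infinity>b. ?g x b) = ?g x 0 + (\<Sum>\<^sub>\<infinity>b\<in>-{0}. ?g x b)"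
    if x: "0 < x" "x < 1/2" for x
  proof -
    have le: "norm (?g x b) \<le> M b" if "b \<in> - {0}" for b
    proof -
      have "\<bar>real_of_int b\<bar> \<ge> 1" using that by simp
      then have 1: "1 / 2 \<le> \<bar>x + of_int b\<bar>" using x by linarith
      have "norm (?g x b) = exp (- (pi / \<kappa> * (x + of_int b)\<^sup>2)) / \<bar>x + of_int b\<bar>"
      proof -
        have e: "of_real x + of_int b = complex_of_real (x + of_int b)" by simp
        have "exp (- (of_real (pi / \<kappa>) * (of_real x + of_int b)\<^sup>2)) = complex_of_real (exp (- (pi / \<kappa> * (x + of_int b)\<^sup>2)))"
          unfolding e by (simp flip: exp_of_real)
        then show ?thesis unfolding e norm_divide by (simp del: of_real_add)
      qed
      also have "\<dots> \<le> exp (- (pi / \<kappa> * (x + of_int b)\<^sup>2)) / (1 / 2)"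
        using 1 by (intro divide_left_mono) auto
      also have "\<dots> \<le> M b"
      proof -
        have "- (x * of_int b) \<le> \<bar>x\<bar> * \<bar>of_int b\<bar>" by (simp flip: abs_mult)
        also have "\<dots> \<le> 1 / 2 * \<bar>of_int b\<bar>" using x by (intro mult_right_mono) auto
        finally have "(of_int b)\<^sup>2 - \<bar>of_int b\<bar> \<le> (x + of_int b)\<^sup>2"
          unfolding power2_sum using zero_le_power2[of x] by linarith
        then have "pi / \<kappa> * ((of_int b)\<^sup>2 - \<bar>of_int b\<bar>) \<le> pi / \<kappa> * (x + of_int b)\<^sup>2"
          using assms by (intro mult_left_mono) auto
        then show ?thesis unfolding M_def by (simp add: algebra_simps)
      qed
      finally show ?thesis .
    qed
    have M0: "M summable_on - {0}" using M summable_on_subset_banach by blast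
    have abs: "(\<lambda>b. norm (?g x b)) summable_on - {0}"
      by (rule summable_on_comparison_test[OF M0]) (use le in auto)
    then have s: "(\<lambda>b. ?g x b) summable_on - {0}" by (rule abs_summable_summable)
    show "norm (\<Sum>\<^sub>\<infinity>b\<in>-{0}. ?g x b) \<le> infsum M (-{0})"
      using norm_infsum_bound[OF abs] infsum_mono[OF abs M0 le] by linarith
    have "(\<Sum>\<^sub>\<infinity>b. ?g x b) = (\<Sum>\<^sub>\<infinity>b\<in>insert 0 (-{0}). ?g x b)" by (rule arg_cong[where f = "infsum _"]) auto
    also have "\<dots> = ?g x 0 + (\<Sum>\<^sub>\<infinity>b\<in>-{0}. ?g x b)" by (rule infsum_insert[OF s]) auto
    finally show "(\<Sum>\<^sub>\<infinity>b. ?g x b) = ?g x 0 + (\<Sum>\<^sub>\<infinity>b\<in>-{0}. ?g x b)" .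
  qed
  define B where "B = infsum M (-{0})"
  have ev: "eventually (\<lambda>x::real. 0 < x \<and> x < 1/2) (at_right 0)"
    by (auto simp: eventually_at_right_field intro!: exI[of _ "1/2"])
  have l1: "((\<lambda>x. complex_of_real x * (\<Sum>\<^sub>\<infinity>b\<in>-{0}. ?g x b)) \<longlongrightarrow> 0) (at_right 0)"
  proof (rule Lim_null_comparison)
    show "eventually (\<lambda>x. norm (complex_of_real x * (\<Sum>\<^sub>\<infinity>b\<in>-{0}. ?g x b)) \<le> x * B) (at_right 0)"
      using ev
    proof eventually_elim
      case (elim x)
      then show ?case unfolding norm_mult B_def using bd[of x] by (simp add: mult_left_mono)
    qed
    have "((\<lambda>x::real. x * B) \<longlongrightarrow> 0 * B) (at_right 0)" by (intro tendsto_intros)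
    then show "((\<lambda>x::real. x * B) \<longlongrightarrow> 0) (at_right 0)" by simp
  qed
  have l2: "((\<lambda>x. exp (- (of_real (pi / \<kappa>) * (complex_of_real x)\<^sup>2))) \<longlongrightarrow> exp (- (of_real (pi / \<kappa>) * (of_real 0)\<^sup>2))) (at_right 0)"
    by (intro tendsto_intros)
  have "((\<lambda>x. \<i> / (2 * of_real pi) * (exp (- (of_real (pi / \<kappa>) * (complex_of_real x)\<^sup>2)) + complex_of_real x * (\<Sum>\<^sub>\<infinity>b\<in>-{0}. ?g x b)))
      \<longlongrightarrow> \<i> / (2 * of_real pi) * (exp (- (of_real (pi / \<kappa>) * (of_real 0)\<^sup>2)) + 0)) (at_right 0)"
    by (intro tendsto_mult tendsto_const tendsto_add l1 l2)
  moreover have "eventually (\<lambda>x. \<i> / (2 * of_real pi) * (exp (- (of_real (pi / \<kappa>) * (complex_of_real x)\<^sup>2)) + complex_of_real x * (\<Sum>\<^sub>\<infinity>b\<in>-{0}. ?g x b))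
       = of_real x * kernel_gauss \<kappa> 0 (of_real x)) (at_right 0)"
    using ev
  proof eventually_elim
    case (elim x)
    then have x: "complex_of_real x \<noteq> 0" by simp
    have "kernel_gauss \<kappa> 0 (of_real x) = \<i> / (2 * of_real pi) * (?g x 0 + (\<Sum>\<^sub>\<infinity>b\<in>-{0}. ?g x b))"
      unfolding kernel_gauss_def using split[of x] elim by simp
    then show ?case using x by (simp add: field_simps)
  qed
  ultimately show ?thesis by (simp add: Lim_transform_eventually)
qed

text \<open>
  The pole comes from \<open>1 / (1 - e2pi z)\<close>; the Fourier series is bounded on the real axis.
\<close>

lemma tendsto_times_kernel_fourier:
  assumes "\<kappa> > 0"
  shows "((\<lambda>x. of_real x * kernel_fourier \<kappa> 0 0 (of_real x)) \<longlongrightarrow> \<i> / (2 * of_real pi)) (at_right 0)"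
proof -
  let ?f = "\<lambda>x k. fourier_term \<kappa> 0 0 (complex_of_real x) k"
  define B where "B = (\<Sum>\<^sub>\<infinity>k. norm (?f 0 k))"
  have bd: "norm (\<Sum>\<^sub>\<infinity>k. ?f x k) \<le> B" for x
  proof -
    have "norm (\<Sum>\<^sub>\<infinity>k. ?f x k) \<le> (\<Sum>\<^sub>\<infinity>k. norm (?f x k))"
      by (rule norm_infsum_bound) (rule kernel_fourier_summable[OF assms])
    also have "\<dots> = B" unfolding B_def by (intro infsum_cong) (simp add: norm_mult norm_e2pi)
    finally show ?thesis .
  qed
  have l1: "((\<lambda>x. complex_of_real x * (1 / 2 * (\<Sum>\<^sub>\<infinity>k. ?f x k))) \<longlongrightarrow> 0) (at_right 0)"
  proof (rule Lim_null_comparison)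
    show "eventually (\<lambda>x. norm (complex_of_real x * (1 / 2 * (\<Sum>\<^sub>\<infinity>k. ?f x k))) \<le> x * B) (at_right 0)"
      using eventually_at_right_less[of "0::real"]
    proof eventually_elim
      case (elim x)
      have "0 \<le> B" using bd[of 0] norm_ge_zero order_trans by blast
      then have "1 / 2 * norm (\<Sum>\<^sub>\<infinity>k. ?f x k) \<le> B" using bd[of x] by linarith
      then show ?case unfolding norm_mult using elim by (simp add: mult_left_mono)
    qed
    have "((\<lambda>x::real. x * B) \<longlongrightarrow> 0 * B) (at_right 0)" by (intro tendsto_intros)
    then show "((\<lambda>x::real. x * B) \<longlongrightarrow> 0) (at_right 0)" by simp
  qed
  have "((\<lambda>w. e2pi w) has_field_derivative 2 * of_real pi * \<i> * 1 * e2pi 0) (at 0)"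
    by (rule DERIV_e2pi[OF DERIV_ident])
  then have "((\<lambda>w. (e2pi w - 1) / w) \<longlongrightarrow> 2 * of_real pi * \<i>) (at 0)"
    by (simp add: has_field_derivative_iff)
  then have "((\<lambda>w. inverse (- ((e2pi w - 1) / w))) \<longlongrightarrow> inverse (- (2 * of_real pi * \<i>))) (at 0)"
    by (intro tendsto_inverse tendsto_minus) auto
  moreover have "filterlim complex_of_real (at 0) (at_right 0)"
    by (auto simp: filterlim_at intro!: tendsto_eq_intros eventually_mono[OF eventually_at_right_less[of "0::real"]])
  ultimately have "((\<lambda>x. inverse (- ((e2pi (complex_of_real x) - 1) / complex_of_real x))) \<longlongrightarrow> inverse (- (2 * of_real pi * \<i>))) (at_right 0)"
    by (rule filterlim_compose)
  moreover have inv: "inverse (- (2 * of_real pi * \<i>)) = \<i> / (2 * complex_of_real pi)"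
    by (rule inverse_unique) simp
  ultimately have "((\<lambda>x. inverse (- ((e2pi (complex_of_real x) - 1) / complex_of_real x))) \<longlongrightarrow> \<i> / (2 * complex_of_real pi)) (at_right 0)"
    by (simp only:)
  from tendsto_add[OF this l1]
  have "((\<lambda>x. inverse (- ((e2pi (complex_of_real x) - 1) / complex_of_real x)) + complex_of_real x * (1 / 2 * (\<Sum>\<^sub>\<infinity>k. ?f x k))) \<longlongrightarrow> \<i> / (2 * of_real pi)) (at_right 0)"
    by (simp only: add_0_right)
  moreover have "inverse (- ((e2pi (complex_of_real x) - 1) / complex_of_real x)) + complex_of_real x * (1 / 2 * (\<Sum>\<^sub>\<infinity>k. ?f x k)) = of_real x * kernel_fourier \<kappa> 0 0 (of_real x)" for x
  proof -
    have "inverse (- ((e2pi (complex_of_real x) - 1) / complex_of_real x)) = complex_of_real x * (1 / (1 - e2pi (complex_of_real x)))"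
    proof -
      have "- ((e2pi (complex_of_real x) - 1) / complex_of_real x) = (1 - e2pi (complex_of_real x)) / complex_of_real x"
        by (simp add: minus_divide_left)
      then show ?thesis by simp
    qed
    then show ?thesis unfolding kernel_fourier_def by (simp add: distrib_left)
  qed
  ultimately show ?thesis by simp
qed

text \<open>
  The identity is known up to a factor \<open>c\<close> independent of \<open>r\<close>, \<open>s\<close> and \<open>z\<close>. Comparing the residues at \<open>z = 0\<close> for \<open>r = 0\<close> and \<open>s = 0\<close>
  gives \<open>c = 1\<close>.
\<close>

theorem kernel_identity:
  assumes "\<kappa> > 0" "z \<notin> \<int>"
  shows "kernel_fourier \<kappa> s r z = kernel_gauss \<kappa> r z"
proof -
  obtain c :: complex where c: "\<And>r z. (\<Sum>\<^sub>\<infinity>b::int. gauss_term \<kappa> r z b)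
     = c * (of_real (sqrt \<kappa>) * (\<Sum>\<^sub>\<infinity>k::int. heat_term \<kappa> r z k))"
    using poisson_gauss[OF assms(1)] by blast
  have ev: "eventually (\<lambda>x::real. 0 < x \<and> x < 1/2) (at_right 0)"
    by (auto simp: eventually_at_right_field intro!: exI[of _ "1/2"])
  have "((\<lambda>x. c * (of_real x * kernel_fourier \<kappa> 0 0 (of_real x))) \<longlongrightarrow> c * (\<i> / (2 * of_real pi))) (at_right 0)"
    by (intro tendsto_mult tendsto_const tendsto_times_kernel_fourier assms)
  moreover have "eventually (\<lambda>x. c * (of_real x * kernel_fourier \<kappa> 0 0 (of_real x)) = of_real x * kernel_gauss \<kappa> 0 (of_real x)) (at_right 0)"
    using ev
  proof eventually_elim
    case (elim x)
    have "complex_of_real x \<notin> \<int>"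
    proof
      assume "complex_of_real x \<in> \<int>"
      then obtain n where "complex_of_real x = of_int n" by (elim Ints_cases)
      then have "x = of_int n" by (metis of_real_eq_iff of_real_of_int_eq)
      with elim show False by auto
    qed
    from kernel_identity_up_to_constant[OF assms(1) this c, of 0 0] show ?case by simp
  qed
  ultimately have "((\<lambda>x. of_real x * kernel_gauss \<kappa> 0 (of_real x)) \<longlongrightarrow> c * (\<i> / (2 * of_real pi))) (at_right 0)"
    by (rule Lim_transform_eventually)
  then have "c * (\<i> / (2 * of_real pi)) = \<i> / (2 * of_real pi)"
    using tendsto_times_kernel_gauss[OF assms(1)] tendsto_unique trivial_limit_at_right_real by blast
  then have "c = 1" by simp
  then show ?thesis using kernel_identity_up_to_constant[OF assms c] by simp
qed

section \<open>Absolutely convergent sums over a lattice\<close>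

lemma summable_on_product_nonneg:
  fixes f :: "'a \<Rightarrow> real" and g :: "'b \<Rightarrow> real"
  assumes "f summable_on A" "g summable_on B" "\<And>x. x \<in> A \<Longrightarrow> 0 \<le> f x" "\<And>y. y \<in> B \<Longrightarrow> 0 \<le> g y"
  shows "(\<lambda>(x, y). f x * g y) summable_on A \<times> B"
proof (rule summable_on_SigmaI[where g = "\<lambda>x. f x * infsum g B"])
  fix x
  show "((\<lambda>y. case (x, y) of (x, y) \<Rightarrow> f x * g y) has_sum f x * infsum g B) B"
    using has_sum_cmult_right[OF has_sum_infsum[OF assms(2)], of "f x"] by simp
qed (use assms in \<open>auto intro: summable_on_cmult_left\<close>)

text \<open>
  The first factor comes from the term with index \<open>a\<close> of the Appell sum. The remaining factors are those of \<open>kernel_gauss\<close>, at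
  the point \<open>z1 + a * \<tau>\<close>.
\<close>

definition lattice_term :: "nat \<Rightarrow> complex \<Rightarrow> complex \<Rightarrow> complex \<Rightarrow> int \<Rightarrow> int \<Rightarrow> complex" where
  "lattice_term N \<tau> z1 z2 a b =
     e2pi (of_nat N * ((of_int a)\<^sup>2 * \<tau> + of_int a * (z1 + z2)))
     * (exp (- (of_real (pi * of_nat N / Im \<tau>) * (z1 + of_int a * \<tau> + of_int b)\<^sup>2))
        * e2pi (of_real (of_nat N * Im (z1 - z2) / Im \<tau>) * (z1 + of_int a * \<tau> + of_int b))
        / (z1 + of_int a * \<tau> + of_int b))"

definition lattice_sum :: "nat \<Rightarrow> complex \<Rightarrow> complex \<Rightarrow> complex \<Rightarrow> complex" where
  "lattice_sum N \<tau> z1 z2 = (\<Sum>\<^sub>\<infinity>(a, b). lattice_term N \<tau> z1 z2 a b)"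

lemma mem_lattice_iff: "z \<in> coset 0 0 \<tau> \<longleftrightarrow> (\<exists>a b :: int. z = of_int a * \<tau> + of_int b)"
proof
  assume "z \<in> coset 0 0 \<tau>"
  then obtain x y :: real where "z = of_real x + of_real y * \<tau>" "x \<in> \<int>" "y \<in> \<int>"
    by (auto simp: coset_def)
  then obtain a b :: int where "z = of_int a * \<tau> + of_int b"
    by (auto elim!: Ints_cases simp: add.commute)
  then show "\<exists>a b :: int. z = of_int a * \<tau> + of_int b" by blast
next
  assume "\<exists>a b :: int. z = of_int a * \<tau> + of_int b"
  then obtain a b :: int where "z = of_int a * \<tau> + of_int b" by blast
  then have "z = of_real (of_int b) + of_real (of_int a) * \<tau>" by simp
  then show "z \<in> coset 0 0 \<tau>" 
    unfolding coset_def by (intro CollectI exI[of _ "real_of_int b"] exI[of _ "real_of_int a"] conjI) auto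
qed

lemma lattice_translate_not_Ints:
  assumes "z \<notin> coset 0 0 \<tau>"
  shows "z + of_int a * \<tau> \<notin> \<int>"
proof
  assume "z + of_int a * \<tau> \<in> \<int>"
  then obtain b where "z + of_int a * \<tau> = of_int b" by (elim Ints_cases)
  then have "z = of_int (- a) * \<tau> + of_int b" by (simp add: algebra_simps)
  with assms show False using mem_lattice_iff by blast
qed

text \<open>
  Rows with large \<open>\<bar>a\<bar>\<close> have distance at least 1 from \<open>0\<close> by their imaginary part; each of the others is treated by
  \<open>dist_Ints_lower_bound\<close>.
\<close>

lemma dist_lattice_lower_bound:
  assumes "Im \<tau> > 0" "z \<notin> coset 0 0 \<tau>"
  obtains \<delta> where "\<delta> > 0" "\<And>a b :: int. norm (z + of_int a * \<tau> + of_int b) \<ge> \<delta>"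
proof -
  have "\<forall>a::int. \<exists>d>0. \<forall>b::int. norm (z + of_int a * \<tau> + of_int b) \<ge> d"
    using dist_Ints_lower_bound[OF lattice_translate_not_Ints[OF assms(2)]] by metis
  then obtain d where d: "\<And>a. d a > 0" "\<And>a b. norm (z + of_int a * \<tau> + of_int b) \<ge> d a"
    by metis
  define A where "A = \<lceil>(\<bar>Im z\<bar> + 1) / Im \<tau>\<rceil>"
  define F where "F = insert 1 (d ` {-A..A})"
  have fin: "finite F" "F \<noteq> {}" by (auto simp: F_def)
  have "Min F > 0" using fin d(1) by (auto simp: F_def)
  moreover have "norm (z + of_int a * \<tau> + of_int b) \<ge> Min F" for a b :: int
  proof (cases "a \<in> {-A..A}")
    case True
    then have "Min F \<le> d a" using fin by (intro Min_le) (auto simp: F_def)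
    with d(2)[of a b] show ?thesis by linarith
  next
    case False
    then have "\<bar>a\<bar> \<ge> A" by auto
    then have "real_of_int \<bar>a\<bar> \<ge> (\<bar>Im z\<bar> + 1) / Im \<tau>"
      unfolding A_def by (meson ceiling_le_iff)
    then have "\<bar>Im z\<bar> + 1 \<le> real_of_int \<bar>a\<bar> * Im \<tau>" using assms(1) by (simp add: field_simps)
    moreover have "real_of_int \<bar>a\<bar> * Im \<tau> = \<bar>of_int a * Im \<tau>\<bar>" using assms(1) by (simp add: abs_mult)
    ultimately have "1 \<le> \<bar>Im z + of_int a * Im \<tau>\<bar>" by linarith
    also have "\<dots> = \<bar>Im (z + of_int a * \<tau> + of_int b)\<bar>" by simp
    also have "\<dots> \<le> norm (z + of_int a * \<tau> + of_int b)" by (rule abs_Im_le_cmod)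
    finally have "1 \<le> norm (z + of_int a * \<tau> + of_int b)" .
    moreover have "Min F \<le> 1" using fin by (intro Min_le) (auto simp: F_def)
    ultimately show ?thesis by linarith
  qed
  ultimately show ?thesis by (rule that)
qed

text \<open>
  The quadratic form on the right is positive definite in \<open>(a, b)\<close>, but not diagonal. Bounding it by a
  diagonal form allows the double sum over the lattice to be compared with a product of two sums.
\<close>

lemma quadratic_lower_bound:
  fixes t x y :: real
  assumes "y > 0"
  obtains \<eta> where "\<eta> > 0"
    "\<And>a b. y\<^sup>2 / 2 * a\<^sup>2 + \<eta> / 2 * b\<^sup>2 - 2 * x\<^sup>2 \<le> a\<^sup>2 * y\<^sup>2 + (x + a * t + b)\<^sup>2"
proof -
  \<comment> \<open>so small that \<open>\<eta> * (2 * t\<^sup>2) \<le> y\<^sup>2 / 2\<close>, which absorbs the mixed term\<close>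
  define \<eta> where "\<eta> = min 1 (y\<^sup>2 / (4 * t\<^sup>2 + 1))"
  have d: "4 * t\<^sup>2 + 1 > 0" by (simp add: add_nonneg_pos)
  have pos: "\<eta> > 0" "\<eta> \<le> 1" using assms d by (auto simp: \<eta>_def)
  have "\<eta> * (4 * t\<^sup>2 + 1) \<le> y\<^sup>2 / (4 * t\<^sup>2 + 1) * (4 * t\<^sup>2 + 1)"
    by (rule mult_right_mono) (use d in \<open>auto simp: \<eta>_def\<close>)
  then have "\<eta> * (4 * t\<^sup>2 + 1) \<le> y\<^sup>2" using d by simp
  then have \<eta>t: "\<eta> * (2 * t\<^sup>2) \<le> y\<^sup>2 / 2" using pos by (simp add: algebra_simps)
  have "y\<^sup>2 / 2 * a\<^sup>2 + \<eta> / 2 * b\<^sup>2 - 2 * x\<^sup>2 \<le> a\<^sup>2 * y\<^sup>2 + (x + a * t + b)\<^sup>2" for a b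
  proof -
    have "0 \<le> (2 * (x + a * t) + b)\<^sup>2" "0 \<le> (x - a * t)\<^sup>2" by simp_all
    then have "b\<^sup>2 / 2 - 2 * x\<^sup>2 - 2 * (a * t)\<^sup>2 \<le> (x + a * t + b)\<^sup>2"
      unfolding power2_eq_square by (simp add: algebra_simps)
    then have "\<eta> * (b\<^sup>2 / 2 - 2 * x\<^sup>2 - 2 * (a * t)\<^sup>2) \<le> \<eta> * (x + a * t + b)\<^sup>2"
      using pos by (intro mult_left_mono) auto
    also have "\<dots> \<le> 1 * (x + a * t + b)\<^sup>2" using pos by (intro mult_right_mono) auto
    finally have 1: "\<eta> / 2 * b\<^sup>2 - \<eta> * (2 * x\<^sup>2) - \<eta> * (2 * t\<^sup>2) * a\<^sup>2 \<le> (x + a * t + b)\<^sup>2"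
      by (simp add: algebra_simps power_mult_distrib)
    have 2: "\<eta> * (2 * t\<^sup>2) * a\<^sup>2 \<le> y\<^sup>2 / 2 * a\<^sup>2" by (rule mult_right_mono[OF \<eta>t]) simp
    have 3: "\<eta> * (2 * x\<^sup>2) \<le> 1 * (2 * x\<^sup>2)" using pos by (intro mult_right_mono) auto
    from 1 2 3 show ?thesis by (simp add: algebra_simps)
  qed
  with pos(1) show ?thesis by (rule that)
qed

text \<open>
  With \<open>c = pi * N / Im \<tau>\<close>, the factor \<open>exp (- c * \<zeta>\<^sup>2)\<close> may grow like \<open>exp (c * (a * Im \<tau>)\<^sup>2)\<close>, but the first factor of
  \<open>lattice_term\<close> decays like \<open>exp (- 2 * c * (a * Im \<tau>)\<^sup>2)\<close>. Up to linear terms, the exponent of the norm is thus \<open>- c\<close> times the form in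
  \<open>quadratic_lower_bound\<close>.
\<close>

lemma lattice_sum_summable:
  assumes "Im \<tau> > 0" "N > 0" "z1 \<notin> coset 0 0 \<tau>"
  shows "(\<lambda>p. norm (case p of (a, b) \<Rightarrow> lattice_term N \<tau> z1 z2 a b)) summable_on UNIV"
proof -
  define y t x where "y = Im \<tau>" and "t = Re \<tau>" and "x = Re z1"
  have y: "y > 0" using assms by (simp add: y_def)
  obtain \<delta> where \<delta>: "\<delta> > 0" "\<And>a b :: int. norm (z1 + of_int a * \<tau> + of_int b) \<ge> \<delta>"
    using dist_lattice_lower_bound[OF assms(1,3)] by blast
  obtain \<eta> where \<eta>: "\<eta> > 0" "\<And>a b. y\<^sup>2 / 2 * a\<^sup>2 + \<eta> / 2 * b\<^sup>2 - 2 * x\<^sup>2 \<le> a\<^sup>2 * y\<^sup>2 + (x + a * t + b)\<^sup>2"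
    using quadratic_lower_bound[OF y] by blast
  define c where "c = pi * of_nat N / y"
  have c: "c > 0" using y assms(2) by (simp add: c_def)
  define \<rho> where "\<rho> = of_nat N * Im (z1 - z2) / y"
  \<comment> \<open>the coefficient of \<open>a\<close> and the constant in the exponent of the norm\<close>
  define \<alpha> where "\<alpha> = 2 * c * y * Im z1 - 2 * pi * (of_nat N * Im (z1 + z2)) - 2 * pi * \<rho> * y"
  define \<beta> where "\<beta> = c * (Im z1)\<^sup>2 - 2 * pi * \<rho> * Im z1 + 2 * c * x\<^sup>2"
  have bound: "norm (lattice_term N \<tau> z1 z2 a b) \<le>
      (exp \<beta> / \<delta> * exp (\<bar>\<alpha>\<bar> * \<bar>of_int a\<bar> - (c * y\<^sup>2 / 2) * (of_int a)\<^sup>2)) * exp (0 * \<bar>of_int b\<bar> - (c * \<eta> / 2) * (of_int b)\<^sup>2)" for a b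
  proof -
    let ?\<zeta> = "z1 + of_int a * \<tau> + of_int b"
    let ?a = "real_of_int a" and ?b = "real_of_int b"
    have n1: "norm (e2pi (of_nat N * ((of_int a)\<^sup>2 * \<tau> + of_int a * (z1 + z2)))) = exp (- (2 * pi * of_nat N * (?a\<^sup>2 * y + ?a * Im (z1 + z2))))"
      unfolding norm_e2pi y_def by (simp add: power2_eq_square)
    have n2: "norm (exp (- (of_real (pi * of_nat N / Im \<tau>) * ?\<zeta>\<^sup>2))) = exp (- (c * ((x + ?a * t + ?b)\<^sup>2 - (Im z1 + ?a * y)\<^sup>2)))"
      unfolding norm_exp_eq_Re c_def x_def t_def y_def by (simp add: power2_eq_square)
    have n3: "norm (e2pi (of_real (of_nat N * Im (z1 - z2) / Im \<tau>) * ?\<zeta>)) = exp (- (2 * pi * \<rho> * (Im z1 + ?a * y)))"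
      unfolding norm_e2pi \<rho>_def y_def by simp
    have cy: "c * y = pi * of_nat N" using y by (simp add: c_def)
    have "norm (lattice_term N \<tau> z1 z2 a b) =
        exp (- (2 * pi * of_nat N * (?a\<^sup>2 * y + ?a * Im (z1 + z2)))
          + (- (c * ((x + ?a * t + ?b)\<^sup>2 - (Im z1 + ?a * y)\<^sup>2)) + - (2 * pi * \<rho> * (Im z1 + ?a * y)))) / norm ?\<zeta>"
      unfolding lattice_term_def norm_mult norm_divide n1 n2 n3 exp_add by simp
    also have "\<dots> \<le> exp (\<beta> + (\<bar>\<alpha>\<bar> * \<bar>?a\<bar> - (c * y\<^sup>2 / 2) * ?a\<^sup>2) + (0 * \<bar>?b\<bar> - (c * \<eta> / 2) * ?b\<^sup>2)) / \<delta>"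
    proof (rule frac_le)
      have "- (2 * pi * of_nat N * (?a\<^sup>2 * y + ?a * Im (z1 + z2)))
          + (- (c * ((x + ?a * t + ?b)\<^sup>2 - (Im z1 + ?a * y)\<^sup>2)) + - (2 * pi * \<rho> * (Im z1 + ?a * y)))
        = - 2 * (c * y) * (?a\<^sup>2 * y) + 2 * pi * \<rho> * 0 + ?a * \<alpha> - c * (x + ?a * t + ?b)\<^sup>2 + c * y\<^sup>2 * ?a\<^sup>2 + (\<beta> - 2 * c * x\<^sup>2)"
        unfolding cy \<alpha>_def \<beta>_def by (simp add: power2_sum algebra_simps power_mult_distrib)
      also have "\<dots> = ?a * \<alpha> + \<beta> - c * (?a\<^sup>2 * y\<^sup>2 + (x + ?a * t + ?b)\<^sup>2 + 2 * x\<^sup>2)"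
        by (simp add: power2_eq_square algebra_simps)
      also have "\<dots> \<le> \<bar>\<alpha>\<bar> * \<bar>?a\<bar> + \<beta> - c * (y\<^sup>2 / 2 * ?a\<^sup>2 + \<eta> / 2 * ?b\<^sup>2)"
      proof -
        have "?a * \<alpha> \<le> \<bar>\<alpha>\<bar> * \<bar>?a\<bar>" using mult_le_bound_abs(1)[of \<alpha> "\<bar>\<alpha>\<bar>" ?a] by (simp add: mult.commute)
        moreover have "c * (y\<^sup>2 / 2 * ?a\<^sup>2 + \<eta> / 2 * ?b\<^sup>2) \<le> c * (?a\<^sup>2 * y\<^sup>2 + (x + ?a * t + ?b)\<^sup>2 + 2 * x\<^sup>2)"
          using \<eta>(2)[of ?a ?b] c by (intro mult_left_mono) auto
        ultimately show ?thesis by linarith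
      qed
      also have "\<dots> = \<beta> + (\<bar>\<alpha>\<bar> * \<bar>?a\<bar> - (c * y\<^sup>2 / 2) * ?a\<^sup>2) + (0 * \<bar>?b\<bar> - (c * \<eta> / 2) * ?b\<^sup>2)"
        by (simp add: algebra_simps)
      finally show "exp (- (2 * pi * of_nat N * (?a\<^sup>2 * y + ?a * Im (z1 + z2)))
          + (- (c * ((x + ?a * t + ?b)\<^sup>2 - (Im z1 + ?a * y)\<^sup>2)) + - (2 * pi * \<rho> * (Im z1 + ?a * y))))
        \<le> exp (\<beta> + (\<bar>\<alpha>\<bar> * \<bar>?a\<bar> - (c * y\<^sup>2 / 2) * ?a\<^sup>2) + (0 * \<bar>?b\<bar> - (c * \<eta> / 2) * ?b\<^sup>2))"
        by (simp only: exp_le_cancel_iff)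
    qed (use \<delta> in auto)
    also have "\<dots> = (exp \<beta> / \<delta> * exp (\<bar>\<alpha>\<bar> * \<bar>?a\<bar> - (c * y\<^sup>2 / 2) * ?a\<^sup>2)) * exp (0 * \<bar>?b\<bar> - (c * \<eta> / 2) * ?b\<^sup>2)"
      unfolding exp_add by simp
    finally show ?thesis .
  qed
  have "(\<lambda>(a, b). (exp \<beta> / \<delta> * exp (\<bar>\<alpha>\<bar> * \<bar>of_int a\<bar> - (c * y\<^sup>2 / 2) * (of_int a)\<^sup>2)) * exp (0 * \<bar>of_int b\<bar> - (c * \<eta> / 2) * (of_int b)\<^sup>2))
      summable_on (UNIV :: int set) \<times> (UNIV :: int set)"
    by (intro summable_on_product_nonneg summable_on_cmult_right summable_on_gauss_int) (use c y \<eta> \<delta> in auto)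
  then have "(\<lambda>(a, b). (exp \<beta> / \<delta> * exp (\<bar>\<alpha>\<bar> * \<bar>of_int a\<bar> - (c * y\<^sup>2 / 2) * (of_int a)\<^sup>2)) * exp (0 * \<bar>of_int b\<bar> - (c * \<eta> / 2) * (of_int b)\<^sup>2))
      summable_on (UNIV :: (int \<times> int) set)" by simp
  then show ?thesis
    by (rule summable_on_comparison_test) (use bound in \<open>auto simp: case_prod_unfold\<close>)
qed

section \<open>Completed Appell sums as lattice sums\<close>

lemma Theta_e2pi:
  assumes "N > 0"
  shows "Theta j N \<tau> w = (\<Sum>\<^sub>\<infinity>a::int. e2pi (\<tau> * (of_int (2 * int N * a + j))\<^sup>2 / (4 * of_nat N) + of_int (2 * int N * a + j) * w / 2))"
  unfolding Theta_def qpow_def e2pi_add[symmetric]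
  by (intro infsum_cong arg_cong[where f = e2pi]) (use assms in \<open>simp add: field_simps power2_eq_square\<close>)

lemma Theta_cong:
  assumes "N > 0" "[j = k] (mod 2 * int N)"
  shows "Theta j N \<tau> w = Theta k N \<tau> w"
proof -
  obtain p where p: "k = j + 2 * int N * p" using assms(2) by (metis cong_iff_lin)
  show ?thesis unfolding Theta_e2pi[OF assms(1)]
    by (rule infsum_reindex_bij_witness[where i = "\<lambda>a. a + p" and j = "\<lambda>a. a - p"]) (auto simp: p algebra_simps)
qed

lemma Theta_uminus:
  assumes "N > 0"
  shows "Theta (- j) N \<tau> w = Theta j N \<tau> (- w)"
  unfolding Theta_e2pi[OF assms]
proof (rule infsum_reindex_bij_witness[where i = uminus and j = uminus])
  fix a :: int
  define r where "r = 2 * int N * a + - j"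
  have e: "2 * int N * - a + j = - r" by (simp add: r_def)
  show "e2pi (\<tau> * (of_int (2 * int N * - a + j))\<^sup>2 / (4 * of_nat N) + of_int (2 * int N * - a + j) * - w / 2)
    = e2pi (\<tau> * (of_int (2 * int N * a + - j))\<^sup>2 / (4 * of_nat N) + of_int (2 * int N * a + - j) * w / 2)"
    unfolding e r_def[symmetric] by simp
qed auto

text \<open>
  The summand of \<open>R_corr\<close> for the summation index \<open>- k\<close> and \<open>v = u / 2\<close>. The residue class of \<open>k\<close> no longer
  occurs in it, and this allows all residue classes to be summed at once.
\<close>

definition corr_coeff :: "int \<Rightarrow> nat \<Rightarrow> complex \<Rightarrow> complex \<Rightarrow> int \<Rightarrow> complex" where
  "corr_coeff s N \<tau> u k = of_real (sgn_cut s k - E_fun ((of_nat N * Im u / Im \<tau> - of_int k) * sqrt (Im \<tau> / of_nat N)))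
     * e2pi (- ((of_int k)\<^sup>2 * \<tau> / (4 * of_nat N)) + of_int k * u / 2)"

text \<open>
  If \<open>n = - k\<close> and \<open>n + j = 2 * N * p\<close>, the sign in \<open>R_corr\<close> is positive exactly for \<open>p \<ge> 1\<close>. As \<open>j\<close> lies in an interval of
  \<open>2 * N\<close> integers starting at \<open>- s\<close>, this means \<open>k < - s\<close>.
\<close>

lemma R_corr_eq:
  assumes "N > 0" "j \<in> {- s..- s + 2 * int N - 1}"
  shows "R_corr j N \<tau> (u / 2) = (\<Sum>\<^sub>\<infinity>k\<in>{k. [k = j] (mod 2 * int N)}. corr_coeff s N \<tau> u k)"
  unfolding R_corr_def
proof (rule infsum_reindex_bij_witness[where i = uminus and j = uminus])
  fix n assume n: "n \<in> {n. [n = - j] (mod 2 * int N)}"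
  then have cong: "[- n = j] (mod 2 * int N)"
    using cong_minus_minus_iff[of "- n" j "2 * int N"] by simp
  then show "- n \<in> {k. [k = j] (mod 2 * int N)}" by simp
  obtain p where p: "j = - n + 2 * int N * p" using cong by (metis cong_iff_lin)
  have j: "- s \<le> j" "j \<le> - s + 2 * int N - 1" using assms(2) by auto
  have "sgn (of_int n + 1 / 2 + of_int j - 2 * of_nat N) = sgn_cut s (- n)"
  proof (cases "p \<ge> 1")
    case True
    then have "2 * int N * 1 \<le> 2 * int N * p" by (intro mult_left_mono) auto
    then have "n + j - 2 * int N \<ge> 0" "- n < - s" using p j by linarith+
    then have "real_of_int (n + j - 2 * int N) \<ge> 0" by (simp only: of_int_0_le_iff)
    with \<open>- n < - s\<close> show ?thesis by (simp add: sgn_cut_def)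
  next
    case False
    then have "2 * int N * p \<le> 2 * int N * 0" by (intro mult_left_mono) auto
    then have "n + j - 2 * int N \<le> -1" "\<not> - n < - s" using p j by linarith+
    then have "real_of_int (n + j - 2 * int N) \<le> - 1" by linarith
    with \<open>\<not> - n < - s\<close> show ?thesis by (simp add: sgn_cut_def)
  qed
  moreover have "- (of_real pi * \<i> * (of_int n)\<^sup>2 / (2 * of_nat N)) * \<tau> - 2 * of_real pi * \<i> * of_int n * (u / 2)
      = 2 * of_real pi * \<i> * (- ((of_int (- n))\<^sup>2 * \<tau> / (4 * of_nat N)) + of_int (- n) * u / 2)"
    using assms(1) by (simp add: field_simps)
  moreover have "of_int n + 2 * of_nat N * Im (u / 2) / Im \<tau> = of_nat N * Im u / Im \<tau> - of_int (- n)"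
    by simp
  ultimately show "corr_coeff s N \<tau> u (- n) = of_real (sgn (of_int n + 1 / 2 + of_int j - 2 * of_nat N)
      - E_fun ((of_int n + 2 * of_nat N * Im (u / 2) / Im \<tau>) * sqrt (Im \<tau> / of_nat N)))
      * exp (- (of_real pi * \<i> * (of_int n)\<^sup>2 / (2 * of_nat N)) * \<tau> - 2 * of_real pi * \<i> * of_int n * (u / 2))"
    unfolding corr_coeff_def e2pi_def by (simp only:)
next
  fix k assume "k \<in> {k. [k = j] (mod 2 * int N)}"
  then show "- k \<in> {n. [n = - j] (mod 2 * int N)}"
    using cong_minus_minus_iff[of k j "2 * int N"] by simp
qed auto

text \<open>
  The exponential function in \<open>corr_coeff\<close> grows like \<open>exp (pi * \<kappa> / 2 * k\<^sup>2)\<close>, but its coefficient decays like \<open>exp (- pi * \<kappa> * k\<^sup>2)\<close>.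
\<close>

lemma corr_coeff_summable:
  assumes "Im \<tau> > 0" "N > 0"
  shows "(\<lambda>k. norm (corr_coeff s N \<tau> u k)) summable_on UNIV"
proof -
  define \<kappa> where "\<kappa> = Im \<tau> / of_nat N"
  have \<kappa>: "\<kappa> > 0" using assms by (simp add: \<kappa>_def)
  define r where "r = of_nat N * Im u / Im \<tau>"
  define K where "K = \<bar>r\<bar> + \<bar>of_int s\<bar> + 1"
  define C where "C = 2 + 2 * exp (pi * \<kappa> * K\<^sup>2)"
  have "norm (corr_coeff s N \<tau> u k) \<le> C * exp ((2 * pi * \<kappa> * K + pi * \<bar>Im u\<bar>) * \<bar>of_int k\<bar> - (pi * \<kappa> / 2) * (of_int k)\<^sup>2)" for k
  proof -
    have "- (Im u * of_int k) \<le> \<bar>Im u\<bar> * \<bar>of_int k\<bar>" by (rule mult_le_bound_abs) simp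
    then have 1: "pi * (- (Im u * of_int k)) \<le> pi * (\<bar>Im u\<bar> * \<bar>of_int k\<bar>)" by (rule mult_left_mono) simp
    have "Im (- ((of_int k)\<^sup>2 * \<tau> / (4 * of_nat N)) + of_int k * u / 2) = - ((of_int k)\<^sup>2 * Im \<tau> / (4 * of_nat N)) + of_int k * Im u / 2"
    proof -
      have "- ((of_int k)\<^sup>2 * \<tau> / (4 * of_nat N)) + of_int k * u / 2 = complex_of_real (- ((of_int k)\<^sup>2 / (4 * of_nat N))) * \<tau> + complex_of_real (of_int k / 2) * u"
        by simp
      then show ?thesis by (simp del: of_real_minus of_real_divide of_real_mult of_real_power)
    qed
    then have "norm (e2pi (- ((of_int k)\<^sup>2 * \<tau> / (4 * of_nat N)) + of_int k * u / 2)) = exp (pi * \<kappa> / 2 * (of_int k)\<^sup>2 + pi * (- (Im u * of_int k)))"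
      unfolding norm_e2pi \<kappa>_def by (simp add: field_simps)
    also have "\<dots> \<le> exp (pi * \<kappa> / 2 * (of_int k)\<^sup>2 + pi * (\<bar>Im u\<bar> * \<bar>of_int k\<bar>))"
      using 1 by simp
    finally have "norm (corr_coeff s N \<tau> u k) \<le> (C * exp (2 * pi * \<kappa> * K * \<bar>of_int k\<bar> - pi * \<kappa> * (of_int k)\<^sup>2)) * exp (pi * \<kappa> / 2 * (of_int k)\<^sup>2 + pi * (\<bar>Im u\<bar> * \<bar>of_int k\<bar>))"
      unfolding corr_coeff_def norm_mult norm_of_real C_def \<kappa>_def[symmetric] r_def[symmetric]
      by (intro mult_mono sgn_cut_minus_E_fun_bound \<kappa>) (auto simp: K_def)
    also have "\<dots> = C * exp ((2 * pi * \<kappa> * K + pi * \<bar>Im u\<bar>) * \<bar>of_int k\<bar> - (pi * \<kappa> / 2) * (of_int k)\<^sup>2)"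
      unfolding mult.assoc exp_add[symmetric] by (simp add: algebra_simps)
    finally show ?thesis .
  qed
  moreover have "(\<lambda>k::int. C * exp ((2 * pi * \<kappa> * K + pi * \<bar>Im u\<bar>) * \<bar>of_int k\<bar> - (pi * \<kappa> / 2) * (of_int k)\<^sup>2)) summable_on UNIV"
    by (intro summable_on_cmult_right summable_on_gauss_int) (use \<kappa> in simp)
  ultimately show ?thesis by (intro summable_on_comparison_test[OF \<open>_ summable_on UNIV\<close>]) auto
qed

text \<open>The monomial with exponent \<open>r\<close> in the theta series of index \<open>N\<close>.\<close>

definition theta_mono :: "nat \<Rightarrow> complex \<Rightarrow> complex \<Rightarrow> int \<Rightarrow> complex" where
  "theta_mono N \<tau> w r = e2pi (\<tau> * (of_int r)\<^sup>2 / (4 * of_nat N) + of_int r * w / 2)"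

lemma theta_mono_summable:
  assumes "Im \<tau> > 0" "N > 0"
  shows "(\<lambda>r. norm (theta_mono N \<tau> w r)) summable_on UNIV"
proof -
  have "norm (theta_mono N \<tau> w r) \<le> exp ((pi * \<bar>Im w\<bar>) * \<bar>of_int r\<bar> - (pi * Im \<tau> / (2 * of_nat N)) * (of_int r)\<^sup>2)" for r
  proof -
    have "- (Im w * of_int r) \<le> \<bar>Im w\<bar> * \<bar>of_int r\<bar>" by (rule mult_le_bound_abs) simp
    then have 1: "pi * (- (Im w * of_int r)) \<le> pi * (\<bar>Im w\<bar> * \<bar>of_int r\<bar>)" by (rule mult_left_mono) simp
    have "\<tau> * (of_int r)\<^sup>2 / (4 * of_nat N) + of_int r * w / 2 = complex_of_real ((of_int r)\<^sup>2 / (4 * of_nat N)) * \<tau> + complex_of_real (of_int r / 2) * w"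
      by simp
    then have "Im (\<tau> * (of_int r)\<^sup>2 / (4 * of_nat N) + of_int r * w / 2) = (of_int r)\<^sup>2 / (4 * of_nat N) * Im \<tau> + of_int r / 2 * Im w"
      by (simp del: of_real_minus of_real_divide of_real_mult of_real_power)
    then have "norm (theta_mono N \<tau> w r) = exp (pi * (- (Im w * of_int r)) - (pi * Im \<tau> / (2 * of_nat N)) * (of_int r)\<^sup>2)"
      unfolding theta_mono_def norm_e2pi by (simp add: field_simps)
    also have "\<dots> \<le> exp ((pi * \<bar>Im w\<bar>) * \<bar>of_int r\<bar> - (pi * Im \<tau> / (2 * of_nat N)) * (of_int r)\<^sup>2)"
      using 1 by (simp add: mult.assoc)
    finally show ?thesis .
  qed
  moreover have "(\<lambda>r::int. exp ((pi * \<bar>Im w\<bar>) * \<bar>of_int r\<bar> - (pi * Im \<tau> / (2 * of_nat N)) * (of_int r)\<^sup>2)) summable_on UNIV"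
    by (intro summable_on_gauss_int) (use assms in simp)
  ultimately show ?thesis by (intro summable_on_comparison_test[OF \<open>_ summable_on UNIV\<close>]) auto
qed

lemma corr_theta_summable:
  assumes "Im \<tau> > 0" "N > 0"
  shows "(\<lambda>(k, a). corr_coeff s N \<tau> u k * theta_mono N \<tau> w (2 * int N * a + k)) summable_on UNIV \<times> UNIV"
proof -
  have "(\<lambda>(k, r). norm (corr_coeff s N \<tau> u k) * norm (theta_mono N \<tau> w r)) summable_on UNIV \<times> UNIV"
    by (intro summable_on_product_nonneg corr_coeff_summable theta_mono_summable assms) auto
  then have "(\<lambda>(k, r). norm (corr_coeff s N \<tau> u k) * norm (theta_mono N \<tau> w r)) summable_on range (\<lambda>(k, a). (k, 2 * int N * a + k))"
    by (rule summable_on_subset_banach) auto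
  moreover have "inj (\<lambda>(k, a). (k, 2 * int N * a + k))"
    using assms(2) by (auto simp: inj_on_def)
  ultimately have "((\<lambda>(k, r). norm (corr_coeff s N \<tau> u k) * norm (theta_mono N \<tau> w r)) \<circ> (\<lambda>(k, a). (k, 2 * int N * a + k))) summable_on UNIV"
    by (subst (asm) summable_on_reindex) auto
  then have "(\<lambda>p. norm ((\<lambda>(k, a). corr_coeff s N \<tau> u k * theta_mono N \<tau> w (2 * int N * a + k)) p)) summable_on UNIV"
    by (simp add: o_def case_prod_unfold norm_mult)
  then have "(\<lambda>(k, a). corr_coeff s N \<tau> u k * theta_mono N \<tau> w (2 * int N * a + k)) summable_on UNIV"
    by (rule abs_summable_summable)
  then show ?thesis by simp
qed

lemma Theta_eq_infsum_theta_mono: "N > 0 \<Longrightarrow> Theta k N \<tau> w = (\<Sum>\<^sub>\<infinity>a::int. theta_mono N \<tau> w (2 * int N * a + k))"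
  unfolding theta_mono_def by (rule Theta_e2pi)

text \<open>
  Since \<open>Theta j\<close> depends only on \<open>j\<close> modulo \<open>2 * N\<close>, the sum over \<open>j\<close> and over \<open>k\<close> congruent to \<open>j\<close> becomes a sum over all
  integers \<open>k\<close>. The order of summation is then exchanged, to single out the index \<open>a\<close> of the theta series, which corresponds
  to the summation index in \<open>Phi1\<close>.
\<close>

lemma sum_R_corr_Theta:
  assumes "Im \<tau> > 0" "N > 0"
  shows "(\<Sum>j\<in>{- s..- s + 2 * int N - 1}. R_corr j N \<tau> (u / 2) * Theta j N \<tau> w)
    = (\<Sum>\<^sub>\<infinity>a::int. \<Sum>\<^sub>\<infinity>k::int. corr_coeff s N \<tau> u k * theta_mono N \<tau> w (2 * int N * a + k))"
proof -
  let ?J = "{- s..- s + 2 * int N - 1}" and ?C = "\<lambda>j. {k. [k = j] (mod 2 * int N)}"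
  let ?g = "\<lambda>k. corr_coeff s N \<tau> u k * Theta k N \<tau> w"
  have sg: "?g summable_on UNIV"
  proof -
    have "(\<lambda>k. \<Sum>\<^sub>\<infinity>a. corr_coeff s N \<tau> u k * theta_mono N \<tau> w (2 * int N * a + k)) summable_on UNIV"
      by (rule summable_on_Sigma_banach[OF corr_theta_summable[OF assms]])
    then show ?thesis unfolding infsum_cmult_right' Theta_eq_infsum_theta_mono[OF assms(2), symmetric] .
  qed
  have "(\<Sum>\<^sub>\<infinity>a. \<Sum>\<^sub>\<infinity>k. corr_coeff s N \<tau> u k * theta_mono N \<tau> w (2 * int N * a + k))
      = (\<Sum>\<^sub>\<infinity>k. \<Sum>\<^sub>\<infinity>a. corr_coeff s N \<tau> u k * theta_mono N \<tau> w (2 * int N * a + k))"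
    by (rule infsum_swap_banach[symmetric, OF corr_theta_summable[OF assms]])
  also have "\<dots> = infsum ?g UNIV"
    unfolding infsum_cmult_right' Theta_eq_infsum_theta_mono[OF assms(2), symmetric] ..
  also have "infsum ?g UNIV = infsum ?g (\<Union>j\<in>?J. ?C j)"
  proof -
  have "UNIV = (\<Union>j\<in>?J. ?C j)"
  proof (intro equalityI subsetI)
    fix k :: int
    define j where "j = (k + s) mod (2 * int N) - s"
    have "j \<in> ?J" using assms(2) pos_mod_bound[of "2 * int N" "k + s"] by (simp add: j_def)
    moreover have "[(k + s) - s = (k + s) mod (2 * int N) - s] (mod 2 * int N)"
      by (rule cong_diff) (simp_all add: cong_def)
    ultimately show "k \<in> (\<Union>j\<in>?J. ?C j)" by (auto simp: j_def)
  qed auto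
  then show ?thesis by (rule arg_cong)
  qed
  also have "infsum ?g (\<Union>j\<in>?J. ?C j) = (\<Sum>j\<in>?J. infsum ?g (?C j))"
  proof (rule sum_infsum[symmetric])
    show "?g summable_on ?C j" for j using sg by (rule summable_on_subset_banach) auto
    fix i j assume ij: "i \<in> ?J" "j \<in> ?J" "i \<noteq> j"
    show "?C i \<inter> ?C j = {}"
    proof (rule ccontr)
      assume "?C i \<inter> ?C j \<noteq> {}"
      then have "[i = j] (mod 2 * int N)" by (auto simp: cong_def)
      then have "2 * int N dvd i - j" by (simp add: cong_iff_dvd_diff)
      moreover have "\<bar>i - j\<bar> < 2 * int N" using ij by auto
      ultimately show False using ij dvd_imp_le_int[of "i - j" "2 * int N"] by simp
    qed
  qed simp
  also have "\<dots> = (\<Sum>j\<in>?J. R_corr j N \<tau> (u / 2) * Theta j N \<tau> w)"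
  proof (rule sum.cong)
    fix j assume j: "j \<in> ?J"
    have "infsum ?g (?C j) = (\<Sum>\<^sub>\<infinity>k\<in>?C j. corr_coeff s N \<tau> u k * Theta j N \<tau> w)"
      by (rule infsum_cong) (use Theta_cong[OF assms(2)] in auto)
    then show "infsum ?g (?C j) = R_corr j N \<tau> (u / 2) * Theta j N \<tau> w"
      unfolding R_corr_eq[OF assms(2) j] by (simp add: infsum_cmult_left')
  qed simp
  finally show ?thesis by simp
qed

text \<open>
  Put \<open>z\<^sub>a = z1 + a * \<tau>\<close>. Because of \<open>(2 * N * a + k)\<^sup>2 - k\<^sup>2 = 4 * N * (N * a\<^sup>2 + a * k)\<close>, the terms of the double sum in
  \<open>sum_R_corr_Theta\<close> are \<open>A a * e2pi (k * z\<^sub>a)\<close> up to the coefficient, where \<open>A a\<close> is independent of \<open>k\<close>. Together with the term of \<open>Phi1\<close> they form \<open>A a\<close>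
  times \<open>kernel_fourier\<close> at \<open>z\<^sub>a\<close>, and the row of the lattice sum is \<open>A a\<close> times \<open>kernel_gauss\<close>.
\<close>

lemma Phi1_completion:
  assumes "Im \<tau> > 0" "z1 \<notin> coset 0 0 \<tau>"
  shows "Phi1 m s \<tau> z1 z2 + 1 / 2 * (\<Sum>j\<in>{- int s..- int s + 2 * int m + 1}.
      R_corr j (m + 1) \<tau> ((z1 - z2) / 2) * Theta j (m + 1) \<tau> (z1 + z2))
    = \<i> / (2 * of_real pi) * lattice_sum (m + 1) \<tau> z1 z2"
proof -
  define N where "N = m + 1"
  have N: "N > 0" by (simp add: N_def)
  define u w where "u = z1 - z2" and "w = z1 + z2"
  define \<kappa> where "\<kappa> = Im \<tau> / of_nat N"
  define r where "r = of_nat N * Im u / Im \<tau>"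
  have \<kappa>: "\<kappa> > 0" using assms N by (simp add: \<kappa>_def)
  define A where "A = (\<lambda>a::int. e2pi (of_nat N * ((of_int a)\<^sup>2 * \<tau> + of_int a * w)))"
  define z where "z = (\<lambda>a::int. z1 + of_int a * \<tau>)"
  have z: "z a \<notin> \<int>" for a unfolding z_def by (rule lattice_translate_not_Ints[OF assms(2)])
  have pk: "pi / \<kappa> = pi * of_nat N / Im \<tau>" by (simp add: \<kappa>_def)
  have row: "\<i> / (2 * of_real pi) * (\<Sum>\<^sub>\<infinity>b. lattice_term N \<tau> z1 z2 a b) = A a * kernel_gauss \<kappa> r (z a)" for a
    unfolding lattice_term_def infsum_cmult_right' kernel_gauss_def A_def z_def r_def pk u_def w_def
    by (simp only: mult.left_commute)
  have sum_lt: "(\<lambda>(a, b). lattice_term N \<tau> z1 z2 a b) summable_on UNIV \<times> UNIV"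
    using abs_summable_summable[OF lattice_sum_summable[OF assms(1) N assms(2)]] by simp
  have "lattice_sum N \<tau> z1 z2 = (\<Sum>\<^sub>\<infinity>a. \<Sum>\<^sub>\<infinity>b. lattice_term N \<tau> z1 z2 a b)"
    unfolding lattice_sum_def using infsum_Sigma'_banach[OF sum_lt] by simp
  then have total: "\<i> / (2 * of_real pi) * lattice_sum N \<tau> z1 z2 = (\<Sum>\<^sub>\<infinity>a. A a * kernel_gauss \<kappa> r (z a))"
    unfolding row[symmetric] by (simp only: infsum_cmult_right')
  have sK: "(\<lambda>a. A a * kernel_gauss \<kappa> r (z a)) summable_on UNIV"
    unfolding row[symmetric]
    by (intro summable_on_cmult_right summable_on_Sigma_banach[OF sum_lt])
  \<comment> \<open>the splitting of row \<open>a\<close> into the term of the Appell sum and its correction\<close>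
  define P where "P = (\<lambda>a. A a * (e2pi (- of_int (int s) * z a) / (1 - e2pi (z a))))"
  define Q where "Q = (\<lambda>a. \<Sum>\<^sub>\<infinity>k::int. corr_coeff (int s) N \<tau> u k * theta_mono N \<tau> w (2 * int N * a + k))"
  have Q: "Q a = A a * (\<Sum>\<^sub>\<infinity>k::int. fourier_term \<kappa> (int s) r (z a) k)" for a
    unfolding Q_def infsum_cmult_right'[symmetric]
  proof (rule infsum_cong)
    fix k :: int
    have "(- ((of_int k)\<^sup>2 * \<tau> / (4 * of_nat N)) + of_int k * u / 2) + (\<tau> * (of_int (2 * int N * a + k))\<^sup>2 / (4 * of_nat N) + of_int (2 * int N * a + k) * w / 2)
       = of_nat N * ((of_int a)\<^sup>2 * \<tau> + of_int a * w) + of_int k * z a"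
      using N by (simp add: u_def w_def z_def field_simps power2_eq_square)
    then have "e2pi (- ((of_int k)\<^sup>2 * \<tau> / (4 * of_nat N)) + of_int k * u / 2) * theta_mono N \<tau> w (2 * int N * a + k) = A a * e2pi (of_int k * z a)"
      unfolding theta_mono_def A_def e2pi_add[symmetric] by (simp only:)
    then show "corr_coeff (int s) N \<tau> u k * theta_mono N \<tau> w (2 * int N * a + k)
        = A a * (fourier_term \<kappa> (int s) r (z a) k)"
      unfolding corr_coeff_def r_def[symmetric] \<kappa>_def[symmetric] by (simp only: mult.assoc mult.left_commute)
  qed
  have PQ: "A a * kernel_gauss \<kappa> r (z a) = P a + 1 / 2 * Q a" for a
    unfolding kernel_identity[OF \<kappa> z, symmetric, where s = "int s"] kernel_fourier_def P_def Q
    by (simp only: distrib_left mult.left_commute)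
  have "(\<lambda>(a, k). corr_coeff (int s) N \<tau> u k * theta_mono N \<tau> w (2 * int N * a + k)) summable_on UNIV \<times> UNIV"
    using corr_theta_summable[OF assms(1) N, of "int s" u w] by (subst summable_on_swap) simp
  then have sQ: "Q summable_on UNIV"
    unfolding Q_def by (rule summable_on_Sigma_banach)
  have sP: "P summable_on UNIV"
  proof -
    have "(\<lambda>a. A a * kernel_gauss \<kappa> r (z a) + (- 1 / 2) * Q a) summable_on UNIV"
      by (intro summable_on_add sK summable_on_cmult_right sQ)
    then show ?thesis unfolding PQ by simp
  qed
  have "(\<Sum>\<^sub>\<infinity>a. A a * kernel_gauss \<kappa> r (z a)) = infsum P UNIV + 1 / 2 * infsum Q UNIV"
    unfolding PQ infsum_add[OF sP summable_on_cmult_right[OF sQ, of "1 / 2"]] infsum_cmult_right' ..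
  moreover have "infsum P UNIV = Phi1 m s \<tau> z1 z2"
    unfolding Phi1_def
  proof (rule infsum_cong)
    fix a :: int
    have e1: "e2pi z1 * qpow \<tau> (of_int a) = e2pi (z a)"
      unfolding qpow_def e2pi_add[symmetric] z_def by simp
    have "e2pi (of_nat (m + 1) * of_int a * (z1 + z2)) * e2pi (- of_nat s * z1) * qpow \<tau> ((of_int a)\<^sup>2 * of_nat (m + 1) - of_int a * of_nat s) = A a * e2pi (- of_int (int s) * z a)"
      unfolding qpow_def A_def e2pi_add[symmetric] N_def w_def z_def
      by (rule arg_cong[where f = e2pi]) (simp add: algebra_simps)
    then show "P a = e2pi (of_nat (m + 1) * of_int a * (z1 + z2)) * e2pi (- of_nat s * z1) * qpow \<tau> ((of_int a)\<^sup>2 * of_nat (m + 1) - of_int a * of_nat s) / (1 - e2pi z1 * qpow \<tau> (of_int a))"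
      unfolding P_def e1 by simp
  qed
  moreover have "infsum Q UNIV = (\<Sum>j\<in>{- int s..- int s + 2 * int m + 1}. R_corr j (m + 1) \<tau> (u / 2) * Theta j (m + 1) \<tau> w)"
  proof -
    have "- int s + 2 * int m + 1 = - int s + 2 * int N - 1" by (simp add: N_def)
    then show ?thesis
      unfolding Q_def N_def[symmetric] sum_R_corr_Theta[OF assms(1) N, where s = "int s" and u = u and w = w, symmetric]
      by (simp only:)
  qed
  ultimately show ?thesis using total by (simp add: N_def u_def w_def)
qed

text \<open>
  The substitution of \<open>(- z2, - z1)\<close> for \<open>(z1, z2)\<close> preserves \<open>z1 - z2\<close> and negates \<open>z1 + z2\<close>. As \<open>Theta (- j)\<close> is
  \<open>Theta j\<close> at the negated argument, the part of \<open>Phi_add\<close> with \<open>Theta (- j)\<close> completes the second Appell sum.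
\<close>

theorem Phi_mod_eq_lattice_sums:
  assumes "Im \<tau> > 0" "z1 \<notin> coset 0 0 \<tau>" "- z2 \<notin> coset 0 0 \<tau>"
  shows "Phi_mod m s \<tau> z1 z2 t = e2pi (of_nat (m + 1) * t) * (\<i> / (2 * of_real pi)) *
    (lattice_sum (m + 1) \<tau> z1 z2 - lattice_sum (m + 1) \<tau> (- z2) (- z1))"
proof -
  let ?J = "{- int s..- int s + 2 * int m + 1}"
  have 1: "Phi1 m s \<tau> z1 z2 + 1 / 2 * (\<Sum>j\<in>?J. R_corr j (m + 1) \<tau> ((z1 - z2) / 2) * Theta j (m + 1) \<tau> (z1 + z2))
    = \<i> / (2 * of_real pi) * lattice_sum (m + 1) \<tau> z1 z2"
    by (rule Phi1_completion[OF assms(1,2)])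
  have "Phi1 m s \<tau> (- z2) (- z1) + 1 / 2 * (\<Sum>j\<in>?J. R_corr j (m + 1) \<tau> ((- z2 - - z1) / 2) * Theta j (m + 1) \<tau> (- z2 + - z1))
    = \<i> / (2 * of_real pi) * lattice_sum (m + 1) \<tau> (- z2) (- z1)"
    by (rule Phi1_completion[OF assms(1,3)])
  moreover have "Theta (- j) (m + 1) \<tau> (z1 + z2) = Theta j (m + 1) \<tau> (- (z1 + z2))" for j
    by (rule Theta_uminus) simp
  moreover have "- z2 - - z1 = z1 - z2" "- z2 + - z1 = - (z1 + z2)" by simp_all
  ultimately have 2: "Phi1 m s \<tau> (- z2) (- z1) + 1 / 2 * (\<Sum>j\<in>?J. R_corr j (m + 1) \<tau> ((z1 - z2) / 2) * Theta (- j) (m + 1) \<tau> (z1 + z2))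
    = \<i> / (2 * of_real pi) * lattice_sum (m + 1) \<tau> (- z2) (- z1)"
    by (simp only:)
  have "Phi_mod m s \<tau> z1 z2 t = e2pi (of_nat (m + 1) * t) *
     ((Phi1 m s \<tau> z1 z2 + 1 / 2 * (\<Sum>j\<in>?J. R_corr j (m + 1) \<tau> ((z1 - z2) / 2) * Theta j (m + 1) \<tau> (z1 + z2)))
     - (Phi1 m s \<tau> (- z2) (- z1) + 1 / 2 * (\<Sum>j\<in>?J. R_corr j (m + 1) \<tau> ((z1 - z2) / 2) * Theta (- j) (m + 1) \<tau> (z1 + z2))))"
  proof -
    have "E * (p - p') + 1 / 2 * E * (S - S') = E * ((p + 1 / 2 * S) - (p' + 1 / 2 * S'))" for E p p' S S' :: complex
      by (simp add: field_simps)
    then show ?thesis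
      unfolding Phi_mod_def Phi_def Phi_add_def right_diff_distrib[of "R_corr _ _ _ _"] sum_subtractf .
  qed
  then show ?thesis unfolding 1 2 by (simp only: right_diff_distrib mult.assoc)
qed

section \<open>Modular transformations of the lattice sum\<close>

text \<open>
  Real multiples by imaginary parts become quotients of differences such as \<open>\<tau> - cnj \<tau>\<close>, and a single exponential remains.
  Transformations of terms are thereby reduced to rational identities in \<open>\<tau>\<close>, \<open>cnj \<tau>\<close> and the other variables.
\<close>

lemma lattice_term_alt:
  assumes "Im \<tau> \<noteq> 0"
  shows "lattice_term N \<tau> z1 z2 a b =
    e2pi (of_nat N * ((of_int a)\<^sup>2 * \<tau> + of_int a * (z1 + z2)
      - (z1 + of_int a * \<tau> + of_int b)\<^sup>2 / (\<tau> - cnj \<tau>)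
      + ((z1 - z2) - cnj (z1 - z2)) / (\<tau> - cnj \<tau>) * (z1 + of_int a * \<tau> + of_int b)))
    / (z1 + of_int a * \<tau> + of_int b)"
proof -
  let ?\<zeta> = "z1 + of_int a * \<tau> + of_int b"
  have nz: "complex_of_real (Im \<tau>) \<noteq> 0" using assms by simp
  have t: "\<tau> - cnj \<tau> = 2 * \<i> * of_real (Im \<tau>)" and u: "(z1 - z2) - cnj (z1 - z2) = 2 * \<i> * of_real (Im (z1 - z2))"
    by (simp_all add: complex_eq_iff)
  have "- (of_real (pi * of_nat N / Im \<tau>) * ?\<zeta>\<^sup>2) = 2 * of_real pi * \<i> * (of_nat N * (- (?\<zeta>\<^sup>2 / (\<tau> - cnj \<tau>))))"
    unfolding t using nz by (simp add: field_simps)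
  then have 1: "exp (- (of_real (pi * of_nat N / Im \<tau>) * ?\<zeta>\<^sup>2)) = e2pi (of_nat N * (- (?\<zeta>\<^sup>2 / (\<tau> - cnj \<tau>))))"
    unfolding e2pi_def by (simp only:)
  have 2: "of_real (of_nat N * Im (z1 - z2) / Im \<tau>) * ?\<zeta> = of_nat N * (((z1 - z2) - cnj (z1 - z2)) / (\<tau> - cnj \<tau>) * ?\<zeta>)"
    unfolding t u using nz by (simp add: field_simps)
  show ?thesis
    unfolding lattice_term_def 1 2 times_divide_eq_right e2pi_add[symmetric] distrib_left[symmetric]
    by (simp only: mult.assoc add.assoc[symmetric] diff_conv_add_uminus)
qed

text \<open>
  Apart from \<open>N * z1 * z2 / \<tau>\<close>, the exponents differ by the integer \<open>- 2 * N * a * b\<close>.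
\<close>

lemma lattice_term_inversion:
  assumes "Im \<tau> > 0"
  shows "lattice_term N (- 1 / \<tau>) (z1 / \<tau>) (z2 / \<tau>) a b = \<tau> * e2pi (of_nat N * (z1 * z2 / \<tau>)) * lattice_term N \<tau> z1 z2 b (- a)"
proof -
  have t0: "\<tau> \<noteq> 0" using assms by auto
  have im: "Im (- 1 / \<tau>) \<noteq> 0" "Im \<tau> \<noteq> 0" using Im_minus_inverse[OF assms] assms by auto
  define T where "T = cnj \<tau>"
  define u v where "u = z1 - z2" and "v = cnj (z1 - z2)"
  have T0: "T \<noteq> 0" using t0 by (simp add: T_def)
  have d0: "\<tau> - T \<noteq> 0" using assms by (simp add: T_def complex_eq_iff)
  define \<zeta> where "\<zeta> = z1 + of_int b * \<tau> + of_int (- a)"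
  have z': "z1 / \<tau> + of_int a * (- 1 / \<tau>) + of_int b = \<zeta> / \<tau>"
    using t0 by (simp add: \<zeta>_def field_simps)
  have d': "- 1 / \<tau> - cnj (- 1 / \<tau>) = (\<tau> - T) / (\<tau> * T)"
    using t0 T0 by (simp add: T_def field_simps)
  have u': "(z1 / \<tau> - z2 / \<tau>) - cnj (z1 / \<tau> - z2 / \<tau>) = (u * T - v * \<tau>) / (\<tau> * T)"
    using t0 T0 by (simp add: T_def u_def v_def field_simps)
  have 1: "(\<zeta> / \<tau>)\<^sup>2 / ((\<tau> - T) / (\<tau> * T)) = \<zeta>\<^sup>2 / (\<tau> - T) - \<zeta>\<^sup>2 / \<tau>"
    using t0 T0 d0 by (simp add: field_simps power2_eq_square)
  have 2: "(u * T - v * \<tau>) / (\<tau> * T) / ((\<tau> - T) / (\<tau> * T)) * (\<zeta> / \<tau>) = (u - v) / (\<tau> - T) * \<zeta> - u * \<zeta> / \<tau>"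
    using t0 T0 d0 by (simp add: field_simps)
  have 3: "(of_int a)\<^sup>2 * (- 1 / \<tau>) + of_int a * (z1 / \<tau> + z2 / \<tau>) + \<zeta>\<^sup>2 / \<tau> - u * \<zeta> / \<tau>
      = z1 * z2 / \<tau> + ((of_int b)\<^sup>2 * \<tau> + of_int b * (z1 + z2)) + of_int (- 2 * a * b)"
    using t0 by (simp add: \<zeta>_def u_def field_simps power2_eq_square)
  have "of_nat N * ((of_int a)\<^sup>2 * (- 1 / \<tau>) + of_int a * (z1 / \<tau> + z2 / \<tau>)
      - (\<zeta> / \<tau>)\<^sup>2 / ((\<tau> - T) / (\<tau> * T)) + (u * T - v * \<tau>) / (\<tau> * T) / ((\<tau> - T) / (\<tau> * T)) * (\<zeta> / \<tau>))
    = of_nat N * (((of_int a)\<^sup>2 * (- 1 / \<tau>) + of_int a * (z1 / \<tau> + z2 / \<tau>) + \<zeta>\<^sup>2 / \<tau> - u * \<zeta> / \<tau>)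
      - \<zeta>\<^sup>2 / (\<tau> - T) + (u - v) / (\<tau> - T) * \<zeta>)"
    unfolding 1 2 by (simp only: algebra_simps)
  also have "\<dots> = (of_nat N * (z1 * z2 / \<tau>) + of_nat N * ((of_int b)\<^sup>2 * \<tau> + of_int b * (z1 + z2) - \<zeta>\<^sup>2 / (\<tau> - T) + (u - v) / (\<tau> - T) * \<zeta>))
      + of_int (int N * (- 2 * a * b))"
    unfolding 3 by (simp add: algebra_simps)
  finally have "e2pi (of_nat N * ((of_int a)\<^sup>2 * (- 1 / \<tau>) + of_int a * (z1 / \<tau> + z2 / \<tau>)
      - (\<zeta> / \<tau>)\<^sup>2 / ((\<tau> - T) / (\<tau> * T)) + (u * T - v * \<tau>) / (\<tau> * T) / ((\<tau> - T) / (\<tau> * T)) * (\<zeta> / \<tau>)))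
    = e2pi (of_nat N * (z1 * z2 / \<tau>)) * e2pi (of_nat N * ((of_int b)\<^sup>2 * \<tau> + of_int b * (z1 + z2) - \<zeta>\<^sup>2 / (\<tau> - T) + (u - v) / (\<tau> - T) * \<zeta>))"
    by (simp only: e2pi_add_int e2pi_add[of "of_nat N * (z1 * z2 / \<tau>)"])
  then show ?thesis
    unfolding lattice_term_alt[OF im(1)] lattice_term_alt[OF im(2)] z' d' u'
    unfolding \<zeta>_def[symmetric] T_def[symmetric] u_def[symmetric] v_def[symmetric]
    using t0 by (simp add: v_def u_def T_def mult.commute)
qed

lemma lattice_sum_inversion:
  assumes "Im \<tau> > 0"
  shows "lattice_sum N (- 1 / \<tau>) (z1 / \<tau>) (z2 / \<tau>) = \<tau> * e2pi (of_nat N * (z1 * z2 / \<tau>)) * lattice_sum N \<tau> z1 z2"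
proof -
  have "lattice_sum N (- 1 / \<tau>) (z1 / \<tau>) (z2 / \<tau>) = (\<Sum>\<^sub>\<infinity>(a, b). \<tau> * e2pi (of_nat N * (z1 * z2 / \<tau>)) * lattice_term N \<tau> z1 z2 b (- a))"
    unfolding lattice_sum_def lattice_term_inversion[OF assms] ..
  also have "\<dots> = (\<Sum>\<^sub>\<infinity>p. \<tau> * e2pi (of_nat N * (z1 * z2 / \<tau>)) * (case p of (a, b) \<Rightarrow> lattice_term N \<tau> z1 z2 a b))"
    by (rule infsum_reindex_bij_witness[where i = "\<lambda>(a, b). (- b, a)" and j = "\<lambda>(a, b). (b, - a)"]) auto
  finally show ?thesis unfolding lattice_sum_def infsum_cmult_right' .
qed

lemma lattice_sum_translate:
  assumes "Im \<tau> > 0"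
  shows "lattice_sum N (\<tau> + 1) z1 z2 = lattice_sum N \<tau> z1 z2"
  unfolding lattice_sum_def
proof (rule infsum_reindex_bij_witness[where i = "\<lambda>(a, b). (a, b - a)" and j = "\<lambda>(a, b). (a, a + b)"], goal_cases)
  case (5 p)
  obtain a b where p: "p = (a, b)" by (cases p)
  have z: "z1 + of_int a * (\<tau> + 1) + of_int b = z1 + of_int a * \<tau> + of_int (a + b)" by (simp add: algebra_simps)
  have e: "of_nat N * ((of_int a)\<^sup>2 * (\<tau> + 1) + of_int a * (z1 + z2)) = of_nat N * ((of_int a)\<^sup>2 * \<tau> + of_int a * (z1 + z2)) + of_int (int N * a\<^sup>2)"
    by (simp add: algebra_simps)
  show ?case unfolding p by (simp only: prod.case lattice_term_def z e e2pi_add_int) simp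
qed auto

lemma lattice_sum_translate_nat:
  assumes "Im \<tau> > 0"
  shows "lattice_sum N (\<tau> + of_nat k) z1 z2 = lattice_sum N \<tau> z1 z2"
proof (induction k)
  case (Suc k)
  have e: "\<tau> + of_nat (Suc k) = (\<tau> + of_nat k) + 1" by simp
  show ?case unfolding e using lattice_sum_translate[of "\<tau> + of_nat k" N z1 z2] assms Suc by simp
qed simp

lemma lattice_sum_add_ints: "lattice_sum N \<tau> (z1 + of_int n1) (z2 + of_int n2) = lattice_sum N \<tau> z1 z2"
  unfolding lattice_sum_def
proof (rule infsum_reindex_bij_witness[where i = "\<lambda>(a, b). (a, b - n1)" and j = "\<lambda>(a, b). (a, b + n1)"], goal_cases)
  case (5 p)
  obtain a b where p: "p = (a, b)" by (cases p)
  have z: "z1 + of_int n1 + of_int a * \<tau> + of_int b = z1 + of_int a * \<tau> + of_int (b + n1)" by (simp add: algebra_simps)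
  have i: "Im (z1 + of_int n1 - (z2 + of_int n2)) = Im (z1 - z2)" by simp
  have e: "of_nat N * ((of_int a)\<^sup>2 * \<tau> + of_int a * (z1 + of_int n1 + (z2 + of_int n2))) = of_nat N * ((of_int a)\<^sup>2 * \<tau> + of_int a * (z1 + z2)) + of_int (int N * a * (n1 + n2))"
    by (simp add: algebra_simps)
  show ?case unfolding p by (simp only: prod.case lattice_term_def z i e e2pi_add_int)
qed auto

section \<open>Sums over residue classes modulo M\<close>

text \<open>
  A geometric sum whose ratio is an \<open>M\<close>-th root of unity. The ratio is \<open>1\<close> only if \<open>M\<close> divides \<open>N * d\<close>, that is, if \<open>M\<close> divides \<open>d\<close>.
\<close>

lemma sum_roots_of_unity:
  assumes "M > 0" "coprime (int N) (int M)"
  shows "(\<Sum>\<beta>\<in>{l..<l + int M}. e2pi (- (of_nat N * of_int \<beta> * of_int d / of_nat M))) = (if int M dvd d then of_nat M else 0)"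
proof -
  define x where "x = e2pi (- (of_nat N * of_int d / of_nat M))"
  have M0: "of_nat M \<noteq> (0::complex)" using assms by simp
  have xM: "x ^ M = 1"
  proof -
    have "of_nat M * - (of_nat N * of_int d / of_nat M) = (of_int (- (int N * d)) :: complex)" using M0 by simp
    then show ?thesis unfolding x_def e2pi_power by (simp only: e2pi_of_int)
  qed
  have "(\<Sum>\<beta>\<in>{l..<l + int M}. e2pi (- (of_nat N * of_int \<beta> * of_int d / of_nat M))) = (\<Sum>i<M. e2pi (- (of_nat N * of_int l * of_int d / of_nat M)) * x ^ i)"
  proof (rule sum.reindex_bij_witness[where i = "\<lambda>i. l + int i" and j = "\<lambda>\<beta>. nat (\<beta> - l)"])
    fix \<beta> assume \<beta>: "\<beta> \<in> {l..<l + int M}"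
    define i where "i = nat (\<beta> - l)"
    have b: "\<beta> = l + int i" using \<beta> by (simp add: i_def)
    have "e2pi (- (of_nat N * of_int l * of_int d / of_nat M)) * x ^ i = e2pi (- (of_nat N * of_int \<beta> * of_int d / of_nat M))"
      unfolding x_def e2pi_power e2pi_add[symmetric] b
      by (rule arg_cong[where f = e2pi]) (use M0 in \<open>simp add: field_simps\<close>)
    then show "e2pi (- (of_nat N * of_int l * of_int d / of_nat M)) * x ^ nat (\<beta> - l) = e2pi (- (of_nat N * of_int \<beta> * of_int d / of_nat M))"
      by (simp add: i_def)
  qed auto
  also have "\<dots> = e2pi (- (of_nat N * of_int l * of_int d / of_nat M)) * (\<Sum>i<M. x ^ i)"
    by (simp add: sum_distrib_left)
  also have "\<dots> = (if int M dvd d then of_nat M else 0)"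
  proof (cases "int M dvd d")
    case True
    then obtain e where d: "d = int M * e" by (elim dvdE)
    have "- (of_nat N * of_int d / of_nat M) = (of_int (- (int N * e)) :: complex)" using M0 by (simp add: d)
    then have x: "x = 1" unfolding x_def by (simp only: e2pi_of_int)
    have "- (of_nat N * of_int l * of_int d / of_nat M) = (of_int (- (int N * l * e)) :: complex)" using M0 by (simp add: d)
    then have "e2pi (- (of_nat N * of_int l * of_int d / of_nat M)) = 1" by (simp only: e2pi_of_int)
    with x True show ?thesis by simp
  next
    case False
    have "x \<noteq> 1"
    proof
      assume "x = 1"
      then obtain n where n: "- (of_nat N * of_int d / of_nat M) = (of_int n :: complex)"
        unfolding x_def e2pi_eq_1_iff by (elim Ints_cases)
      from arg_cong[OF n, of uminus] have "of_nat N * of_int d / of_nat M = (of_int (- n) :: complex)" by simp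
      then have "(of_int (int N * d) :: complex) = of_int (- n * int M)" using M0 by (simp add: field_simps)
      then have "int N * d = - n * int M" by (simp only: of_int_eq_iff)
      then have "int M dvd int N * d" by simp
      with assms(2) have "int M dvd d" by (simp add: coprime_commute coprime_dvd_mult_right_iff)
      with False show False by simp
    qed
    moreover have "(x - 1) * (\<Sum>i<M. x ^ i) = 0" unfolding power_diff_1_eq[symmetric] xM by simp
    ultimately show ?thesis using False by simp
  qed
  finally show ?thesis .
qed

lemma infsum_finite_sum:
  fixes f :: "'a \<Rightarrow> 'b \<Rightarrow> complex"
  assumes "finite A" "\<And>a. a \<in> A \<Longrightarrow> f a summable_on B"
  shows "(\<Sum>a\<in>A. infsum (f a) B) = (\<Sum>\<^sub>\<infinity>x\<in>B. \<Sum>a\<in>A. f a x)" "(\<lambda>x. \<Sum>a\<in>A. f a x) summable_on B"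
proof -
  have "((\<lambda>x. \<Sum>a\<in>A. f a x) has_sum (\<Sum>a\<in>A. infsum (f a) B)) B"
    using assms
  proof (induction A)
    case (insert a A)
    have "((\<lambda>x. f a x + (\<Sum>a\<in>A. f a x)) has_sum (infsum (f a) B + (\<Sum>a\<in>A. infsum (f a) B))) B"
      by (intro has_sum_add has_sum_infsum insert) (use insert in auto)
    then show ?case using insert by simp
  qed simp
  then show "(\<Sum>a\<in>A. infsum (f a) B) = (\<Sum>\<^sub>\<infinity>x\<in>B. \<Sum>a\<in>A. f a x)" "(\<lambda>x. \<Sum>a\<in>A. f a x) summable_on B"
    by (auto simp: has_sum_iff)
qed

text \<open>
  The lattice points of the modulus \<open>M * \<tau>\<close> are \<open>c * M * \<tau> + d\<close>. In the term for \<open>(\<alpha>, \<beta>)\<close> and \<open>(c, d)\<close> the residue \<open>\<beta>\<close> only occurs in the factor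
  \<open>e2pi (- N * \<beta> * d / M)\<close>, and \<open>\<alpha>\<close> and \<open>c\<close> only in the combination \<open>A = \<alpha> + M * c\<close>. Summation over \<open>\<beta>\<close> keeps the \<open>d\<close>
  divisible by \<open>M\<close>, with a factor \<open>M\<close>, and summation over \<open>\<alpha>\<close> and \<open>c\<close> becomes a sum over all integers \<open>A\<close>. The
  result is a sum over the lattice points \<open>A * \<tau> + M * d\<close>, which are \<open>M\<close> times those of the modulus \<open>\<tau> / M\<close>.
  
  The range of residues may start at any \<open>l\<close>, so that the lemma also applies to the negatives of \<open>0, ..., M - 1\<close>.
\<close>

lemma lattice_sum_isogeny:
  fixes \<epsilon> :: real
  assumes "Im \<tau> > 0" "N > 0" "M > 0" "coprime (int N) (int M)"
    and pole: "x1 + of_real \<epsilon> * \<tau> \<notin> coset 0 0 \<tau>"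
  shows "(\<Sum>\<alpha>\<in>{l..<l + int M}. \<Sum>\<beta>\<in>{l..<l + int M}.
      e2pi (of_nat N / of_nat M * ((of_real \<epsilon> + of_int \<alpha>) * (of_real \<epsilon> + of_int \<beta>) * \<tau> + (of_real \<epsilon> + of_int \<beta>) * x1 + (of_real \<epsilon> + of_int \<alpha>) * x2))
      * lattice_sum N (of_nat M * \<tau>) (x1 + (of_real \<epsilon> + of_int \<alpha>) * \<tau>) (x2 + (of_real \<epsilon> + of_int \<beta>) * \<tau>))
    = e2pi (of_nat N / of_nat M * ((of_real \<epsilon>)\<^sup>2 * \<tau> + of_real \<epsilon> * (x1 + x2)))
      * lattice_sum N (\<tau> / of_nat M) ((x1 + of_real \<epsilon> * \<tau>) / of_nat M) ((x2 + of_real \<epsilon> * \<tau>) / of_nat M)"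
proof -
  let ?R = "{l..<l + int M}"
  define e where "e = complex_of_real \<epsilon>"
  define m where "m = (of_nat M :: complex)"
  have m0: "m \<noteq> 0" using assms by (simp add: m_def)
  have cm: "cnj m = m" "cnj e = e" by (simp_all add: m_def e_def)
  define D where "D = \<tau> - cnj \<tau>"
  have D0: "D \<noteq> 0" using assms(1) by (simp add: D_def complex_eq_iff)
  define U where "U = (x1 - x2) - cnj (x1 - x2)"
  have ImM: "Im (of_nat M * \<tau>) > 0" "Im (of_nat M * \<tau>) \<noteq> 0" using assms by simp_all
  have ImM': "Im (\<tau> / of_nat M) \<noteq> 0" using assms by simp
  define \<zeta> where "\<zeta> = (\<lambda>A d. x1 + (e + of_int A) * \<tau> + of_int d)"
  \<comment> \<open>the part of the terms on the left that does not depend on \<open>\<beta>\<close>; for \<open>M dvd d\<close> it also gives the term on the right\<close>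
  define H where "H = (\<lambda>A d. e2pi (of_nat N / m * ((e + of_int A) * x2 + (e + of_int A) * \<zeta> A d - \<zeta> A d ^ 2 / D + U / D * \<zeta> A d - e * of_int d)) / \<zeta> A d)"
  define pre where "pre = (\<lambda>\<alpha> \<beta>. e2pi (of_nat N / m * ((e + of_int \<alpha>) * (e + of_int \<beta>) * \<tau> + (e + of_int \<beta>) * x1 + (e + of_int \<alpha>) * x2)))"
  have term1: "pre \<alpha> \<beta> * lattice_term N (m * \<tau>) (x1 + (e + of_int \<alpha>) * \<tau>) (x2 + (e + of_int \<beta>) * \<tau>) c d
      = e2pi (- (of_nat N * of_int \<beta> * of_int d / m)) * H (\<alpha> + int M * c) d" for \<alpha> \<beta> c d
  proof -
    let ?z = "\<zeta> (\<alpha> + int M * c) d"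
    have z: "x1 + (e + of_int \<alpha>) * \<tau> + of_int c * (m * \<tau>) + of_int d = ?z"
      by (simp add: \<zeta>_def m_def algebra_simps)
    have dd: "m * \<tau> - cnj (m * \<tau>) = m * D" by (simp add: D_def cm algebra_simps)
    have uu: "(x1 + (e + of_int \<alpha>) * \<tau> - (x2 + (e + of_int \<beta>) * \<tau>)) - cnj (x1 + (e + of_int \<alpha>) * \<tau> - (x2 + (e + of_int \<beta>) * \<tau>)) = U + (of_int \<alpha> - of_int \<beta>) * D"
      by (simp add: U_def D_def cm algebra_simps)
    have x1: "x1 = ?z - (e + of_int \<alpha>) * \<tau> - of_int c * (m * \<tau>) - of_int d"
      by (simp add: \<zeta>_def m_def algebra_simps)
    have "of_nat N / m * ((e + of_int \<alpha>) * (e + of_int \<beta>) * \<tau> + (e + of_int \<beta>) * x1 + (e + of_int \<alpha>) * x2)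
       + of_nat N * ((of_int c)\<^sup>2 * (m * \<tau>) + of_int c * (x1 + (e + of_int \<alpha>) * \<tau> + (x2 + (e + of_int \<beta>) * \<tau>))
         - ?z\<^sup>2 / (m * D) + (U + (of_int \<alpha> - of_int \<beta>) * D) / (m * D) * ?z)
      = (- (of_nat N * of_int \<beta> * of_int d / m)
        + of_nat N / m * ((e + of_int (\<alpha> + int M * c)) * x2 + (e + of_int (\<alpha> + int M * c)) * ?z - ?z ^ 2 / D + U / D * ?z - e * of_int d)) + of_int (- (int N * c * d))"
    proof -
      define Z where "Z = ?z"
      have mc: "of_int (\<alpha> + int M * c) = of_int \<alpha> + m * of_int c" by (simp add: m_def)
      have r: "(U + (of_int \<alpha> - of_int \<beta>) * D) / (m * D) = (U / D + (of_int \<alpha> - of_int \<beta>)) / m"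
        using D0 m0 by (simp add: field_simps)
      have q: "?z\<^sup>2 / (m * D) = (?z\<^sup>2 / D) / m" by simp
      show ?thesis unfolding r q mc Z_def[symmetric] x1[folded Z_def]
        using m0 by (simp add: field_simps power2_eq_square)
    qed
    then have "pre \<alpha> \<beta> * e2pi (of_nat N * ((of_int c)\<^sup>2 * (m * \<tau>) + of_int c * (x1 + (e + of_int \<alpha>) * \<tau> + (x2 + (e + of_int \<beta>) * \<tau>))
         - ?z\<^sup>2 / (m * D) + (U + (of_int \<alpha> - of_int \<beta>) * D) / (m * D) * ?z))
      = e2pi (- (of_nat N * of_int \<beta> * of_int d / m)) *
        e2pi (of_nat N / m * ((e + of_int (\<alpha> + int M * c)) * x2 + (e + of_int (\<alpha> + int M * c)) * ?z - ?z ^ 2 / D + U / D * ?z - e * of_int d))"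
      unfolding pre_def e2pi_add[symmetric] by (simp only: e2pi_add_int)
    then show ?thesis
      unfolding lattice_term_alt[OF ImM(2), folded m_def] z dd uu H_def times_divide_eq_right by (simp only:)
  qed
  have term2: "e2pi (of_nat N / m * (e\<^sup>2 * \<tau> + e * (x1 + x2))) * lattice_term N (\<tau> / m) ((x1 + e * \<tau>) / m) ((x2 + e * \<tau>) / m) A d
      = m * H A (int M * d)" for A d
  proof -
    let ?z = "\<zeta> A (int M * d)"
    have z: "(x1 + e * \<tau>) / m + of_int A * (\<tau> / m) + of_int d = ?z / m"
      using m0 by (simp add: \<zeta>_def m_def field_simps)
    have dd: "\<tau> / m - cnj (\<tau> / m) = D / m" by (simp add: D_def cm diff_divide_distrib)
    have uu: "((x1 + e * \<tau>) / m - (x2 + e * \<tau>) / m) - cnj ((x1 + e * \<tau>) / m - (x2 + e * \<tau>) / m) = U / m"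
      using m0 by (simp add: U_def cm field_simps)
    have r: "(?z / m)\<^sup>2 / (D / m) = (?z\<^sup>2 / D) / m" "U / m / (D / m) * (?z / m) = U / D * ?z / m"
      using m0 D0 by (simp_all add: power2_eq_square field_simps)
    have "of_nat N / m * (e\<^sup>2 * \<tau> + e * (x1 + x2))
        + of_nat N * ((of_int A)\<^sup>2 * (\<tau> / m) + of_int A * ((x1 + e * \<tau>) / m + (x2 + e * \<tau>) / m) - (?z\<^sup>2 / D) / m + U / D * ?z / m)
      = of_nat N / m * ((e + of_int A) * x2 + (e + of_int A) * ?z - ?z ^ 2 / D + U / D * ?z - e * of_int (int M * d)) + of_int (- (int N * A * d))"
    proof -
      define Z where "Z = ?z"
      have md: "of_int (int M * d) = m * of_int d" by (simp add: m_def)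
      have x1: "x1 = Z - (e + of_int A) * \<tau> - m * of_int d" by (simp add: Z_def \<zeta>_def m_def algebra_simps)
      show ?thesis unfolding md Z_def[symmetric] x1
        using m0 by (simp add: field_simps power2_eq_square)
    qed
    then have eq: "e2pi (of_nat N / m * (e\<^sup>2 * \<tau> + e * (x1 + x2)))
        * e2pi (of_nat N * ((of_int A)\<^sup>2 * (\<tau> / m) + of_int A * ((x1 + e * \<tau>) / m + (x2 + e * \<tau>) / m) - (?z\<^sup>2 / D) / m + U / D * ?z / m))
      = e2pi (of_nat N / m * ((e + of_int A) * x2 + (e + of_int A) * ?z - ?z ^ 2 / D + U / D * ?z - e * of_int (int M * d)))"
      unfolding e2pi_add[symmetric] by (simp only: e2pi_add_int)
    have fin: "Y / (?z / m) = m * (Y / ?z)" for Y by simp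
    show ?thesis
      unfolding lattice_term_alt[OF ImM', folded m_def] z dd uu r
      unfolding times_divide_eq_right[of "e2pi _"] eq
      unfolding fin H_def ..
  qed
  have sum1: "(\<lambda>(c, d). e2pi (- (of_nat N * of_int \<beta> * of_int d / m)) * H (\<alpha> + int M * c) d) summable_on UNIV" for \<alpha> \<beta>
  proof -
    have "x1 + (e + of_int \<alpha>) * \<tau> \<notin> coset 0 0 (of_nat M * \<tau>)"
    proof
      assume "x1 + (e + of_int \<alpha>) * \<tau> \<in> coset 0 0 (of_nat M * \<tau>)"
      then obtain a b :: int where "x1 + (e + of_int \<alpha>) * \<tau> = of_int a * (of_nat M * \<tau>) + of_int b"
        unfolding mem_lattice_iff by blast
      then have "x1 + e * \<tau> = of_int (a * int M - \<alpha>) * \<tau> + of_int b" by (simp add: algebra_simps)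
      with pole show False unfolding mem_lattice_iff e_def by blast
    qed
    from abs_summable_summable[OF lattice_sum_summable[OF ImM(1) assms(2) this, of "x2 + (e + of_int \<beta>) * \<tau>"]]
    have "(\<lambda>p. pre \<alpha> \<beta> * (case p of (c, d) \<Rightarrow> lattice_term N (m * \<tau>) (x1 + (e + of_int \<alpha>) * \<tau>) (x2 + (e + of_int \<beta>) * \<tau>) c d)) summable_on UNIV"
      unfolding m_def by (rule summable_on_cmult_right)
    then show ?thesis by (simp add: case_prod_unfold term1)
  qed
  define K where "K = (\<lambda>d. if int M dvd d then m else 0)"
  have K: "(\<Sum>\<beta>\<in>?R. e2pi (- (of_nat N * of_int \<beta> * of_int d / m))) = K d" for d
    unfolding K_def m_def by (rule sum_roots_of_unity[OF assms(3,4)])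
  have inner: "(\<Sum>\<beta>\<in>?R. pre \<alpha> \<beta> * lattice_sum N (m * \<tau>) (x1 + (e + of_int \<alpha>) * \<tau>) (x2 + (e + of_int \<beta>) * \<tau>))
      = (\<Sum>\<^sub>\<infinity>(c, d). K d * H (\<alpha> + int M * c) d)" (is "_ = ?rhs1")
    and sum2: "(\<lambda>(c, d). K d * H (\<alpha> + int M * c) d) summable_on UNIV" for \<alpha>
  proof -
    have eq: "(\<Sum>\<beta>\<in>?R. case p of (c, d) \<Rightarrow> e2pi (- (of_nat N * of_int \<beta> * of_int d / m)) * H (\<alpha> + int M * c) d) = (case p of (c, d) \<Rightarrow> K d * H (\<alpha> + int M * c) d)" for p
      by (cases p) (simp add: K[symmetric] sum_distrib_right)
    have "pre \<alpha> \<beta> * lattice_sum N (m * \<tau>) (x1 + (e + of_int \<alpha>) * \<tau>) (x2 + (e + of_int \<beta>) * \<tau>)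
        = (\<Sum>\<^sub>\<infinity>(c, d). e2pi (- (of_nat N * of_int \<beta> * of_int d / m)) * H (\<alpha> + int M * c) d)" for \<beta>
      unfolding lattice_sum_def infsum_cmult_right'[symmetric]
      by (rule infsum_cong) (simp add: case_prod_unfold term1)
    then show "(\<Sum>\<beta>\<in>?R. pre \<alpha> \<beta> * lattice_sum N (m * \<tau>) (x1 + (e + of_int \<alpha>) * \<tau>) (x2 + (e + of_int \<beta>) * \<tau>))
      = (\<Sum>\<^sub>\<infinity>(c, d). K d * H (\<alpha> + int M * c) d)"
      using infsum_finite_sum(1)[of ?R "\<lambda>\<beta> p. case p of (c, d) \<Rightarrow> e2pi (- (of_nat N * of_int \<beta> * of_int d / m)) * H (\<alpha> + int M * c) d" UNIV, OF _ sum1]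
      unfolding eq by simp
    show "(\<lambda>(c, d). K d * H (\<alpha> + int M * c) d) summable_on UNIV"
      using infsum_finite_sum(2)[of ?R "\<lambda>\<beta> p. case p of (c, d) \<Rightarrow> e2pi (- (of_nat N * of_int \<beta> * of_int d / m)) * H (\<alpha> + int M * c) d" UNIV, OF _ sum1]
      unfolding eq by simp
  qed
  \<comment> \<open>the pairs \<open>(A, d)\<close> with \<open>A\<close> congruent to \<open>\<alpha>\<close> modulo \<open>M\<close>\<close>
  define B where "B = (\<lambda>\<alpha>. range (\<lambda>(c, d::int). (\<alpha> + int M * c, d)))"
  have inj: "inj (\<lambda>(c, d::int). (\<alpha> + int M * c, d))" for \<alpha>
    using assms(3) by (auto simp: inj_on_def)
  let ?g = "\<lambda>(A, d). K d * H A d"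
  have B1: "infsum ?g (B \<alpha>) = (\<Sum>\<^sub>\<infinity>(c, d). K d * H (\<alpha> + int M * c) d)" for \<alpha>
    unfolding B_def by (subst infsum_reindex[OF inj]) (simp add: o_def case_prod_unfold)
  have B2: "?g summable_on B \<alpha>" for \<alpha>
    unfolding B_def by (subst summable_on_reindex[OF inj]) (use sum2[of \<alpha>] in \<open>simp add: o_def case_prod_unfold\<close>)
  have memB: "(A, d) \<in> B \<alpha> \<longleftrightarrow> int M dvd A - \<alpha>" for A d \<alpha>
  proof
    assume "int M dvd A - \<alpha>"
    then obtain c where "A - \<alpha> = int M * c" by (elim dvdE)
    then have "(A, d) = (\<lambda>(c, d). (\<alpha> + int M * c, d)) (c, d)" by simp
    then show "(A, d) \<in> B \<alpha>" unfolding B_def by (rule range_eqI)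
  qed (auto simp: B_def)
  have "(\<Sum>\<alpha>\<in>?R. \<Sum>\<beta>\<in>?R. pre \<alpha> \<beta> * lattice_sum N (m * \<tau>) (x1 + (e + of_int \<alpha>) * \<tau>) (x2 + (e + of_int \<beta>) * \<tau>)) = (\<Sum>\<alpha>\<in>?R. infsum ?g (B \<alpha>))"
    unfolding inner B1 ..
  also have "\<dots> = infsum ?g (\<Union>\<alpha>\<in>?R. B \<alpha>)"
  proof (rule sum_infsum)
    fix i j assume ij: "i \<in> ?R" "j \<in> ?R" "i \<noteq> j"
    show "B i \<inter> B j = {}"
    proof (rule ccontr)
      assume "B i \<inter> B j \<noteq> {}"
      then obtain A d where "(A, d) \<in> B i" "(A, d) \<in> B j" by auto
      then have "int M dvd A - i" "int M dvd A - j" by (simp_all add: memB)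
      then have "int M dvd (A - i) - (A - j)" by (rule dvd_diff)
      then have "int M dvd j - i" by simp
      moreover have "\<bar>j - i\<bar> < int M" using ij by auto
      ultimately show False using ij dvd_imp_le_int[of "j - i" "int M"] by simp
    qed
  qed (auto intro: B2)
  also have "(\<Union>\<alpha>\<in>?R. B \<alpha>) = UNIV"
  proof (intro equalityI subsetI)
    fix p :: "int \<times> int"
    obtain A d where p: "p = (A, d)" by (cases p)
    define \<alpha> where "\<alpha> = (A - l) mod int M + l"
    have "\<alpha> \<in> ?R" using assms(3) by (simp add: \<alpha>_def)
    moreover have "int M dvd (A - l) - (A - l) mod int M" by (rule dvd_minus_mod)
    then have "int M dvd A - \<alpha>" by (simp add: \<alpha>_def algebra_simps)
    ultimately show "p \<in> (\<Union>\<alpha>\<in>?R. B \<alpha>)" unfolding p using memB by blast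
  qed auto
  also have "infsum ?g UNIV = infsum ?g (range (\<lambda>(A, d). (A, int M * d)))"
  proof (rule infsum_cong_neutral)
    fix p :: "int \<times> int" assume p: "p \<in> UNIV - range (\<lambda>(A, d). (A, int M * d))"
    obtain A d where Ad: "p = (A, d)" by (cases p)
    have "\<not> int M dvd d"
    proof
      assume "int M dvd d"
      then obtain d' where "d = int M * d'" by (elim dvdE)
      then have "p = (\<lambda>(A, d). (A, int M * d)) (A, d')" by (simp add: Ad)
      with p show False by blast
    qed
    then show "?g p = 0" by (simp add: Ad K_def)
  qed auto
  also have "\<dots> = (\<Sum>\<^sub>\<infinity>(A, d). m * H A (int M * d))"
    by (subst infsum_reindex) (use assms(3) in \<open>auto simp: inj_on_def o_def case_prod_unfold K_def\<close>)
  also have "\<dots> = (\<Sum>\<^sub>\<infinity>p. e2pi (of_nat N / m * (e\<^sup>2 * \<tau> + e * (x1 + x2))) * (case p of (A, d) \<Rightarrow> lattice_term N (\<tau> / m) ((x1 + e * \<tau>) / m) ((x2 + e * \<tau>) / m) A d))"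
    by (rule infsum_cong) (simp only: case_prod_unfold term2)
  also have "\<dots> = e2pi (of_nat N / m * (e\<^sup>2 * \<tau> + e * (x1 + x2))) * lattice_sum N (\<tau> / m) ((x1 + e * \<tau>) / m) ((x2 + e * \<tau>) / m)"
    unfolding lattice_sum_def by (rule infsum_cmult_right')
  finally show ?thesis unfolding pre_def e_def m_def .
qed

section \<open>Transformation of the characters\<close>

lemma idx_eq:
  assumes "\<epsilon> \<in> {0, 1 / 2}"
  shows "idx M \<epsilon> = (\<lambda>\<alpha>. \<epsilon> + of_int \<alpha>) ` {0..<int M}"
proof (intro equalityI subsetI)
  fix a assume "a \<in> idx M \<epsilon>"
  then obtain \<alpha> where \<alpha>: "a - \<epsilon> = of_int \<alpha>" and a: "0 \<le> a" "a < of_nat M"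
    by (auto simp: idx_def elim: Ints_cases)
  then have eq: "a = \<epsilon> + of_int \<alpha>" by simp
  have "real_of_int \<alpha> > -1" "real_of_int \<alpha> < real_of_int (int M)" using a assms unfolding eq by auto
  then have "\<alpha> \<in> {0..<int M}" by simp
  then show "a \<in> (\<lambda>\<alpha>. \<epsilon> + of_int \<alpha>) ` {0..<int M}" using eq by blast
next
  fix a assume "a \<in> (\<lambda>\<alpha>. \<epsilon> + of_int \<alpha>) ` {0..<int M}"
  then obtain \<alpha> where eq: "a = \<epsilon> + of_int \<alpha>" and \<alpha>: "0 \<le> \<alpha>" "\<alpha> \<le> int M - 1" by auto
  then have "real_of_int \<alpha> \<ge> 0" "real_of_int \<alpha> \<le> real_of_int (int M - 1)" by (simp_all only: of_int_0_le_iff of_int_le_iff)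
  then show "a \<in> idx M \<epsilon>" using assms by (auto simp: idx_def eq)
qed

lemma sum_idx:
  assumes "\<epsilon> \<in> {0, 1 / 2}"
  shows "(\<Sum>a\<in>idx M \<epsilon>. f a) = (\<Sum>\<alpha>\<in>{0..<int M}. f (\<epsilon> + of_int \<alpha>))"
  unfolding idx_eq[OF assms] by (subst sum.reindex) (auto simp: inj_on_def)

lemma sum_neg_residues:
  fixes f :: "int \<Rightarrow> complex"
  shows "(\<Sum>\<alpha>\<in>{1 - int M..<1 - int M + int M}. f \<alpha>) = (\<Sum>\<alpha>\<in>{0..<int M}. f (- \<alpha>))"
  by (rule sum.reindex_bij_witness[where i = uminus and j = uminus]) auto

text \<open>Skew-symmetric under the exchange of \<open>(z1, z2)\<close> and \<open>(- z2, - z1)\<close>.\<close>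

definition skew_sum :: "nat \<Rightarrow> complex \<Rightarrow> complex \<Rightarrow> complex \<Rightarrow> complex" where
  "skew_sum N \<tau> z1 z2 = lattice_sum N \<tau> z1 z2 - lattice_sum N \<tau> (- z2) (- z1)"

lemma skew_sum_inversion:
  assumes "Im \<tau> > 0"
  shows "skew_sum N (- 1 / \<tau>) (z1 / \<tau>) (z2 / \<tau>) = \<tau> * e2pi (of_nat N * (z1 * z2 / \<tau>)) * skew_sum N \<tau> z1 z2"
proof -
  have "lattice_sum N (- 1 / \<tau>) (- (z2 / \<tau>)) (- (z1 / \<tau>)) = \<tau> * e2pi (of_nat N * (z1 * z2 / \<tau>)) * lattice_sum N \<tau> (- z2) (- z1)"
    using lattice_sum_inversion[OF assms, of N "- z2" "- z1"] by (simp add: mult.commute)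
  then show ?thesis
    unfolding skew_sum_def lattice_sum_inversion[OF assms, of N z1 z2] by (simp only: right_diff_distrib)
qed

lemma skew_sum_translate:
  "Im \<tau> > 0 \<Longrightarrow> skew_sum N (\<tau> + of_nat k) z1 z2 = skew_sum N \<tau> z1 z2"
  unfolding skew_sum_def by (simp add: lattice_sum_translate_nat)

lemma skew_sum_add_ints:
  assumes "d1 \<in> \<int>" "d2 \<in> \<int>"
  shows "skew_sum N \<tau> (z1 + d1) (z2 + d2) = skew_sum N \<tau> z1 z2"
proof -
  obtain n1 n2 where d: "d1 = of_int n1" "d2 = of_int n2" using assms by (auto elim!: Ints_cases)
  have "lattice_sum N \<tau> (- (z2 + d2)) (- (z1 + d1)) = lattice_sum N \<tau> (- z2) (- z1)"
    using lattice_sum_add_ints[of N \<tau> "- z2" "- n2" "- z1" "- n1"] by (simp add: d)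
  then show ?thesis unfolding skew_sum_def d lattice_sum_add_ints by (simp add: d)
qed

text \<open>
  For the second lattice sum, at \<open>(- z2, - z1)\<close>, the roles of \<open>a\<close> and \<open>b\<close> are exchanged and their signs reversed; therefore
  \<open>lattice_sum_isogeny\<close> is used with \<open>- \<epsilon>\<close> and with the residues \<open>1 - M, ..., 0\<close>.
\<close>

lemma skew_sum_isogeny:
  fixes \<epsilon> :: real
  assumes "Im \<tau> > 0" "N > 0" "M > 0" "coprime (int N) (int M)" "\<epsilon> \<in> {0, 1 / 2}"
    and pole: "x1 + of_real \<epsilon> * \<tau> \<notin> coset 0 0 \<tau>" "- (x2 + of_real \<epsilon> * \<tau>) \<notin> coset 0 0 \<tau>"
  shows "(\<Sum>a\<in>idx M \<epsilon>. \<Sum>b\<in>idx M \<epsilon>.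
      e2pi (of_nat N / of_nat M * (of_real a * of_real b * \<tau> + of_real b * x1 + of_real a * x2))
      * skew_sum N (of_nat M * \<tau>) (x1 + of_real a * \<tau>) (x2 + of_real b * \<tau>))
    = e2pi (of_nat N / of_nat M * ((of_real \<epsilon>)\<^sup>2 * \<tau> + of_real \<epsilon> * (x1 + x2)))
      * skew_sum N (\<tau> / of_nat M) ((x1 + of_real \<epsilon> * \<tau>) / of_nat M) ((x2 + of_real \<epsilon> * \<tau>) / of_nat M)"
proof -
  let ?E = "\<lambda>a b::real. e2pi (of_nat N / of_nat M * (of_real a * of_real b * \<tau> + of_real b * x1 + of_real a * x2))"
  let ?c = "e2pi (of_nat N / of_nat M * ((of_real \<epsilon>)\<^sup>2 * \<tau> + of_real \<epsilon> * (x1 + x2)))"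
  have 1: "(\<Sum>a\<in>idx M \<epsilon>. \<Sum>b\<in>idx M \<epsilon>. ?E a b * lattice_sum N (of_nat M * \<tau>) (x1 + of_real a * \<tau>) (x2 + of_real b * \<tau>))
    = ?c * lattice_sum N (\<tau> / of_nat M) ((x1 + of_real \<epsilon> * \<tau>) / of_nat M) ((x2 + of_real \<epsilon> * \<tau>) / of_nat M)"
    unfolding sum_idx[OF assms(5)]
    using lattice_sum_isogeny[OF assms(1-4) pole(1), where l = 0 and ?x2.0 = x2] by simp
  have pole': "- x2 + of_real (- \<epsilon>) * \<tau> \<notin> coset 0 0 \<tau>" using pole(2) by simp
  have "(\<Sum>a\<in>idx M \<epsilon>. \<Sum>b\<in>idx M \<epsilon>. ?E a b * lattice_sum N (of_nat M * \<tau>) (- (x2 + of_real b * \<tau>)) (- (x1 + of_real a * \<tau>)))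
    = (\<Sum>b\<in>idx M \<epsilon>. \<Sum>a\<in>idx M \<epsilon>. ?E a b * lattice_sum N (of_nat M * \<tau>) (- (x2 + of_real b * \<tau>)) (- (x1 + of_real a * \<tau>)))"
    by (rule sum.swap)
  also have "\<dots> = (\<Sum>\<alpha>\<in>{0..<int M}. \<Sum>\<beta>\<in>{0..<int M}.
      e2pi (of_nat N / of_nat M * ((of_real (- \<epsilon>) + of_int (- \<alpha>)) * (of_real (- \<epsilon>) + of_int (- \<beta>)) * \<tau> + (of_real (- \<epsilon>) + of_int (- \<beta>)) * (- x2) + (of_real (- \<epsilon>) + of_int (- \<alpha>)) * (- x1)))
      * lattice_sum N (of_nat M * \<tau>) (- x2 + (of_real (- \<epsilon>) + of_int (- \<alpha>)) * \<tau>) (- x1 + (of_real (- \<epsilon>) + of_int (- \<beta>)) * \<tau>))"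
    unfolding sum_idx[OF assms(5)]
    by (intro sum.cong refl arg_cong2[where f = "(*)"] arg_cong[where f = e2pi] arg_cong2[where f = "lattice_sum N (of_nat M * \<tau>)"])
       (simp_all add: algebra_simps)
  also have "\<dots> = e2pi (of_nat N / of_nat M * ((of_real (- \<epsilon>))\<^sup>2 * \<tau> + of_real (- \<epsilon>) * (- x2 + - x1)))
      * lattice_sum N (\<tau> / of_nat M) ((- x2 + of_real (- \<epsilon>) * \<tau>) / of_nat M) ((- x1 + of_real (- \<epsilon>) * \<tau>) / of_nat M)"
    using lattice_sum_isogeny[OF assms(1-4) pole', where l = "1 - int M" and ?x2.0 = "- x1"]
    unfolding sum_neg_residues .
  also have "e2pi (of_nat N / of_nat M * ((of_real (- \<epsilon>))\<^sup>2 * \<tau> + of_real (- \<epsilon>) * (- x2 + - x1))) = ?c"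
    by (rule arg_cong[where f = e2pi]) (simp add: algebra_simps)
  also have "(- x2 + of_real (- \<epsilon>) * \<tau>) / of_nat M = - ((x2 + of_real \<epsilon> * \<tau>) / of_nat M)"
    by (simp add: minus_divide_left)
  also have "(- x1 + of_real (- \<epsilon>) * \<tau>) / of_nat M = - ((x1 + of_real \<epsilon> * \<tau>) / of_nat M)"
    by (simp add: minus_divide_left)
  finally have 2: "(\<Sum>a\<in>idx M \<epsilon>. \<Sum>b\<in>idx M \<epsilon>. ?E a b * lattice_sum N (of_nat M * \<tau>) (- (x2 + of_real b * \<tau>)) (- (x1 + of_real a * \<tau>)))
    = ?c * lattice_sum N (\<tau> / of_nat M) (- ((x2 + of_real \<epsilon> * \<tau>) / of_nat M)) (- ((x1 + of_real \<epsilon> * \<tau>) / of_nat M))" .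
  show ?thesis unfolding skew_sum_def right_diff_distrib sum_subtractf 1 2 ..
qed

lemma uminus_mem_lattice: "- z \<in> coset 0 0 \<tau> \<Longrightarrow> z \<in> coset 0 0 \<tau>"
proof -
  assume "- z \<in> coset 0 0 \<tau>"
  then obtain a b :: int where "- z = of_int a * \<tau> + of_int b" unfolding mem_lattice_iff by blast
  then have "z = of_int (- a) * \<tau> + of_int (- b)" by (simp add: minus_equation_iff[of z] algebra_simps)
  then show "z \<in> coset 0 0 \<tau>" unfolding mem_lattice_iff by blast
qed

lemma Phi_mod_eq_skew_sum:
  assumes "Im \<tau> > 0" "z1 \<notin> coset 0 0 \<tau>" "z2 \<notin> coset 0 0 \<tau>"
  shows "Phi_mod m s \<tau> z1 z2 t = e2pi (of_nat (m + 1) * t) * (\<i> / (2 * of_real pi)) * skew_sum (m + 1) \<tau> z1 z2"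
  unfolding skew_sum_def
  by (rule Phi_mod_eq_lattice_sums[OF assms(1,2)]) (use assms(3) uminus_mem_lattice in blast)

lemma mem_coset_inversion:
  assumes "\<tau> \<noteq> 0" "2 * \<epsilon>' \<in> \<int>" "c - \<epsilon> \<in> \<int>" "d - \<epsilon>' \<in> \<int>" "z = of_real c * \<tau> + of_real d"
  shows "z / \<tau> \<in> coset \<epsilon> \<epsilon>' (- 1 / \<tau>)"
proof -
  have "z / \<tau> = of_real c + of_real (- d) * (- 1 / \<tau>)" using assms by (simp add: field_simps)
  moreover have "- d - \<epsilon>' = - (d - \<epsilon>') - 2 * \<epsilon>'" by simp
  then have "- d - \<epsilon>' \<in> \<int>" using assms by (metis Ints_diff Ints_minus)
  ultimately show ?thesis using assms(3) unfolding coset_def by blast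
qed

lemma mem_coset_translate:
  assumes "c - \<epsilon>' \<in> \<int>" "d - c - \<epsilon> \<in> \<int>" "z = of_real c * \<tau> + of_real d"
  shows "z \<in> coset \<epsilon> \<epsilon>' (\<tau> + 1)"
proof -
  have "z = of_real (d - c) + of_real c * (\<tau> + 1)" using assms by (simp add: algebra_simps)
  then show ?thesis using assms unfolding coset_def by blast
qed

text \<open>
  The modulus on the left is \<open>- M / \<tau>\<close>, the inverse of \<open>\<tau> / M\<close>. Inversion leads to a sum of modulus \<open>\<tau> / M\<close>, which
  \<open>skew_sum_isogeny\<close> expands into sums of modulus \<open>M * \<tau>\<close>. It is used at \<open>x1 = z1 - j\<close> and \<open>x2 = z2 - k\<close>; these shifts yield the
  factors \<open>e2pi (- N / M * (a * k + b * j))\<close>. The arguments of \<open>Psi_mod\<close> on the right contain \<open>z1 + \<epsilon>'\<close> instead, but \<open>j + \<epsilon>'\<close> is an integer.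
\<close>

lemma Psi_mod_inversion:
  assumes "M > 0" "coprime (int (m + 1)) (int M)"
    and \<epsilon>: "\<epsilon> \<in> {0, 1 / 2}" "\<epsilon>' \<in> {0, 1 / 2}"
    and jk: "j \<in> idx M \<epsilon>'" "k \<in> idx M \<epsilon>'"
    and "Im \<tau> > 0"
    and pole: "z1 / \<tau> \<notin> coset \<epsilon> \<epsilon>' (- 1 / \<tau>)" "z2 / \<tau> \<notin> coset \<epsilon> \<epsilon>' (- 1 / \<tau>)"
  shows "Psi_mod M m s \<epsilon> \<epsilon>' j k (- 1 / \<tau>) (z1 / \<tau>) (z2 / \<tau>) (t - z1 * z2 / \<tau>) =
    \<tau> / of_nat M * (\<Sum>a\<in>idx M \<epsilon>. \<Sum>b\<in>idx M \<epsilon>.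
      e2pi (- (of_nat (m + 1) / of_nat M) * of_real (a * k + b * j)) * Psi_mod M m s \<epsilon>' \<epsilon> a b \<tau> z1 z2 t)"
proof -
  define N where "N = m + 1"
  have N: "N > 0" "coprime (int N) (int M)" using assms(2) by (simp_all add: N_def)
  define mm where "mm = (of_nat M :: complex)"
  have m0: "mm \<noteq> 0" using assms(1) by (simp add: mm_def)
  have t0: "\<tau> \<noteq> 0" using assms(7) by auto
  have int2: "2 * \<epsilon> \<in> \<int>" "2 * \<epsilon>' \<in> \<int>" using \<epsilon> by (elim insertE emptyE; hypsubst; simp)+
  have jk': "j - \<epsilon>' \<in> \<int>" "k - \<epsilon>' \<in> \<int>" using jk by (auto simp: idx_def)
  have jk'': "j + \<epsilon>' \<in> \<int>" "k + \<epsilon>' \<in> \<int>"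
    using Ints_add[OF jk'(1) int2(2)] Ints_add[OF jk'(2) int2(2)] by (simp_all add: algebra_simps)
  define e where "e = complex_of_real \<epsilon>"
  \<comment> \<open>the shifts by \<open>j\<close> and \<open>k\<close> belong to the translations by \<open>j * (- 1 / \<tau>)\<close> and \<open>k * (- 1 / \<tau>)\<close> on the left\<close>
  define x1 x2 where "x1 = z1 - of_real j" and "x2 = z2 - of_real k"
  define \<tau>1 where "\<tau>1 = \<tau> / mm"
  have im1: "Im \<tau>1 > 0" using assms(1,7) by (simp add: \<tau>1_def mm_def)
  define X1 X2 where "X1 = (x1 + e * \<tau>) / mm" and "X2 = (x2 + e * \<tau>) / mm"
  define q where "q = \<i> / (2 * complex_of_real pi)"
  have np: "z \<noteq> of_real c * \<tau> + of_real d" if "z / \<tau> \<notin> coset \<epsilon> \<epsilon>' (- 1 / \<tau>)" "c - \<epsilon> \<in> \<int>" "d - \<epsilon>' \<in> \<int>" for z c d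
    using mem_coset_inversion[OF t0 int2(2) that(2,3)] that(1) by blast
  have pole_x: "z - of_real i + e * \<tau> \<notin> coset 0 0 \<tau>" if z: "z / \<tau> \<notin> coset \<epsilon> \<epsilon>' (- 1 / \<tau>)" and i: "i - \<epsilon>' \<in> \<int>" for z i
  proof
    assume "z - of_real i + e * \<tau> \<in> coset 0 0 \<tau>"
    then obtain a b :: int where "z - of_real i + e * \<tau> = of_int a * \<tau> + of_int b" unfolding mem_lattice_iff by blast
    then have "z = of_real (of_int a - \<epsilon>) * \<tau> + of_real (of_int b + i)" by (simp add: e_def algebra_simps)
    moreover have "of_int a - \<epsilon> - \<epsilon> = of_int a - 2 * \<epsilon>" "of_int b + i - \<epsilon>' = of_int b + (i - \<epsilon>')" by simp_all
    then have "of_int a - \<epsilon> - \<epsilon> \<in> \<int>" "of_int b + i - \<epsilon>' \<in> \<int>" using int2 i by (metis Ints_diff Ints_of_int, metis Ints_add Ints_of_int)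
    ultimately show False using np[OF z] by blast
  qed
  have pole_l: "z / \<tau> + of_real i * (- 1 / \<tau>) + e \<notin> coset 0 0 (mm * (- 1 / \<tau>))" if z: "z / \<tau> \<notin> coset \<epsilon> \<epsilon>' (- 1 / \<tau>)" and i: "i - \<epsilon>' \<in> \<int>" for z i
  proof
    assume "z / \<tau> + of_real i * (- 1 / \<tau>) + e \<in> coset 0 0 (mm * (- 1 / \<tau>))"
    then obtain a b :: int where "z / \<tau> + of_real i * (- 1 / \<tau>) + e = of_int a * (mm * (- 1 / \<tau>)) + of_int b" unfolding mem_lattice_iff by blast
    then have "z - of_real i + e * \<tau> = of_int b * \<tau> + of_int (- a * int M)" using t0 by (simp add: mm_def field_simps)
    with pole_x[OF z i] show False unfolding mem_lattice_iff by blast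
  qed
  have pole_r: "z + of_real a * \<tau> + of_real \<epsilon>' \<notin> coset 0 0 (mm * \<tau>)" if z: "z / \<tau> \<notin> coset \<epsilon> \<epsilon>' (- 1 / \<tau>)" and a: "a \<in> idx M \<epsilon>" for z a
  proof
    have a': "a - \<epsilon> \<in> \<int>" using a by (auto simp: idx_def)
    assume "z + of_real a * \<tau> + of_real \<epsilon>' \<in> coset 0 0 (mm * \<tau>)"
    then obtain c d :: int where "z + of_real a * \<tau> + of_real \<epsilon>' = of_int c * (mm * \<tau>) + of_int d" unfolding mem_lattice_iff by blast
    then have "z = of_real (of_int (c * int M) - a) * \<tau> + of_real (of_int d - \<epsilon>')" by (simp add: mm_def algebra_simps)
    moreover have "of_int (c * int M) - a - \<epsilon> \<in> \<int>" "of_int d - \<epsilon>' - \<epsilon>' \<in> \<int>"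
      using Ints_diff[OF Ints_diff[OF Ints_of_int a'] int2(1), of "c * int M"] Ints_diff[OF Ints_of_int int2(2), of d]
      by (simp_all add: algebra_simps)
    ultimately show False using np[OF z] by blast
  qed
  have Z: "z / \<tau> + of_real i * (- 1 / \<tau>) + e = ((z - of_real i + e * \<tau>) / mm) / \<tau>1" for z i
    using t0 m0 by (simp add: \<tau>1_def field_simps)
  have M1: "mm * (- 1 / \<tau>) = - 1 / \<tau>1" by (simp add: \<tau>1_def)
  have imM: "Im (mm * (- 1 / \<tau>)) > 0" unfolding M1 by (rule Im_minus_inverse[OF im1])
  have Phi_l: "Phi_mod m s (mm * (- 1 / \<tau>)) (z1 / \<tau> + of_real j * (- 1 / \<tau>) + e) (z2 / \<tau> + of_real k * (- 1 / \<tau>) + e) ((t - z1 * z2 / \<tau>) / mm)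
     = e2pi (of_nat N * ((t - z1 * z2 / \<tau>) / mm)) * q * (\<tau>1 * e2pi (of_nat N * (X1 * X2 / \<tau>1)) * skew_sum N \<tau>1 X1 X2)"
    unfolding Phi_mod_eq_skew_sum[OF imM pole_l[OF pole(1) jk'(1)] pole_l[OF pole(2) jk'(2)]] N_def[symmetric] q_def[symmetric]
    unfolding Z M1 skew_sum_inversion[OF im1] X1_def x1_def X2_def x2_def ..
  define D where "D = (\<lambda>a b::real. skew_sum N (mm * \<tau>) (x1 + of_real a * \<tau>) (x2 + of_real b * \<tau>))"
  have imM': "Im (mm * \<tau>) > 0" using assms(1,7) by (simp add: mm_def)
  have Phi_r: "Phi_mod m s (mm * \<tau>) (z1 + of_real a * \<tau> + of_real \<epsilon>') (z2 + of_real b * \<tau> + of_real \<epsilon>') (t / mm) = e2pi (of_nat N * (t / mm)) * q * D a b"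
    if ab: "a \<in> idx M \<epsilon>" "b \<in> idx M \<epsilon>" for a b
  proof -
    have s1: "z1 + of_real a * \<tau> + of_real \<epsilon>' = (x1 + of_real a * \<tau>) + of_real (j + \<epsilon>')" "z2 + of_real b * \<tau> + of_real \<epsilon>' = (x2 + of_real b * \<tau>) + of_real (k + \<epsilon>')"
      by (simp_all add: x1_def x2_def)
    have ints: "complex_of_real (j + \<epsilon>') \<in> \<int>" "complex_of_real (k + \<epsilon>') \<in> \<int>"
      using jk'' by (auto elim!: Ints_cases simp del: of_real_add)
    show ?thesis
      unfolding Phi_mod_eq_skew_sum[OF imM' pole_r[OF pole(1) ab(1)] pole_r[OF pole(2) ab(2)]] N_def[symmetric] q_def[symmetric]
      unfolding s1 skew_sum_add_ints[OF ints] D_def ..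
  qed
  define E where "E = (\<lambda>a b::real. e2pi (of_nat N / mm * (of_real a * of_real b * \<tau> + of_real b * x1 + of_real a * x2)))"
  have iso: "(\<Sum>a\<in>idx M \<epsilon>. \<Sum>b\<in>idx M \<epsilon>. E a b * D a b) = e2pi (of_nat N / mm * (e\<^sup>2 * \<tau> + e * (x1 + x2))) * skew_sum N \<tau>1 X1 X2"
  proof -
    have p1: "x1 + of_real \<epsilon> * \<tau> \<notin> coset 0 0 \<tau>" using pole_x[OF pole(1) jk'(1)] by (simp add: x1_def e_def)
    have p2: "- (x2 + of_real \<epsilon> * \<tau>) \<notin> coset 0 0 \<tau>"
      using pole_x[OF pole(2) jk'(2)] uminus_mem_lattice[of "x2 + of_real \<epsilon> * \<tau>" \<tau>] by (auto simp: x2_def e_def)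
    show ?thesis unfolding E_def D_def \<tau>1_def X1_def X2_def e_def mm_def
      by (rule skew_sum_isogeny[OF assms(7) N(1) assms(1) N(2) \<epsilon>(1) p1 p2])
  qed
  have term_r: "e2pi (- (of_nat (m + 1) / of_nat M) * of_real (a * k + b * j)) * Psi_mod M m s \<epsilon>' \<epsilon> a b \<tau> z1 z2 t
      = e2pi (of_nat N * (t / mm)) * q * (E a b * D a b)" if ab: "a \<in> idx M \<epsilon>" "b \<in> idx M \<epsilon>" for a b
  proof -
    have "- (of_nat N / mm) * of_real (a * k + b * j) + (of_real (of_nat N * a * b / of_nat M) * \<tau> + of_nat N / mm * (of_real b * z1 + of_real a * z2))
       = of_nat N / mm * (of_real a * of_real b * \<tau> + of_real b * x1 + of_real a * x2)"
      using m0 by (simp add: mm_def x1_def x2_def field_simps)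
    then have "e2pi (- (of_nat N / mm) * of_real (a * k + b * j)) * (qpow \<tau> (of_nat N * a * b / of_nat M) * e2pi (of_nat N / mm * (of_real b * z1 + of_real a * z2))) = E a b"
      unfolding E_def qpow_def e2pi_add[symmetric] by (simp only:)
    then show ?thesis
      unfolding Psi_mod_def N_def[symmetric] mm_def[symmetric] Phi_r[OF ab] mult.assoc[symmetric]
      by (simp only: mult_ac)
  qed
  have pref: "qpow (- 1 / \<tau>) (of_nat N * j * k / of_nat M) * e2pi (of_nat N / mm * (of_real k * (z1 / \<tau>) + of_real j * (z2 / \<tau>)))
      * (e2pi (of_nat N * ((t - z1 * z2 / \<tau>) / mm)) * e2pi (of_nat N * (X1 * X2 / \<tau>1)))
    = e2pi (of_nat N * (t / mm)) * e2pi (of_nat N / mm * (e\<^sup>2 * \<tau> + e * (x1 + x2)))"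
    unfolding qpow_def e2pi_add[symmetric]
    by (rule arg_cong[where f = e2pi]) (use t0 m0 in \<open>simp add: X1_def X2_def x1_def x2_def \<tau>1_def mm_def field_simps power2_eq_square\<close>)
  have "Psi_mod M m s \<epsilon> \<epsilon>' j k (- 1 / \<tau>) (z1 / \<tau>) (z2 / \<tau>) (t - z1 * z2 / \<tau>)
     = (qpow (- 1 / \<tau>) (of_nat N * j * k / of_nat M) * e2pi (of_nat N / mm * (of_real k * (z1 / \<tau>) + of_real j * (z2 / \<tau>)))
      * (e2pi (of_nat N * ((t - z1 * z2 / \<tau>) / mm)) * e2pi (of_nat N * (X1 * X2 / \<tau>1)))) * (q * \<tau>1 * skew_sum N \<tau>1 X1 X2)"
    unfolding Psi_mod_def N_def[symmetric] mm_def[symmetric] e_def[symmetric] Phi_l by (simp only: mult_ac)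
  also have "\<dots> = \<tau>1 * (e2pi (of_nat N * (t / mm)) * q * (\<Sum>a\<in>idx M \<epsilon>. \<Sum>b\<in>idx M \<epsilon>. E a b * D a b))"
    unfolding pref iso by (simp only: mult_ac)
  also have "\<dots> = \<tau>1 * (\<Sum>a\<in>idx M \<epsilon>. \<Sum>b\<in>idx M \<epsilon>.
      e2pi (- (of_nat (m + 1) / of_nat M) * of_real (a * k + b * j)) * Psi_mod M m s \<epsilon>' \<epsilon> a b \<tau> z1 z2 t)"
    unfolding sum_distrib_left
    by (intro sum.cong refl) (simp only: term_r)
  finally show ?thesis unfolding \<tau>1_def mm_def .
qed

text \<open>
  The modulus \<open>M * \<tau>\<close> increases by the integer \<open>M\<close>, and with \<open>\<delta> = \<bar>\<epsilon> - \<epsilon>'\<bar>\<close> the arguments change by the integers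
  \<open>j + \<epsilon> - \<delta>\<close> and \<open>k + \<epsilon> - \<delta>\<close>. Neither affects \<open>skew_sum\<close>.
\<close>

lemma Psi_mod_translate:
  assumes "M > 0"
    and \<epsilon>: "\<epsilon> \<in> {0, 1 / 2}" "\<epsilon>' \<in> {0, 1 / 2}"
    and jk: "j \<in> idx M \<epsilon>'" "k \<in> idx M \<epsilon>'"
    and "Im \<tau> > 0"
    and pole: "z1 \<notin> coset \<epsilon> \<epsilon>' (\<tau> + 1)" "z2 \<notin> coset \<epsilon> \<epsilon>' (\<tau> + 1)"
  shows "Psi_mod M m s \<epsilon> \<epsilon>' j k (\<tau> + 1) z1 z2 t =
    e2pi (of_real (of_nat (m + 1) * j * k / of_nat M)) * Psi_mod M m s \<bar>\<epsilon> - \<epsilon>'\<bar> \<epsilon>' j k \<tau> z1 z2 t"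
proof -
  define \<delta> where "\<delta> = \<bar>\<epsilon> - \<epsilon>'\<bar>"
  have int2: "2 * \<epsilon> \<in> \<int>" "2 * \<epsilon>' \<in> \<int>" "\<epsilon>' + \<epsilon> - \<delta> \<in> \<int>" "\<epsilon>' - \<epsilon> - \<delta> \<in> \<int>" 
    unfolding \<delta>_def using \<epsilon> by (elim insertE emptyE; hypsubst; simp)+
  have jk': "j - \<epsilon>' \<in> \<int>" "k - \<epsilon>' \<in> \<int>" using jk by (auto simp: idx_def)
  have np: "z \<noteq> of_real c * \<tau> + of_real d" if "z \<notin> coset \<epsilon> \<epsilon>' (\<tau> + 1)" "c - \<epsilon>' \<in> \<int>" "d - c - \<epsilon> \<in> \<int>" for z c d
    using mem_coset_translate[OF that(2,3)] that(1) by blast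
  have pole_l: "z + of_real i * (\<tau> + 1) + of_real \<epsilon> \<notin> coset 0 0 (of_nat M * (\<tau> + 1))" if z: "z \<notin> coset \<epsilon> \<epsilon>' (\<tau> + 1)" and i: "i - \<epsilon>' \<in> \<int>" for z i
  proof
    assume "z + of_real i * (\<tau> + 1) + of_real \<epsilon> \<in> coset 0 0 (of_nat M * (\<tau> + 1))"
    then obtain a b :: int where "z + of_real i * (\<tau> + 1) + of_real \<epsilon> = of_int a * (of_nat M * (\<tau> + 1)) + of_int b" unfolding mem_lattice_iff by blast
    then have "z = of_real (of_int (a * int M) - i) * \<tau> + of_real (of_int (a * int M) - i + of_int b - \<epsilon>)" by (simp add: algebra_simps)
    moreover have "of_int (a * int M) - i - \<epsilon>' \<in> \<int>" "of_int (a * int M) - i + of_int b - \<epsilon> - (of_int (a * int M) - i) - \<epsilon> \<in> \<int>"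
      using Ints_diff[OF Ints_diff[OF Ints_of_int i] int2(2), of "a * int M"] Ints_diff[OF Ints_of_int int2(1), of b]
      by (simp_all add: algebra_simps)
    ultimately show False using np[OF z] by blast
  qed
  have pole_r: "z + of_real i * \<tau> + of_real \<delta> \<notin> coset 0 0 (of_nat M * \<tau>)" if z: "z \<notin> coset \<epsilon> \<epsilon>' (\<tau> + 1)" and i: "i - \<epsilon>' \<in> \<int>" for z i
  proof
    assume "z + of_real i * \<tau> + of_real \<delta> \<in> coset 0 0 (of_nat M * \<tau>)"
    then obtain a b :: int where "z + of_real i * \<tau> + of_real \<delta> = of_int a * (of_nat M * \<tau>) + of_int b" unfolding mem_lattice_iff by blast
    then have "z = of_real (of_int (a * int M) - i) * \<tau> + of_real (of_int b - \<delta>)" by (simp add: algebra_simps)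
    moreover have "of_int (a * int M) - i - \<epsilon>' \<in> \<int>" "of_int b - \<delta> - (of_int (a * int M) - i) - \<epsilon> \<in> \<int>"
      using Ints_diff[OF Ints_diff[OF Ints_of_int i] int2(2), of "a * int M"]
        Ints_add[OF Ints_add[OF Ints_of_int i] int2(4), of "b - a * int M"]
      by (simp_all add: algebra_simps)
    ultimately show False using np[OF z] by blast
  qed
  have im: "Im (of_nat M * (\<tau> + 1)) > 0" "Im (of_nat M * \<tau>) > 0" using assms by simp_all
  have shift: "z + of_real i * (\<tau> + 1) + of_real \<epsilon> = (z + of_real i * \<tau> + of_real \<delta>) + of_real (i + \<epsilon> - \<delta>)" for z i
    by (simp add: algebra_simps)
  have ints: "complex_of_real (i + \<epsilon> - \<delta>) \<in> \<int>" if "i - \<epsilon>' \<in> \<int>" for i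
  proof -
    have "i + \<epsilon> - \<delta> = (i - \<epsilon>') + (\<epsilon>' + \<epsilon> - \<delta>)" by simp
    then have "i + \<epsilon> - \<delta> \<in> \<int>" using that int2(3) by (simp only: Ints_add)
    then obtain n where "i + \<epsilon> - \<delta> = of_int n" by (elim Ints_cases)
    then show ?thesis by (simp only: of_real_of_int_eq Ints_of_int)
  qed
  have "skew_sum (m + 1) (of_nat M * (\<tau> + 1)) (z1 + of_real j * (\<tau> + 1) + of_real \<epsilon>) (z2 + of_real k * (\<tau> + 1) + of_real \<epsilon>)
      = skew_sum (m + 1) (of_nat M * \<tau>) (z1 + of_real j * \<tau> + of_real \<delta>) (z2 + of_real k * \<tau> + of_real \<delta>)"
    unfolding shift skew_sum_add_ints[OF ints[OF jk'(1)] ints[OF jk'(2)]]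
    using skew_sum_translate[OF im(2), of "m + 1" M] by (simp add: distrib_left)
  then have Phi: "Phi_mod m s (of_nat M * (\<tau> + 1)) (z1 + of_real j * (\<tau> + 1) + of_real \<epsilon>) (z2 + of_real k * (\<tau> + 1) + of_real \<epsilon>) (t / of_nat M)
      = Phi_mod m s (of_nat M * \<tau>) (z1 + of_real j * \<tau> + of_real \<delta>) (z2 + of_real k * \<tau> + of_real \<delta>) (t / of_nat M)"
    unfolding Phi_mod_eq_skew_sum[OF im(1) pole_l[OF pole(1) jk'(1)] pole_l[OF pole(2) jk'(2)]]
      Phi_mod_eq_skew_sum[OF im(2) pole_r[OF pole(1) jk'(1)] pole_r[OF pole(2) jk'(2)]] by (simp only:)
  have "qpow (\<tau> + 1) x = e2pi (of_real x) * qpow \<tau> x" for x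
    unfolding qpow_def e2pi_add[symmetric] by (simp add: algebra_simps)
  then show ?thesis unfolding Psi_mod_def Phi \<delta>_def[symmetric] by (simp only: mult.assoc)
qed

theorem theorem3p9:
  fixes M m s :: nat and \<epsilon> \<epsilon>' j k :: real and \<tau> z1 z2 t :: complex
  assumes "M > 0"
    and "m > 0 \<Longrightarrow> gcd M (2 * m + 2) = 1"
    and "s \<le> m"
    and "\<epsilon> \<in> {0, 1 / 2}" and "\<epsilon>' \<in> {0, 1 / 2}"
    and "j \<in> idx M \<epsilon>'" and "k \<in> idx M \<epsilon>'"
    and "Im \<tau> > 0"
  shows "(pole_free \<epsilon> \<epsilon>' (- 1 / \<tau>) (z1 / \<tau>) (z2 / \<tau>) \<longrightarrow>
            ch_mod M m s \<epsilon> \<epsilon>' j k (- 1 / \<tau>) (z1 / \<tau>) (z2 / \<tau>) (t - z1 * z2 / \<tau>) =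
            (-1) powr of_real (4 * \<epsilon> * \<epsilon>') * (1 / of_nat M)
            * (\<Sum>a\<in>idx M \<epsilon>. \<Sum>b\<in>idx M \<epsilon>.
                 e2pi (- (of_nat (m + 1) / of_nat M) * of_real (a * k + b * j))
                 * ch_mod M m s \<epsilon>' \<epsilon> a b \<tau> z1 z2 t))
       \<and> (pole_free \<epsilon> \<epsilon>' (\<tau> + 1) z1 z2 \<longrightarrow>
            ch_mod M m s \<epsilon> \<epsilon>' j k (\<tau> + 1) z1 z2 t =
            exp (2 * of_real pi * \<i> * of_real (of_nat (m + 1) * j * k / of_nat M)
                 - of_real pi * \<i> * of_real \<epsilon>')
            * ch_mod M m s \<bar>\<epsilon> - \<epsilon>'\<bar> \<epsilon>' j k \<tau> z1 z2 t)"
proof (intro conjI impI)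
  assume pf: "pole_free \<epsilon> \<epsilon>' (- 1 / \<tau>) (z1 / \<tau>) (z2 / \<tau>)"
  then have p: "z1 / \<tau> \<notin> coset \<epsilon> \<epsilon>' (- 1 / \<tau>)" "z2 / \<tau> \<notin> coset \<epsilon> \<epsilon>' (- 1 / \<tau>)"
    by (simp_all add: pole_free_def)
  have cop: "coprime (int (m + 1)) (int M)"
  proof (cases "m = 0")
    case False
    then have "coprime M (2 * (m + 1))" using assms(2) by (simp add: coprime_iff_gcd_eq_1)
    then have "coprime M (m + 1)" by (simp only: coprime_mult_right_iff)
    then have "coprime (m + 1) M" by (simp only: coprime_commute)
    then show ?thesis by (simp only: coprime_int_iff)
  qed simp
  let ?S = "(-1) powr complex_of_real (4 * \<epsilon> * \<epsilon>')" and ?R = "R_hat \<epsilon>' \<epsilon> \<tau> z1 z2 t"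
  \<comment> \<open>the sign arises in the denominator, and it is its own inverse\<close>
  have sgn: "?S * ?S = 1"
    using assms(4,5) by (elim insertE emptyE; hypsubst) (simp_all add: minus_one_powr)
  then have S: "1 / ?S = ?S" "?S \<noteq> 0" by (auto simp: field_simps)
  have t0: "\<tau> \<noteq> 0" using assms(8) by auto
  have "ch_mod M m s \<epsilon> \<epsilon>' j k (- 1 / \<tau>) (z1 / \<tau>) (z2 / \<tau>) (t - z1 * z2 / \<tau>)
    = \<tau> / of_nat M * (\<Sum>a\<in>idx M \<epsilon>. \<Sum>b\<in>idx M \<epsilon>.
      e2pi (- (of_nat (m + 1) / of_nat M) * of_real (a * k + b * j)) * Psi_mod M m s \<epsilon>' \<epsilon> a b \<tau> z1 z2 t) / (?S * \<tau> * ?R)"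
    unfolding ch_mod_def R_hat_inversion[OF assms(8,4,5)] Psi_mod_inversion[OF assms(1) cop assms(4-8) p] ..
  also have "\<dots> = (1 / ?S) * (1 / of_nat M) * ((\<Sum>a\<in>idx M \<epsilon>. \<Sum>b\<in>idx M \<epsilon>.
      e2pi (- (of_nat (m + 1) / of_nat M) * of_real (a * k + b * j)) * Psi_mod M m s \<epsilon>' \<epsilon> a b \<tau> z1 z2 t) / ?R)"
    using t0 by simp
  also have "\<dots> = ?S * (1 / of_nat M) * (\<Sum>a\<in>idx M \<epsilon>. \<Sum>b\<in>idx M \<epsilon>.
      e2pi (- (of_nat (m + 1) / of_nat M) * of_real (a * k + b * j)) * ch_mod M m s \<epsilon>' \<epsilon> a b \<tau> z1 z2 t)"
    unfolding S ch_mod_def sum_divide_distrib times_divide_eq_right ..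
  finally show "ch_mod M m s \<epsilon> \<epsilon>' j k (- 1 / \<tau>) (z1 / \<tau>) (z2 / \<tau>) (t - z1 * z2 / \<tau>) =
      ?S * (1 / of_nat M) * (\<Sum>a\<in>idx M \<epsilon>. \<Sum>b\<in>idx M \<epsilon>.
        e2pi (- (of_nat (m + 1) / of_nat M) * of_real (a * k + b * j)) * ch_mod M m s \<epsilon>' \<epsilon> a b \<tau> z1 z2 t)" .
next
  assume pf: "pole_free \<epsilon> \<epsilon>' (\<tau> + 1) z1 z2"
  have "exp (2 * of_real pi * \<i> * of_real (of_nat (m + 1) * j * k / of_nat M) - of_real pi * \<i> * of_real \<epsilon>')
      = e2pi (of_real (of_nat (m + 1) * j * k / of_nat M)) / e2pi (of_real \<epsilon>' / 2)"
    unfolding e2pi_def exp_diff by (simp add: mult.assoc)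
  then show "ch_mod M m s \<epsilon> \<epsilon>' j k (\<tau> + 1) z1 z2 t =
            exp (2 * of_real pi * \<i> * of_real (of_nat (m + 1) * j * k / of_nat M)
                 - of_real pi * \<i> * of_real \<epsilon>')
            * ch_mod M m s \<bar>\<epsilon> - \<epsilon>'\<bar> \<epsilon>' j k \<tau> z1 z2 t"
    using Psi_mod_translate[OF assms(1,4,5,6,7,8), where m = m and s = s and t = t] pf
    unfolding ch_mod_def R_hat_translate[OF assms(4,5)] pole_free_def by simp
qed

end
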